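(* Let $G=GL(r,\mathbb C)$, let $M$ be a complex manifold and $\mathcal U=\{U_i\}_{i\in I}$ an open cover of $M$. With the maps $\beta,\gamma,\iota,\kappa$ and $\mathbf{Tot}(\mathbf{Ch}(\check N\mathcal U))$ defined in the context, the diagram of simplicial sets consisting of $$\mathbb{C}\mathcal{M}an^{\mathbf\Delta^{op}}(\check N\mathcal U^{[\bullet]},BG)\xrightarrow{\ \gamma\ }(\check C^\bullet(\mathcal U^{[\bullet]},\Omega^\bullet_{hol}))^{even}_{closed}\xrightarrow{\ \iota\ }\underline{DK}(\check C^\bullet(\mathcal U,\Omega^\bullet_{hol})[u]^{\bullet\le0})$$ and $$\mathbb{C}\mathcal{M}an^{\mathbf\Delta^{op}}(\check N\mathcal U^{[\bullet]},BG)\xrightarrow{\ \beta\ }\mathbf{Tot}(\mathbf{HVB}(\check N\mathcal U))\xrightarrow{\mathbf{Tot}(\mathbf{Ch}(\check N\mathcal U))}\mathbf{Tot}(\mathbf\Omega(\check N\mathcal U))\xrightarrow{\ \kappa\ }\underline{DK}(\check C^\bullet(\mathcal U,\Omega^\bullet_{hol})[u]^{\bullet\le0})$$ is a commutative diagram of simplicial sets, i.e. $\iota\circ\gamma=\kappa\circ\mathbf{Tot}(\mathbf{Ch}(\check N\mathcal U))\circ\beta$.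
   Context: **Complexes.** $u$ is a formal variable of degree $-2$. For a non-negatively graded cochain complex $C$, $C[u]^{\bullet\le0}=Q(C)$ denotes the quotient of $C\otimes\mathbb Z[u]$ (polynomials in $u$, with $du=0$) by all elements of positive degree. $\Omega^\bullet_{hol}(U)$ denotes holomorphic forms on $U$ with zero differential. $N(\mathbb ZK)$ is the complex of normalized chains of a simplicial set $K$, placed in non-positive degrees; $N(\mathbb Z\Delta^k)$ is in degree $-\ell$ free on $e_{i_0,\dots,i_\ell}$ ($0\le i_0<\dots<i_\ell\le k$), with $d(e_{i_0,\dots,i_\ell})=\sum_j(-1)^je_{i_0,\dots,\widehat{i_j},\dots,i_\ell}$. For a non-positively graded complex $C$, $\underline{DK}(C)$ is the simplicial set with $\underline{DK}(C)_k$ the set of cochain maps $N(\mathbb Z\Delta^k)\to C$. **Presheaves and $\mathbf{Ch}$.** $\mathbf{HVB}(U)$ is the nerve of the groupoid of finite rank holomorphic vector bundles with holomorphic connection on $U$, with morphisms all holomorphic bundle isomorphisms (not required to respect connections). $\mathbf\Omega(U)=\underline{DK}(\Omega^\bullet_{hol}(U)[u]^{\bullet\le0})$. $\mathbf{Ch}(U):\mathbf{HVB}(U)\to\mathbf\Omega(U)$ sends $E_0\xrightarrow{f_1}\dots\xrightarrow{f_k}E_k$ to the chain map $e_i\mapsto\dim E_i$, $e_{i_0,\dots,i_\ell}\mapsto\mathrm{tr}\big(\tilde f_{i_\ell,i_0}^{-1}\nabla_{i_\ell,i_{\ell-1}}(\tilde f_{i_\ell,i_{\ell-1}})\cdots\nabla_{i_1,i_0}(\tilde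 f_{i_1,i_0})\big)u^\ell$ for $\ell>0$, with $\tilde f_{q,p}=f_q\circ\dots\circ f_{p+1}$ and $\nabla_{q,p}$ the induced connection on $Hom(E_p,E_q)$. **Čech nerve and totalization.** $\check N\mathcal U_k=\coprod_{i_0,\dots,i_k\in I}U_{i_0,\dots,i_k}$ (intersections), with faces the inclusions omitting an index and degeneracies repeating an index. For a cosimplicial simplicial set $X$, $\mathbf{Tot}(X)$ has as $n$-simplices the families of simplicial maps $(F_\ell:\Delta^\ell\times\Delta^n\to X^\ell)_{\ell\ge0}$ with $F_m\circ(\rho_*\times\mathrm{id})=X(\rho)\circ F_k$ for all $\rho:[k]\to[m]$. $\mathbf{HVB}(\check N\mathcal U)$ and $\mathbf\Omega(\check N\mathcal U)$ are the cosimplicial simplicial sets $[\ell]\mapsto\mathbf{HVB}(\check N\mathcal U_\ell)$, $[\ell]\mapsto\mathbf\Omega(\check N\mathcal U_\ell)$, and $\mathbf{Tot}(\mathbf{Ch}(\check N\mathcal U))$ is postcomposition with the maps $\mathbf{Ch}(\check N\mathcal U_\ell)$. **The top left corner.** $\mathcal U^{[n]}$ is the cover with index set $I^{[n]}=\{i^{(j)}=(i,j):i\in I,0\le j\le n\}$ and $U_{i^{(j)}}=U_i$; a morphism $\rho:[n]\to[m]$ induces $i^{(j)}\mapsto i^{(\rho(j))}$, making $\mathcal U^{[\bullet]}$ a cosimplicial cover. $BG$ is the simplicial manifold $BG_n=G^{\times n}$ with $d_0(g_1,\dots,g_n)=(g_2,\dots,g_n)$, $d_j(g_1,\dots,g_n)=(g_1,\dots,g_jg_{j+1},\dots,g_n)$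 for $0<j<n$, $d_n(g_1,\dots,g_n)=(g_1,\dots,g_{n-1})$, and $s_j$ inserting $1$. $\mathbb{C}\mathcal{M}an^{\mathbf\Delta^{op}}(\check N\mathcal U^{[\bullet]},BG)$ is the simplicial set whose $n$-simplices are maps of simplicial complex manifolds $h:\check N\mathcal U^{[n]}\to BG$. Such an $h$ is determined by its components $h_{a,b}:U_a\cap U_b\to G$, $a,b\in I^{[n]}$, in simplicial degree $1$, which satisfy $h_{a,b}h_{b,c}=h_{a,c}$ and $h_{a,a}=1$. **Čech complex.** For a cover $\mathcal V=\{V_j\}_{j\in J}$, $\check C^q(\mathcal V,\Omega^k_{hol})=\prod_{j_0,\dots,j_q\in J}\Omega^k_{hol}(V_{j_0,\dots,j_q})$ has total degree $q+k$, with differential $(\delta c)_{j_0,\dots,j_{q+1}}=\sum_t(-1)^tc_{j_0,\dots,\widehat{j_t},\dots,j_{q+1}}|_{V_{j_0,\dots,j_{q+1}}}$. $(\check C^\bullet(\mathcal U^{[\bullet]},\Omega^\bullet_{hol}))^{even}_{closed}$ is the simplicial set whose $n$-simplices are the $\delta$-closed elements of $\check C^\bullet(\mathcal U^{[n]},\Omega_{hol}^\bullet)$ of even total degree; $\rho:[n]\to[m]$ induces $\tilde\rho$ with $(\tilde\rho c)_{i_0^{(j_0)},\dots,i_q^{(j_q)}}=c_{i_0^{(\rho(j_0))},\dots,i_q^{(\rho(j_q))}}$. **$\beta$.** For an $n$-simplex $h$, $\beta(h)=(F_\ell)_\ell$, where $F_\ell$ sends a $k$-simplex $(a:[k]\to[\ell],\,b:[k]\to[n])$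 of $\Delta^\ell\times\Delta^n$ to the $k$-simplex of $\mathbf{HVB}(\check N\mathcal U_\ell)$ which over $U_{i_0,\dots,i_\ell}$ consists of $k+1$ copies of the product bundle with fiber $\mathbb C^r$ and connection $\partial$ (the holomorphic de Rham differential on components), with isomorphism from the $(t-1)$-st to the $t$-th bundle ($1\le t\le k$) given by $h_{x,y}$ with $x=i_{a(t)}^{(b(t))}$, $y=i_{a(t-1)}^{(b(t-1))}$. **$\gamma$.** For an $n$-simplex $h$ and indices $j_0,\dots,j_p\in I^{[n]}$, $(\gamma(h))_{j_0,\dots,j_p}=\mathrm{tr}\big(h_{j_p,j_0}^{-1}\,\partial(h_{j_p,j_{p-1}})\cdots\partial(h_{j_1,j_0})\big)$ (equal to $r$ for $p=0$). **$\iota$.** For $k\ge0$ and $\mu\in\check C^{q+k}(\mathcal U^{[k]},\Omega^\bullet_{hol})$ put $$\Big(\int_{\Delta^k}\mu\Big)_{i_0,\dots,i_q}=\sum_{0\le s_1\le\dots\le s_k\le q}(-1)^{s_1+\dots+s_k}\mu_{j_0,\dots,j_{q+k}},$$ where $(j_0,\dots,j_{q+k})=(i_0^{(0)},\dots,i_{s_1}^{(0)},i_{s_1}^{(1)},\dots,i_{s_2}^{(1)},\dots,i_{s_k}^{(k)},\dots,i_q^{(k)})$ (and $\int_{\Delta^k}\mu=0$ if the Čech degree of $\mu$ is $<k$). For an $n$-simplex $c$ of homogeneous total degree $|c|$, $\iota(c)$ is the chain map $e_{i_0,\dots,i_\ell}\mapsto(-1)^{\ell(\ell-1)/2}u^{|c|/2}\int_{\Delta^\ell}\tilde\lambda(c)$,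 where $\lambda:[\ell]\to[n]$, $\lambda(t)=i_t$; this is extended additively over homogeneous components. **$\kappa$.** Write $A^{\ell}=\Omega^\bullet_{hol}(\check N\mathcal U_\ell)$, a cosimplicial cochain complex, and $\mathbf{tot}(A)=\bigoplus_\ell A^{\ell}[\ell]$ (shifted up by $\ell$). $\kappa$ is the composite of the following maps. (1) An $n$-simplex of $\mathbf{Tot}(\mathbf\Omega(\check N\mathcal U))$ is, by the adjunction between normalized chains and Dold-Kan, a compatible family of chain maps $F_\ell:N(\mathbb Z(\Delta^n\times\Delta^\ell))\to Q(A^\ell)$; precompose with the Eilenberg-Zilber map $EZ:N(\mathbb Z\Delta^n)\otimes N(\mathbb Z\Delta^\ell)\to N(\mathbb Z(\Delta^n\times\Delta^\ell))$, $EZ(x\otimes y)=\sum_{(\mu,\nu)}\mathrm{sgn}(\mu,\nu)(s_{\nu_q}\cdots s_{\nu_1}x,s_{\mu_p}\cdots s_{\mu_1}y)$, summed over $(p,q)$-shuffles ($p=\dim x$, $q=\dim y$; $\mu_1<\dots<\mu_p$ and $\nu_1<\dots<\nu_q$ partition $\{0,\dots,p+q-1\}$). By the Hom-tensor adjunction this gives a chain map from $N(\mathbb Z\Delta^n)$ to the totalization of $\ell\mapsto Q(A^\ell)$ in non-positively graded complexes, i.e. to compatible families of graded maps $N(\mathbb Z\Delta^\ell)\to Q(A^\ell)$. (2) Identify this totalization with $Q(\mathbf{tot}(A))$, a compatible family $(\varphi_\ell)_\ell$ corresponding to the element with $\ell$-component $\varphi_\ell(e_{0,1,\dots,\ell})$.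 (3) Apply the isomorphism $Q(\mathbf{tot}(A))\cong\check C^\bullet(\mathcal U,\Omega^\bullet_{hol})[u]^{\bullet\le0}$ that identifies $A^\ell=\prod_{i_0,\dots,i_\ell}\Omega^\bullet_{hol}(U_{i_0,\dots,i_\ell})$ and multiplies an element $c$ of degree $|c|$ by $(-1)^{|c|(|c|+1)/2}$; thus the image of $e_{j_0,\dots,j_p}$, of degree $-p$, is multiplied by $(-1)^{p(p-1)/2}$.
   Formalization: As defined, ι is not simplicial on non-normalized cochains and κ can give infinitely many powers of u; so naturality, and landing in polynomials for κ, are asserted only along the diagram (as for Tot(Ch), on the image of β). The equality ι∘γ=κ∘Tot(Ch)∘β is stated in full. *)

theory Defs
  imports
    "HOL-Analysis.Function_Topology"
    "HOL-Analysis.Abstract_Topological_Spaces"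
    "HOL-Analysis.Derivative"
    "HOL-Library.FuncSet"
    "HOL-Library.Function_Algebras"
    "Jordan_Normal_Form.Gauss_Jordan_Elimination"
begin

text \<open>
  Conventions.  Functions into an additive group (forms, cochains, polynomials in \<open>u\<close>) are extended
  by \<open>0\<close> outside their domain and added pointwise; all other functions are extended by
  \<open>undefined\<close> (\<open>\<Pi>\<^sub>E\<close>, \<open>restrict\<close>).  Thus equality is literal equality of functions.
\<close>

section \<open>Complex manifolds\<close>

text \<open>\<open>\<complex>\<^sup>d\<close> is the set of \<open>z :: nat \<Rightarrow> complex\<close> vanishing from index \<open>d\<close> on, in the
  style of \<open>Euclidean_space\<close>; this keeps the dimension a natural number, possibly \<open>0\<close>.\<close>

definition cspace :: "nat \<Rightarrow> (nat \<Rightarrow> complex) topology" where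
  "cspace d = top_of_set {z. \<forall>i\<ge>d. z i = 0}"

text \<open>Complex (Frechet) differentiability at every point of an open \<open>W \<subseteq> \<complex>\<^sup>d\<close>.\<close>

definition hol_on :: "nat \<Rightarrow> (nat \<Rightarrow> complex) set \<Rightarrow> ((nat \<Rightarrow> complex) \<Rightarrow> complex) \<Rightarrow> bool" where
  "hol_on d W f \<longleftrightarrow> (\<forall>z\<in>W. \<exists>a :: nat \<Rightarrow> complex.
     ((\<lambda>w. (f w - f z - (\<Sum>i<d. a i * (w i - z i))) / of_real (\<Sum>i<d. cmod (w i - z i)))
        \<longlongrightarrow> 0) (at z within W))"

type_synonym 'a chart = "'a set \<times> ('a \<Rightarrow> nat \<Rightarrow> complex)"

record 'a cmfd =
  mdim :: nat
  mtop :: "'a topology"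
  matlas :: "'a chart set"

definition complex_manifold :: "'a cmfd \<Rightarrow> bool" where
  "complex_manifold M \<longleftrightarrow>
     Hausdorff_space (mtop M) \<and> second_countable (mtop M) \<and>
     (\<Union>(D, \<phi>)\<in>matlas M. D) = topspace (mtop M) \<and>
     (\<forall>(D, \<phi>)\<in>matlas M. openin (mtop M) D \<and> openin (cspace (mdim M)) (\<phi> ` D) \<and>
        homeomorphic_map (subtopology (mtop M) D) (subtopology (cspace (mdim M)) (\<phi> ` D)) \<phi>) \<and>
     (\<forall>(D, \<phi>)\<in>matlas M. \<forall>(D', \<psi>)\<in>matlas M. \<forall>i<mdim M.
        hol_on (mdim M) (\<phi> ` (D \<inter> D')) (\<lambda>z. \<psi> (inv_into D \<phi> z) i))"

text \<open>Holomorphic functions on an open set \<open>V\<close>; values off \<open>V\<close> do not matter.\<close>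

definition holfun :: "'a cmfd \<Rightarrow> 'a set \<Rightarrow> ('a \<Rightarrow> complex) \<Rightarrow> bool" where
  "holfun M V f \<longleftrightarrow>
     (\<forall>(D, \<phi>)\<in>matlas M. hol_on (mdim M) (\<phi> ` (V \<inter> D)) (\<lambda>z. f (inv_into D \<phi> z)))"

definition hol_near :: "'a cmfd \<Rightarrow> 'a \<Rightarrow> ('a \<Rightarrow> complex) \<Rightarrow> bool" where
  "hol_near M p f \<longleftrightarrow> (\<exists>V. openin (mtop M) V \<and> p \<in> V \<and> holfun M V f)"

text \<open>A holomorphic tangent vector at \<open>p\<close> is the derivation \<open>\<Sum>\<^sub>i c\<^sub>i \<partial>/\<partial>z\<^sub>i\<close> of functions holomorphic
  near \<open>p\<close> (extended by \<open>0\<close> to all other functions), for some chart at \<open>p\<close>; by the chain rule the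
  set of these does not depend on the chart.\<close>

type_synonym 'a tvec = "('a \<Rightarrow> complex) \<Rightarrow> complex"

definition coord_vec :: "'a cmfd \<Rightarrow> 'a chart \<Rightarrow> nat \<Rightarrow> 'a \<Rightarrow> 'a tvec" where
  "coord_vec M = (\<lambda>(D, \<phi>) i p f.
     if hol_near M p f then deriv (\<lambda>t. f (inv_into D \<phi> ((\<phi> p)(i := t)))) (\<phi> p i) else 0)"

definition tangent :: "'a cmfd \<Rightarrow> 'a \<Rightarrow> 'a tvec set" where
  "tangent M p = {v. \<exists>(D, \<phi>)\<in>matlas M. p \<in> D \<and>
     (\<exists>c :: nat \<Rightarrow> complex. v = (\<lambda>f. \<Sum>i<mdim M. c i * coord_vec M (D, \<phi>) i p f))}"

section \<open>Holomorphic forms\<close>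

text \<open>A form is evaluated on a point and a list of tangent vectors; the component of degree \<open>k\<close> is
  its restriction to lists of length \<open>k\<close>.\<close>

type_synonym 'a form = "'a \<Rightarrow> 'a tvec list \<Rightarrow> complex"

definition hol_form :: "'a cmfd \<Rightarrow> nat \<Rightarrow> 'a set \<Rightarrow> 'a form set" where
  "hol_form M k V = {\<omega>.
     (\<forall>p vs. \<omega> p vs \<noteq> 0 \<longrightarrow> p \<in> V \<and> length vs = k \<and> set vs \<subseteq> tangent M p) \<and>
     (\<forall>p\<in>V. \<forall>vs. length vs = k \<and> set vs \<subseteq> tangent M p \<longrightarrow>
        (\<forall>i<k. \<forall>v\<in>tangent M p. \<forall>w\<in>tangent M p. \<forall>a.
           \<omega> p (vs[i := (\<lambda>f. a * v f + w f)]) = a * \<omega> p (vs[i := v]) + \<omega> p (vs[i := w])) \<and>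
        (\<forall>i<k. \<forall>j<k. i \<noteq> j \<and> vs ! i = vs ! j \<longrightarrow> \<omega> p vs = 0)) \<and>
     (\<forall>(D, \<phi>)\<in>matlas M. \<forall>ns. length ns = k \<and> set ns \<subseteq> {..<mdim M} \<longrightarrow>
        holfun M (V \<inter> D) (\<lambda>p. \<omega> p (map (\<lambda>i. coord_vec M (D, \<phi>) i p) ns)))}"

definition res_form :: "'a set \<Rightarrow> 'a form \<Rightarrow> 'a form" where
  "res_form V \<omega> = (\<lambda>p vs. if p \<in> V then \<omega> p vs else 0)"

text \<open>Matrix-valued forms, of size \<open>n p\<close> at the point \<open>p\<close>.  The product is matrix multiplication
  combined with the wedge product \<open>(\<alpha> \<and> \<beta>)(v\<^sub>1, \<dots>) = \<Sum>\<^sub>S \<plusminus> \<alpha>(v\<^sub>S) \<beta>(v\<^bsub>-S\<^esub>)\<close>, summed over shuffles.\<close>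

type_synonym 'a mform = "'a \<Rightarrow> 'a tvec list \<Rightarrow> complex mat"

definition wedge_inv :: "nat \<Rightarrow> nat set \<Rightarrow> nat" where
  "wedge_inv k S = card {(i, j). i \<in> S \<and> j \<in> {..<k} - S \<and> j < i}"

definition mwedge :: "('a \<Rightarrow> nat) \<Rightarrow> 'a mform \<Rightarrow> 'a mform \<Rightarrow> 'a mform" where
  "mwedge n \<eta> \<theta> = (\<lambda>p vs. mat (n p) (n p) (\<lambda>(i, j).
     \<Sum>S\<in>Pow {..<length vs}. (- 1) ^ wedge_inv (length vs) S *
        (\<eta> p (nths vs S) * \<theta> p (nths vs (- S))) $$ (i, j)))"

fun mwedges :: "('a \<Rightarrow> nat) \<Rightarrow> 'a mform list \<Rightarrow> 'a mform" where
  "mwedges n [] = (\<lambda>p vs. if vs = [] then 1\<^sub>m (n p) else 0\<^sub>m (n p) (n p))"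
| "mwedges n [\<eta>] = \<eta>"
| "mwedges n (\<eta> # \<theta> # \<theta>s) = mwedge n \<eta> (mwedges n (\<theta> # \<theta>s))"

definition mtrace :: "complex mat \<Rightarrow> complex" where
  "mtrace A = (\<Sum>i<dim_row A. A $$ (i, i))"

definition tr_form :: "'a set \<Rightarrow> 'a mform \<Rightarrow> 'a form" where
  "tr_form V \<eta> = res_form V (\<lambda>p vs. mtrace (\<eta> p vs))"

definition mat_inv :: "complex mat \<Rightarrow> complex mat" where
  "mat_inv A = the (mat_inverse A)"

definition mform0 :: "'a set \<Rightarrow> ('a \<Rightarrow> nat) \<Rightarrow> ('a \<Rightarrow> complex mat) \<Rightarrow> 'a mform" where
  "mform0 V n g = (\<lambda>p vs. if p \<in> V \<and> vs = [] then g p else 0\<^sub>m (n p) (n p))"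

definition mform1 :: "'a cmfd \<Rightarrow> 'a set \<Rightarrow> ('a \<Rightarrow> nat) \<Rightarrow> ('a \<Rightarrow> 'a tvec \<Rightarrow> complex mat) \<Rightarrow> 'a mform" where
  "mform1 M V n g = (\<lambda>p vs. if p \<in> V \<and> length vs = 1 \<and> hd vs \<in> tangent M p then g p (hd vs)
     else 0\<^sub>m (n p) (n p))"

text \<open>Entrywise \<open>\<partial>\<close> of a matrix of functions; note \<open>(\<partial> f)(v) = v f\<close>.\<close>

definition dmat :: "nat \<Rightarrow> ('a \<Rightarrow> complex mat) \<Rightarrow> 'a \<Rightarrow> 'a tvec \<Rightarrow> complex mat" where
  "dmat r g = (\<lambda>p v. mat r r (\<lambda>(i, j). v (\<lambda>x. g x $$ (i, j))))"

section \<open>Complexes, simplicial sets, and Dold-Kan\<close>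

definition alt :: "nat \<Rightarrow> 'c::ab_group_add \<Rightarrow> 'c" where
  "alt j c = (if even j then c else - c)"

definition del :: "nat \<Rightarrow> 'b list \<Rightarrow> 'b list" where
  "del j xs = take j xs @ drop (Suc j) xs"

definition dup :: "nat \<Rightarrow> 'b list \<Rightarrow> 'b list" where
  "dup j xs = take (Suc j) xs @ drop j xs"

text \<open>A morphism \<open>\<rho> : [k] \<rightarrow> [m]\<close> of the simplex category is the list of its values; these lists are
  also the \<open>k\<close>-simplices of \<open>\<Delta>\<^sup>m\<close>.  For lists \<open>x\<close> viewed as maps, \<open>pick x \<rho>\<close> is \<open>x \<circ> \<rho>\<close>.\<close>

definition ord_maps :: "nat \<Rightarrow> nat \<Rightarrow> nat list set" where
  "ord_maps k m = {\<rho>. length \<rho> = Suc k \<and> sorted \<rho> \<and> set \<rho> \<subseteq> {..m}}"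

definition pick :: "'b list \<Rightarrow> nat list \<Rightarrow> 'b list" where
  "pick x \<rho> = map (nth x) \<rho>"

record 'x sset =
  simp :: "nat \<Rightarrow> 'x set"
  act :: "nat list \<Rightarrow> 'x \<Rightarrow> 'x"

definition simplicial_map :: "'x sset \<Rightarrow> 'y sset \<Rightarrow> (nat \<Rightarrow> 'x \<Rightarrow> 'y) \<Rightarrow> bool" where
  "simplicial_map S T f \<longleftrightarrow> (\<forall>n. \<forall>x\<in>simp S n. f n x \<in> simp T n \<and>
     (\<forall>k. \<forall>\<rho>\<in>ord_maps k n. f k (act S \<rho> x) = act T \<rho> (f n x)))"

definition std_simplex :: "nat \<Rightarrow> nat list sset" where
  "std_simplex m = \<lparr>simp = (\<lambda>k. ord_maps k m), act = (\<lambda>\<rho> a. pick a \<rho>)\<rparr>"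

definition prod_sset :: "'x sset \<Rightarrow> 'y sset \<Rightarrow> ('x \<times> 'y) sset" where
  "prod_sset S T = \<lparr>simp = (\<lambda>k. simp S k \<times> simp T k), act = (\<lambda>\<rho> (x, y). (act S \<rho> x, act T \<rho> y))\<rparr>"

record 'x cosset =
  lev :: "nat \<Rightarrow> 'x sset"
  coact :: "nat \<Rightarrow> nat list \<Rightarrow> 'x \<Rightarrow> 'x"  \<comment> \<open>\<open>coact m \<rho>\<close> goes from level \<open>k\<close> to level \<open>m\<close>, for \<open>\<rho> : [k] \<rightarrow> [m]\<close>\<close>

definition prism :: "nat \<Rightarrow> nat \<Rightarrow> (nat list \<times> nat list) set" where
  "prism l n = (\<Union>k. simp (prod_sset (std_simplex l) (std_simplex n)) k)"

definition Tot :: "'x cosset \<Rightarrow> (nat \<Rightarrow> nat list \<times> nat list \<Rightarrow> 'x) sset" where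
  "Tot X = \<lparr>
     simp = (\<lambda>n. {F.
       (\<forall>l. F l \<in> extensional (prism l n) \<and>
            simplicial_map (prod_sset (std_simplex l) (std_simplex n)) (lev X l) (\<lambda>_. F l)) \<and>
       (\<forall>k m. \<forall>\<rho>\<in>ord_maps k m. \<forall>(a, b)\<in>prism k n. F m (pick \<rho> a, b) = coact X m \<rho> (F k (a, b)))}),
     act = (\<lambda>\<theta> F l. \<lambda>(a, b)\<in>prism l (length \<theta> - 1). F l (a, pick \<theta> b))\<rparr>"

text \<open>Degree \<open>k\<close> of a non-negatively graded complex, respectively degree \<open>-k\<close> of a non-positively
  graded one, is \<open>gr C k\<close>; \<open>df C k\<close> is the differential out of it (always of degree \<open>+1\<close>).\<close>

record 'c cplx =
  gr :: "nat \<Rightarrow> 'c set"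
  df :: "nat \<Rightarrow> 'c \<Rightarrow> 'c"

text \<open>\<open>C[u]\<^bsup>\<bullet>\<le>0\<^esup>\<close>: a polynomial in \<open>u\<close> is its finitely supported coefficient function.  In degree \<open>-p\<close>
  the coefficient of \<open>u\<^sup>m\<close> has degree \<open>2m - p\<close>.  The quotient is \<open>0\<close> in positive degrees, hence so is
  the differential out of degree \<open>0\<close>.\<close>

definition Qu :: "'c::ab_group_add cplx \<Rightarrow> (nat \<Rightarrow> 'c) cplx" where
  "Qu C = \<lparr>
     gr = (\<lambda>p. {P. finite {m. P m \<noteq> 0} \<and>
       (\<forall>m. P m \<in> (if p \<le> 2 * m then gr C (2 * m - p) else {0}))}),
     df = (\<lambda>p P m. if p = 0 then 0 else df C (2 * m - p) (P m))\<rparr>"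

text \<open>\<open>nondeg k\<close> indexes the generators \<open>e\<^sub>J\<close> of \<open>N(\<int>\<Delta>\<^sup>k)\<close>; \<open>J\<close> has degree \<open>-(length J - 1)\<close>.  A cochain
  map out of this free complex is given by its values on the generators.  Under \<open>\<rho>\<close>, a generator goes
  to the generator \<open>\<rho>(J)\<close>, or to \<open>0\<close> if \<open>\<rho>(J)\<close> is degenerate.\<close>

definition nondeg :: "nat \<Rightarrow> nat list set" where
  "nondeg k = {J. J \<noteq> [] \<and> sorted_wrt (<) J \<and> set J \<subseteq> {..k}}"

definition DK :: "'c::ab_group_add cplx \<Rightarrow> (nat list \<Rightarrow> 'c) sset" where
  "DK C = \<lparr>
     simp = (\<lambda>k. {x.
       (\<forall>J. J \<notin> nondeg k \<longrightarrow> x J = 0) \<and>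
       (\<forall>J\<in>nondeg k. x J \<in> gr C (length J - 1)) \<and>
       (\<forall>J\<in>nondeg k. length J \<ge> 2 \<longrightarrow>
          df C (length J - 1) (x J) = (\<Sum>j<length J. alt j (x (del j J))))}),
     act = (\<lambda>\<rho> x J. if J \<in> nondeg (length \<rho> - 1) \<and> distinct (pick \<rho> J) then x (pick \<rho> J) else 0)\<rparr>"

section \<open>Bundles with connection\<close>

text \<open>A holomorphic vector bundle with fibre \<open>\<complex>\<^bsup>vb_rank x\<^esup>\<close> at \<open>x\<close>, given by its sheaf of holomorphic
  sections.  A connection is given on local sections, with values in bundle-valued \<open>1\<close>-forms.\<close>

record 'a vbc =
  vb_rank :: "'a \<Rightarrow> nat"
  vb_sec :: "'a set \<Rightarrow> ('a \<Rightarrow> complex vec) set"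
  vb_conn :: "'a set \<Rightarrow> ('a \<Rightarrow> complex vec) \<Rightarrow> 'a \<Rightarrow> 'a tvec \<Rightarrow> complex vec"

definition GL :: "nat \<Rightarrow> complex mat set" where
  "GL r = {A \<in> carrier_mat r r. invertible_mat A}"

definition opens_in :: "'a cmfd \<Rightarrow> 'a set \<Rightarrow> 'a set set" where
  "opens_in M W = {V. openin (mtop M) V \<and> V \<subseteq> W}"

definition set_sections :: "'a vbc \<Rightarrow> 'a set \<Rightarrow> ('a \<Rightarrow> complex vec) set" where
  "set_sections E V = (\<Pi>\<^sub>E x\<in>V. carrier_vec (vb_rank E x))"

text \<open>Local triviality: near each point there is a frame \<open>e\<close> (a basis of each fibre, as the columns
  of an invertible matrix) such that the sections are those with holomorphic coordinates in \<open>e\<close>.\<close>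

definition is_vb :: "'a cmfd \<Rightarrow> 'a set \<Rightarrow> 'a vbc \<Rightarrow> bool" where
  "is_vb M W E \<longleftrightarrow>
     vb_rank E \<in> extensional W \<and>
     (\<forall>V. V \<notin> opens_in M W \<longrightarrow> vb_sec E V = {}) \<and>
     (\<forall>V\<in>opens_in M W. \<forall>s\<in>set_sections E V.
        s \<in> vb_sec E V \<longleftrightarrow> (\<forall>p\<in>V. \<exists>V'\<in>opens_in M V. p \<in> V' \<and> restrict s V' \<in> vb_sec E V')) \<and>
     (\<forall>p\<in>W. \<exists>V\<in>opens_in M W. \<exists>n e. p \<in> V \<and> (\<forall>x\<in>V. vb_rank E x = n \<and> e x \<in> GL n) \<and>
        (\<forall>V'\<in>opens_in M V. vb_sec E V' =
           {s \<in> set_sections E V'. \<forall>i<n. holfun M V' (\<lambda>x. vec_index (mat_inv (e x) *\<^sub>v s x) i)}))"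

definition is_conn :: "'a cmfd \<Rightarrow> 'a set \<Rightarrow> 'a vbc \<Rightarrow> bool" where
  "is_conn M W E \<longleftrightarrow>
     (\<forall>V s. s \<notin> vb_sec E V \<longrightarrow> vb_conn E V s = undefined) \<and>
     (\<forall>V. \<forall>s\<in>vb_sec E V.
        vb_conn E V s \<in> (\<Pi>\<^sub>E p\<in>V. \<Pi>\<^sub>E v\<in>tangent M p. carrier_vec (vb_rank E p)) \<and>
        (\<forall>p\<in>V. \<forall>v\<in>tangent M p. \<forall>w\<in>tangent M p. \<forall>a.
           vb_conn E V s p (\<lambda>f. a * v f + w f) = a \<cdot>\<^sub>v vb_conn E V s p v + vb_conn E V s p w) \<and>
        (\<forall>(D, \<phi>)\<in>matlas M. \<forall>i<mdim M.
           (\<lambda>p\<in>V \<inter> D. vb_conn E V s p (coord_vec M (D, \<phi>) i p)) \<in> vb_sec E (V \<inter> D)) \<and>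
        (\<forall>V'\<in>opens_in M V. \<forall>p\<in>V'. vb_conn E V' (restrict s V') p = vb_conn E V s p) \<and>
        (\<forall>t\<in>vb_sec E V. \<forall>p\<in>V. \<forall>v\<in>tangent M p.
           vb_conn E V (\<lambda>x\<in>V. s x + t x) p v = vb_conn E V s p v + vb_conn E V t p v) \<and>
        (\<forall>f. holfun M V f \<longrightarrow> (\<forall>p\<in>V. \<forall>v\<in>tangent M p.
           vb_conn E V (\<lambda>x\<in>V. f x \<cdot>\<^sub>v s x) p v = v f \<cdot>\<^sub>v s p + f p \<cdot>\<^sub>v vb_conn E V s p v)))"

definition is_iso :: "'a cmfd \<Rightarrow> 'a set \<Rightarrow> 'a vbc \<Rightarrow> 'a vbc \<Rightarrow> ('a \<Rightarrow> complex mat) \<Rightarrow> bool" where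
  "is_iso M W E E' f \<longleftrightarrow>
     f \<in> (\<Pi>\<^sub>E x\<in>W. {A \<in> carrier_mat (vb_rank E' x) (vb_rank E x). invertible_mat A}) \<and>
     (\<forall>V\<in>opens_in M W. \<forall>s\<in>set_sections E V.
        s \<in> vb_sec E V \<longleftrightarrow> (\<lambda>x\<in>V. f x *\<^sub>v s x) \<in> vb_sec E' V)"

definition res_vbc :: "'a set \<Rightarrow> 'a vbc \<Rightarrow> 'a vbc" where
  "res_vbc W E = \<lparr>vb_rank = restrict (vb_rank E) W,
     vb_sec = (\<lambda>V. if V \<subseteq> W then vb_sec E V else {}),
     vb_conn = (\<lambda>V s. if V \<subseteq> W then vb_conn E V s else undefined)\<rparr>"

definition product_vbc :: "'a cmfd \<Rightarrow> nat \<Rightarrow> 'a set \<Rightarrow> 'a vbc" where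
  "product_vbc M r W = (let S = (\<lambda>V. if V \<in> opens_in M W
       then {s \<in> (\<Pi>\<^sub>E x\<in>V. carrier_vec r). \<forall>i<r. holfun M V (\<lambda>x. vec_index (s x) i)} else {}) in
     \<lparr>vb_rank = (\<lambda>x\<in>W. r), vb_sec = S,
      vb_conn = (\<lambda>V s. if s \<in> S V
        then (\<lambda>p\<in>V. \<lambda>v\<in>tangent M p. vec r (\<lambda>i. v (\<lambda>x. vec_index (s x) i))) else undefined)\<rparr>)"

text \<open>\<open>k\<close>-simplices \<open>E\<^sub>0 \<rightarrow> \<dots> \<rightarrow> E\<^sub>k\<close> of the nerve; \<open>fs ! t\<close> is the isomorphism from \<open>E\<^sub>t\<close> to \<open>E\<^bsub>t+1\<^esub>\<close>.\<close>

type_synonym 'a hvb = "'a vbc list \<times> ('a \<Rightarrow> complex mat) list"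

definition hvb_simp :: "'a cmfd \<Rightarrow> 'a set \<Rightarrow> nat \<Rightarrow> 'a hvb set" where
  "hvb_simp M W k = {(Es, fs). length Es = Suc k \<and> length fs = k \<and>
     (\<forall>E\<in>set Es. is_vb M W E \<and> is_conn M W E) \<and>
     (\<forall>t<k. is_iso M W (Es ! t) (Es ! Suc t) (fs ! t))}"

primrec hvb_comp' :: "'a set \<Rightarrow> 'a hvb \<Rightarrow> nat \<Rightarrow> nat \<Rightarrow> 'a \<Rightarrow> complex mat" where
  "hvb_comp' W \<sigma> p 0 = (\<lambda>x\<in>W. 1\<^sub>m (vb_rank (fst \<sigma> ! p) x))"
| "hvb_comp' W \<sigma> p (Suc j) = (\<lambda>x\<in>W. (snd \<sigma> ! (p + j)) x * hvb_comp' W \<sigma> p j x)"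

text \<open>The composite from \<open>E\<^sub>p\<close> to \<open>E\<^sub>q\<close>, for \<open>p \<le> q\<close>.\<close>

definition hvb_comp :: "'a set \<Rightarrow> 'a hvb \<Rightarrow> nat \<Rightarrow> nat \<Rightarrow> 'a \<Rightarrow> complex mat" where
  "hvb_comp W \<sigma> q p = hvb_comp' W \<sigma> p (q - p)"

definition hvb_act :: "'a set \<Rightarrow> nat list \<Rightarrow> 'a hvb \<Rightarrow> 'a hvb" where
  "hvb_act W \<rho> \<sigma> = (pick (fst \<sigma>) \<rho>,
     map (\<lambda>t. hvb_comp W \<sigma> (\<rho> ! Suc t) (\<rho> ! t)) [0..<length \<rho> - 1])"

definition hvb_res :: "'a set \<Rightarrow> 'a hvb \<Rightarrow> 'a hvb" where
  "hvb_res W \<sigma> = (map (res_vbc W) (fst \<sigma>), map (\<lambda>f. restrict f W) (snd \<sigma>))"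

text \<open>The induced connection on \<open>Hom(E, E')\<close>: \<open>(\<nabla> f) s = \<nabla>' (f s) - f (\<nabla> s)\<close> for local sections \<open>s\<close>.\<close>

definition hom_conn ::
  "'a cmfd \<Rightarrow> 'a set \<Rightarrow> 'a vbc \<Rightarrow> 'a vbc \<Rightarrow> ('a \<Rightarrow> complex mat) \<Rightarrow> 'a \<Rightarrow> 'a tvec \<Rightarrow> complex mat" where
  "hom_conn M W E E' f p v = (THE B. B \<in> carrier_mat (vb_rank E' p) (vb_rank E p) \<and>
     (\<forall>V\<in>opens_in M W. \<forall>s\<in>vb_sec E V. p \<in> V \<longrightarrow>
        B *\<^sub>v s p = vb_conn E' V (\<lambda>x\<in>V. f x *\<^sub>v s x) p v - f p *\<^sub>v vb_conn E V s p v))"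

text \<open>The coefficient of \<open>u\<^sup>l\<close> in the value of \<open>Ch(W)(\<sigma>)\<close> on the generator \<open>e\<^sub>J\<close>, \<open>l = length J - 1\<close>.\<close>

definition ch_form :: "'a cmfd \<Rightarrow> 'a set \<Rightarrow> 'a hvb \<Rightarrow> nat list \<Rightarrow> 'a form" where
  "ch_form M W \<sigma> J = (let l = length J - 1; E = (\<lambda>t. fst \<sigma> ! (J ! t)); n = vb_rank (E 0) in
     if l = 0 then res_form W (\<lambda>p vs. if vs = [] then of_nat (n p) else 0)
     else tr_form W (mwedges n
       (mform0 W n (\<lambda>x. mat_inv (hvb_comp W \<sigma> (J ! l) (J ! 0) x)) #
        map (\<lambda>t. mform1 M W n
               (hom_conn M W (E t) (E (Suc t)) (hvb_comp W \<sigma> (J ! Suc t) (J ! t)))) (rev [0..<l]))))"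

section \<open>Cech nerve and the presheaves on it\<close>

text \<open>For a cover \<open>U\<close> indexed by \<open>I\<close>: the components of \<open>N\<^sub>l\<close> (the Cech nerve in degree \<open>l\<close>) are indexed
  by \<open>cidx I l\<close>.  A presheaf is evaluated on such a coproduct as the product over the components.\<close>

definition cidx :: "'i set \<Rightarrow> nat \<Rightarrow> 'i list set" where
  "cidx I l = {js. set js \<subseteq> I \<and> length js = Suc l}"

definition cidx_all :: "'i set \<Rightarrow> 'i list set" where
  "cidx_all I = (\<Union>l. cidx I l)"

definition cap :: "('i \<Rightarrow> 'a set) \<Rightarrow> 'i list \<Rightarrow> 'a set" where
  "cap U js = (\<Inter>j\<in>set js. U j)"

definition HVB_nerve :: "'a cmfd \<Rightarrow> 'i set \<Rightarrow> ('i \<Rightarrow> 'a set) \<Rightarrow> ('i list \<Rightarrow> 'a hvb) cosset" where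
  "HVB_nerve M I U = \<lparr>
     lev = (\<lambda>l. \<lparr>simp = (\<lambda>k. \<Pi>\<^sub>E js\<in>cidx I l. hvb_simp M (cap U js) k),
                act = (\<lambda>\<rho> \<sigma>. \<lambda>js\<in>cidx I l. hvb_act (cap U js) \<rho> (\<sigma> js))\<rparr>),
     coact = (\<lambda>m \<rho> \<sigma>. \<lambda>js\<in>cidx I m. hvb_res (cap U js) (\<sigma> (pick js \<rho>)))\<rparr>"

text \<open>Holomorphic forms on \<open>N\<^sub>l\<close>, with zero differential.\<close>

definition nerve_forms :: "'a cmfd \<Rightarrow> 'i set \<Rightarrow> ('i \<Rightarrow> 'a set) \<Rightarrow> nat \<Rightarrow> ('i list \<Rightarrow> 'a form) cplx" where
  "nerve_forms M I U l = \<lparr>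
     gr = (\<lambda>k. {c. (\<forall>js. js \<notin> cidx I l \<longrightarrow> c js = 0) \<and> (\<forall>js\<in>cidx I l. c js \<in> hol_form M k (cap U js))}),
     df = (\<lambda>_ _. 0)\<rparr>"

definition Omega_nerve ::
  "'a cmfd \<Rightarrow> 'i set \<Rightarrow> ('i \<Rightarrow> 'a set) \<Rightarrow> (nat list \<Rightarrow> nat \<Rightarrow> 'i list \<Rightarrow> 'a form) cosset" where
  "Omega_nerve M I U = \<lparr>
     lev = (\<lambda>l. DK (Qu (nerve_forms M I U l))),
     coact = (\<lambda>m \<rho> x J u js. if js \<in> cidx I m then res_form (cap U js) (x J u (pick js \<rho>)) else 0)\<rparr>"

definition Ch_nerve ::
  "'a cmfd \<Rightarrow> 'i set \<Rightarrow> ('i \<Rightarrow> 'a set) \<Rightarrow> nat \<Rightarrow> ('i list \<Rightarrow> 'a hvb) \<Rightarrow> nat list \<Rightarrow> nat \<Rightarrow> 'i list \<Rightarrow> 'a form" where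
  "Ch_nerve M I U l \<sigma> = (\<lambda>J m js.
     if js \<in> cidx I l \<and> J \<in> nondeg (length (snd (\<sigma> js))) \<and> m = length J - 1
     then ch_form M (cap U js) (\<sigma> js) J else 0)"

definition Tot_Ch ::
  "'a cmfd \<Rightarrow> 'i set \<Rightarrow> ('i \<Rightarrow> 'a set) \<Rightarrow> nat \<Rightarrow> (nat \<Rightarrow> nat list \<times> nat list \<Rightarrow> 'i list \<Rightarrow> 'a hvb) \<Rightarrow>
     nat \<Rightarrow> nat list \<times> nat list \<Rightarrow> nat list \<Rightarrow> nat \<Rightarrow> 'i list \<Rightarrow> 'a form" where
  "Tot_Ch M I U n F = (\<lambda>l. \<lambda>z\<in>prism l n. Ch_nerve M I U l (F l z))"

section \<open>Cech complex\<close>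

text \<open>A Cech cochain has values on index lists of all lengths \<open>q + 1\<close>; \<open>gr\<close> refers to the total
  degree.\<close>

definition cech_diff :: "'j set \<Rightarrow> ('j \<Rightarrow> 'a set) \<Rightarrow> ('j list \<Rightarrow> 'a form) \<Rightarrow> 'j list \<Rightarrow> 'a form" where
  "cech_diff J V c = (\<lambda>js. if js \<in> cidx_all J \<and> length js \<ge> 2
     then \<Sum>t<length js. alt t (res_form (cap V js) (c (del t js))) else 0)"

definition cech :: "'a cmfd \<Rightarrow> 'j set \<Rightarrow> ('j \<Rightarrow> 'a set) \<Rightarrow> ('j list \<Rightarrow> 'a form) cplx" where
  "cech M J V = \<lparr>
     gr = (\<lambda>N. {c. (\<forall>js. js \<notin> cidx_all J \<longrightarrow> c js = 0) \<and>
       (\<forall>q. \<forall>js\<in>cidx J q. c js \<in> (if q \<le> N then hol_form M (N - q) (cap V js) else {0}))}),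
     df = (\<lambda>_. cech_diff J V)\<rparr>"

definition homog :: "nat \<Rightarrow> ('j list \<Rightarrow> 'a form) \<Rightarrow> 'j list \<Rightarrow> 'a form" where
  "homog N c = (\<lambda>js p vs. if length js - 1 + length vs = N then c js p vs else 0)"

text \<open>The cover \<open>\<U>\<^bsup>[n]\<^esup>\<close> has index set \<open>bridx I n\<close> and members \<open>brcov U\<close>.\<close>

definition bridx :: "'i set \<Rightarrow> nat \<Rightarrow> ('i \<times> nat) set" where
  "bridx I n = I \<times> {..n}"

definition brcov :: "('i \<Rightarrow> 'a set) \<Rightarrow> 'i \<times> nat \<Rightarrow> 'a set" where
  "brcov U = (\<lambda>(i, j). U i)"

definition relabel :: "nat list \<Rightarrow> ('i \<times> nat) list \<Rightarrow> ('i \<times> nat) list" where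
  "relabel \<rho> js = map (\<lambda>(i, j). (i, \<rho> ! j)) js"

definition cech_act ::
  "'i set \<Rightarrow> nat list \<Rightarrow> (('i \<times> nat) list \<Rightarrow> 'a form) \<Rightarrow> ('i \<times> nat) list \<Rightarrow> 'a form" where
  "cech_act I \<rho> c = (\<lambda>js. if js \<in> cidx_all (bridx I (length \<rho> - 1)) then c (relabel \<rho> js) else 0)"

definition cech_even_closed ::
  "'a cmfd \<Rightarrow> 'i set \<Rightarrow> ('i \<Rightarrow> 'a set) \<Rightarrow> (('i \<times> nat) list \<Rightarrow> 'a form) sset" where
  "cech_even_closed M I U = \<lparr>
     simp = (\<lambda>n. {c. (\<exists>K cs. (\<forall>m<K. cs m \<in> gr (cech M (bridx I n) (brcov U)) (2 * m)) \<and> c = (\<Sum>m<(K::nat). cs m)) \<and>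
       cech_diff (bridx I n) (brcov U) c = 0}),
     act = cech_act I\<rparr>"

section \<open>Maps of simplicial manifolds into \<open>BG\<close>\<close>

definition bg_face :: "nat \<Rightarrow> complex mat list \<Rightarrow> complex mat list" where
  "bg_face j gs = (if j = 0 then tl gs else if j = length gs then butlast gs
     else take (j - 1) gs @ [gs ! (j - 1) * gs ! j] @ drop (Suc j) gs)"

definition bg_degen :: "nat \<Rightarrow> nat \<Rightarrow> complex mat list \<Rightarrow> complex mat list" where
  "bg_degen r j gs = take j gs @ [1\<^sub>m r] @ drop j gs"

definition CMan :: "'a cmfd \<Rightarrow> nat \<Rightarrow> 'i set \<Rightarrow> ('i \<Rightarrow> 'a set) \<Rightarrow>
    (('i \<times> nat) list \<Rightarrow> 'a \<Rightarrow> complex mat list) sset" where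
  "CMan M r I U = \<lparr>
     simp = (\<lambda>n. {h.
       h \<in> (\<Pi>\<^sub>E js\<in>cidx_all (bridx I n). \<Pi>\<^sub>E x\<in>cap (brcov U) js. {gs. length gs = length js - 1 \<and> set gs \<subseteq> GL r}) \<and>
       (\<forall>k. \<forall>js\<in>cidx (bridx I n) k.
          (\<forall>t<k. \<forall>a<r. \<forall>b<r. holfun M (cap (brcov U) js) (\<lambda>x. (h js x ! t) $$ (a, b))) \<and>
          (\<forall>x\<in>cap (brcov U) js. \<forall>j\<le>k.
             (k > 0 \<longrightarrow> h (del j js) x = bg_face j (h js x)) \<and>
             h (dup j js) x = bg_degen r j (h js x)))}),
     act = (\<lambda>\<rho> h. \<lambda>js\<in>cidx_all (bridx I (length \<rho> - 1)). h (relabel \<rho> js))\<rparr>"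

definition comp1 :: "(('i \<times> nat) list \<Rightarrow> 'a \<Rightarrow> complex mat list) \<Rightarrow> 'i \<times> nat \<Rightarrow> 'i \<times> nat \<Rightarrow> 'a \<Rightarrow> complex mat" where
  "comp1 h a b x = hd (h [a, b] x)"

section \<open>The maps \<open>\<beta>\<close>, \<open>\<gamma>\<close>, \<open>\<iota>\<close>, \<open>\<kappa>\<close>\<close>

definition beta :: "'a cmfd \<Rightarrow> nat \<Rightarrow> 'i set \<Rightarrow> ('i \<Rightarrow> 'a set) \<Rightarrow> nat \<Rightarrow>
    (('i \<times> nat) list \<Rightarrow> 'a \<Rightarrow> complex mat list) \<Rightarrow> nat \<Rightarrow> nat list \<times> nat list \<Rightarrow> 'i list \<Rightarrow> 'a hvb" where
  "beta M r I U n h = (\<lambda>l. \<lambda>(a, b)\<in>prism l n. \<lambda>js\<in>cidx I l.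
     (replicate (length a) (product_vbc M r (cap U js)),
      map (\<lambda>t. \<lambda>x\<in>cap U js. comp1 h (js ! (a ! t), b ! t) (js ! (a ! (t - 1)), b ! (t - 1)) x) [1..<length a]))"

definition gamma :: "'a cmfd \<Rightarrow> nat \<Rightarrow> 'i set \<Rightarrow> ('i \<Rightarrow> 'a set) \<Rightarrow> nat \<Rightarrow>
    (('i \<times> nat) list \<Rightarrow> 'a \<Rightarrow> complex mat list) \<Rightarrow> ('i \<times> nat) list \<Rightarrow> 'a form" where
  "gamma M r I U n h = (\<lambda>js. let p = length js - 1; V = cap (brcov U) js in
     if js \<notin> cidx_all (bridx I n) then 0
     else if p = 0 then res_form V (\<lambda>x vs. if vs = [] then of_nat r else 0)
     else tr_form V (mwedges (\<lambda>_. r)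
       (mform0 V (\<lambda>_. r) (\<lambda>x. mat_inv (comp1 h (js ! p) (js ! 0) x)) #
        map (\<lambda>t. mform1 M V (\<lambda>_. r) (dmat r (comp1 h (js ! Suc t) (js ! t)))) (rev [0..<p]))))"

text \<open>For \<open>s = [s\<^sub>1, \<dots>, s\<^sub>k]\<close> this is \<open>(i\<^sub>0\<^sup>(\<^sup>0\<^sup>), \<dots>, i\<^bsub>s\<^sub>1\<^esub>\<^sup>(\<^sup>0\<^sup>), i\<^bsub>s\<^sub>1\<^esub>\<^sup>(\<^sup>1\<^sup>), \<dots>, i\<^bsub>s\<^sub>2\<^esub>\<^sup>(\<^sup>1\<^sup>), \<dots>, i\<^sub>q\<^sup>(\<^sup>k\<^sup>))\<close>.\<close>

definition simplex_path :: "'i list \<Rightarrow> nat list \<Rightarrow> ('i \<times> nat) list" where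
  "simplex_path js s = (let S = 0 # s @ [length js - 1] in
     concat (map (\<lambda>t. map (\<lambda>v. (js ! v, t)) [S ! t..<Suc (S ! Suc t)]) [0..<Suc (length s)]))"

definition simplex_int :: "'i set \<Rightarrow> nat \<Rightarrow> (('i \<times> nat) list \<Rightarrow> 'a form) \<Rightarrow> 'i list \<Rightarrow> 'a form" where
  "simplex_int I k \<mu> = (\<lambda>js. if js \<in> cidx_all I
     then \<Sum>s | length s = k \<and> sorted s \<and> set s \<subseteq> {..<length js}. alt (sum_list s) (\<mu> (simplex_path js s))
     else 0)"

text \<open>The index list \<open>J\<close> of a generator \<open>e\<^sub>J\<close> is itself the map \<open>\<lambda> : [l] \<rightarrow> [n]\<close>.  The homogeneous
  component of degree \<open>2m\<close> contributes to the coefficient of \<open>u\<^sup>m\<close>.\<close>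

definition iota :: "'i set \<Rightarrow> nat \<Rightarrow> (('i \<times> nat) list \<Rightarrow> 'a form) \<Rightarrow> nat list \<Rightarrow> nat \<Rightarrow> 'i list \<Rightarrow> 'a form" where
  "iota I n c = (\<lambda>J m. let l = length J - 1 in if J \<in> nondeg n
     then alt (l * (l - 1) div 2) (simplex_int I l (cech_act I J (homog (2 * m) c))) else 0)"

definition shuffles_pq :: "nat \<Rightarrow> nat \<Rightarrow> (nat list \<times> nat list) set" where
  "shuffles_pq p q = {(\<mu>, \<nu>). length \<mu> = p \<and> length \<nu> = q \<and> sorted_wrt (<) \<mu> \<and> sorted_wrt (<) \<nu> \<and>
     set \<mu> \<inter> set \<nu> = {} \<and> set \<mu> \<union> set \<nu> = {..<p + q}}"

definition shuffle_inv :: "nat list \<Rightarrow> nat list \<Rightarrow> nat" where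
  "shuffle_inv \<mu> \<nu> = card {(i, j). i < length \<mu> \<and> j < length \<nu> \<and> \<nu> ! j < \<mu> ! i}"

text \<open>\<open>\<Phi> (EZ (x \<otimes> y))\<close> for an additive map \<open>\<Phi>\<close> given by its values on simplices; \<open>dup i\<close> is the
  degeneracy \<open>s\<^sub>i\<close> of a standard simplex.\<close>

definition apply_EZ :: "(nat list \<times> nat list \<Rightarrow> 'c::ab_group_add) \<Rightarrow> nat list \<Rightarrow> nat list \<Rightarrow> 'c" where
  "apply_EZ \<Phi> x y = (\<Sum>(\<mu>, \<nu>)\<in>shuffles_pq (length x - 1) (length y - 1).
     alt (shuffle_inv \<mu> \<nu>) (\<Phi> (fold dup \<nu> x, fold dup \<mu> y)))"

text \<open>The chain map \<open>N(\<int>(\<Delta>\<^sup>n \<times> \<Delta>\<^sup>l)) \<rightarrow> Q(A\<^sup>l)\<close> adjoint to \<open>F\<^sub>l\<close>: a \<open>k\<close>-simplex goes to the value of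
  \<open>F\<^sub>l\<close> at it, evaluated on \<open>e\<^bsub>0,\<dots>,k\<^esub>\<close>.\<close>

definition kappa_adj :: "(nat \<Rightarrow> nat list \<times> nat list \<Rightarrow> nat list \<Rightarrow> 'c) \<Rightarrow> nat \<Rightarrow> nat list \<times> nat list \<Rightarrow> 'c" where
  "kappa_adj F l = (\<lambda>(b, a). F l (a, b) [0..<length a])"

definition kappa_tot :: "'i set \<Rightarrow>
    (nat \<Rightarrow> nat list \<times> nat list \<Rightarrow> nat list \<Rightarrow> nat \<Rightarrow> 'i list \<Rightarrow> 'a form) \<Rightarrow>
    nat list \<Rightarrow> nat \<Rightarrow> 'i list \<Rightarrow> 'a form" where
  "kappa_tot I F J = (\<lambda>m js. let l = length js - 1 in if js \<in> cidx_all I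
     then apply_EZ (kappa_adj F l) J [0..<Suc l] m js else 0)"

definition kappa :: "'i set \<Rightarrow> nat \<Rightarrow>
    (nat \<Rightarrow> nat list \<times> nat list \<Rightarrow> nat list \<Rightarrow> nat \<Rightarrow> 'i list \<Rightarrow> 'a form) \<Rightarrow>
    nat list \<Rightarrow> nat \<Rightarrow> 'i list \<Rightarrow> 'a form" where
  "kappa I n F = (\<lambda>J. let p = length J - 1 in if J \<in> nondeg n
     then alt (p * (p - 1) div 2) (kappa_tot I F J) else 0)"

end

theory Submission
  imports Defs "HOL-Complex_Analysis.Cauchy_Integral_Formula"
begin

text \<open>
  Over a simplex \<open>(a, b)\<close> of \<open>\<Delta>\<^sup>l \<times> \<Delta>\<^sup>n\<close>, the form that \<open>Ch \<circ> \<beta>\<close> attaches to a generator is \<open>\<gamma>(h)\<close> at the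
  index tuple given by \<open>a\<close> and \<open>b\<close>.  Shuffles and the cuts \<open>s\<^sub>1 \<le> \<dots> \<le> s\<^sub>k\<close> parametrize the same lattice paths,
  with the same signs; both sides of the diagram are therefore the signed sum of \<open>\<gamma>(h)\<close> over these paths.

  That \<open>\<gamma>(h)\<close> is \<open>\<delta>\<close>-closed comes from the Leibniz rule for \<open>h\<^sub>c\<^sub>a = h\<^sub>c\<^sub>b h\<^sub>b\<^sub>a\<close>, which makes the inner faces telescope, and
  from the invariance of the trace under moving a \<open>0\<close>-form around, which cancels the outer two.  That \<open>\<iota>\<close>
  yields chain maps is a boundary formula for lattice paths: the faces at the corners of a path cancel in
  pairs, the others remove a row or a column.  On the analytic side, the partial derivative of a
  holomorphic function is holomorphic, being on complex lines a locally uniform limit of difference quotients.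
\<close>

section \<open>Functions of several complex variables\<close>

text \<open>The maps are total functions, so the bare equality would not show that they land where
  the diagram says; most of the work is this well-definedness. On a list of \<open>p + 1\<close>
  indices \<open>gamma\<close> has Cech degree and form degree both equal to \<open>p\<close>. Hence
  its total degree \<open>2 * p\<close> is even, it vanishes once \<open>p\<close> exceeds the
  dimension of \<open>M\<close> (so its homogeneous components are finite in number), and splitting
  by total degree in \<open>iota\<close> agrees with reading off powers of \<open>u\<close> in
  \<open>kappa\<close>. \<open>iota\<close> alone need not be simplicial: the action on
  \<open>DK\<close> kills generators with degenerate image, while a cocycle may be nonzero on lists
  with equal neighbours. But \<open>gamma\<close> is normalized, since \<open>comp1 h a a\<close> is
  constantly 1 and has derivative 0. The sign of a path counts the pairs in which a step in the
  first coordinate precedes one in the second. This number is the sum of the cuts, the number of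
  inversions of the shuffle, and the exponent collected by \<open>path_sum\<close>.\<close>

definition csp :: "nat \<Rightarrow> (nat \<Rightarrow> complex) set" where
  "csp d = {z. \<forall>i\<ge>d. z i = 0}"

text \<open>Complex differentiability with gradient \<open>a\<close>, in Caratheodory's form: sums, products and
  compositions then need no estimates.\<close>

definition hol_at :: "nat \<Rightarrow> (nat \<Rightarrow> complex) set \<Rightarrow> ((nat \<Rightarrow> complex) \<Rightarrow> complex) \<Rightarrow>
    (nat \<Rightarrow> complex) \<Rightarrow> (nat \<Rightarrow> complex) \<Rightarrow> bool" where
  "hol_at d W f z a \<longleftrightarrow> (\<exists>A. (\<forall>i<d. continuous (at z within W) (A i) \<and> A i z = a i) \<and>
     (\<forall>w\<in>W. f w = f z + (\<Sum>i<d. A i w * (w i - z i))))"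

lemma csp_eqI:
  assumes "w \<in> csp d" "z \<in> csp d" "(\<Sum>i<d. cmod (w i - z i)) = 0"
  shows "w = z"
proof
  fix i
  show "w i = z i"
  proof (cases "i < d")
    case True
    then have "cmod (w i - z i) = 0"
      using assms(3) by (subst (asm) sum_nonneg_eq_0_iff) auto
    then show ?thesis by simp
  qed (use assms in \<open>auto simp: csp_def\<close>)
qed

text \<open>The normalized error \<open>q\<close> has to be distributed over the coordinates. The
  identity \<open>cnj (sgn u) * u = cmod u\<close> does this: with weights
  \<open>cnj (sgn (w i - z i))\<close> of modulus at most 1, the products add up to the norm in the
  denominator.\<close>

lemma hol_at_of_limit:
  assumes W: "W \<subseteq> csp d" and z: "z \<in> W"
    and lim: "((\<lambda>w. (f w - f z - (\<Sum>i<d. a i * (w i - z i))) / of_real (\<Sum>i<d. cmod (w i - z i)))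
        \<longlongrightarrow> 0) (at z within W)"
  shows "hol_at d W f z a"
proof -
  define q where "q w = (f w - f z - (\<Sum>i<d. a i * (w i - z i))) / of_real (\<Sum>i<d. cmod (w i - z i))" for w
  define A where "A i w = a i + q w * cnj (sgn (w i - z i))" for i w
  have "continuous (at z within W) (A i)" for i
  proof -
    have "((\<lambda>w. q w * cnj (sgn (w i - z i))) \<longlongrightarrow> 0) (at z within W)"
    proof (rule Lim_null_comparison[OF always_eventually])
      show "\<forall>w. norm (q w * cnj (sgn (w i - z i))) \<le> norm (q w)"
        by (simp add: norm_mult norm_sgn)
      show "((\<lambda>w. norm (q w)) \<longlongrightarrow> 0) (at z within W)"
        using lim tendsto_norm_zero unfolding q_def by blast
    qed
    then have "(A i \<longlongrightarrow> a i + 0) (at z within W)"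
      unfolding A_def by (intro tendsto_intros)
    then show ?thesis by (simp add: continuous_within A_def)
  qed
  moreover have "f w = f z + (\<Sum>i<d. A i w * (w i - z i))" if w: "w \<in> W" for w
  proof (cases "(\<Sum>i<d. cmod (w i - z i)) = 0")
    case True
    then have "w = z" using csp_eqI W w z by blast
    then show ?thesis by simp
  next
    case False
    have *: "cnj (sgn u) * u = of_real (cmod u)" for u :: complex
    proof (cases "u = 0")
      case False
      have "u * cnj u = of_real (cmod u) * of_real (cmod u)"
        by (metis complex_norm_square of_real_power power2_eq_square)
      moreover have "cnj (sgn u) = cnj u / of_real (cmod u)"
        by (metis complex_cnj_complex_of_real complex_cnj_divide sgn_eq)
      ultimately show ?thesis using False by (simp add: mult.commute)
    qed simp
    have "(\<Sum>i<d. A i w * (w i - z i)) =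
        (\<Sum>i<d. a i * (w i - z i)) + q w * (\<Sum>i<d. cnj (sgn (w i - z i)) * (w i - z i))"
      by (simp add: A_def distrib_right sum.distrib sum_distrib_left mult.assoc)
    also have "(\<Sum>i<d. cnj (sgn (w i - z i)) * (w i - z i)) = of_real (\<Sum>i<d. cmod (w i - z i))"
      by (simp add: *)
    finally show ?thesis using False by (simp add: q_def del: of_real_sum)
  qed
  moreover have "A i z = a i" for i by (simp add: A_def)
  ultimately show ?thesis unfolding hol_at_def by blast
qed

text \<open>Each coefficient error \<open>A i w - a i\<close> tends to 0 and each
  \<open>cmod (w i - z i)\<close> is at most the whole norm, so the quotient is bounded by the sum
  of the coefficient errors.\<close>

lemma limit_of_hol_at:
  assumes "hol_at d W f z a"
  shows "((\<lambda>w. (f w - f z - (\<Sum>i<d. a i * (w i - z i))) / of_real (\<Sum>i<d. cmod (w i - z i)))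
        \<longlongrightarrow> 0) (at z within W)"
proof -
  obtain A where A: "\<And>i. i < d \<Longrightarrow> continuous (at z within W) (A i)" "\<And>i. i < d \<Longrightarrow> A i z = a i"
    and eq: "\<And>w. w \<in> W \<Longrightarrow> f w = f z + (\<Sum>i<d. A i w * (w i - z i))"
    using assms unfolding hol_at_def by blast
  show ?thesis
  proof (rule Lim_null_comparison)
    have "((\<lambda>w. \<Sum>i<d. cmod (A i w - a i)) \<longlongrightarrow> (\<Sum>i<d. cmod (a i - a i))) (at z within W)"
      using A by (intro tendsto_intros) (auto simp: continuous_within)
    then show "((\<lambda>w. \<Sum>i<d. cmod (A i w - a i)) \<longlongrightarrow> 0) (at z within W)" by simp
    show "\<forall>\<^sub>F w in at z within W. cmod ((f w - f z - (\<Sum>i<d. a i * (w i - z i))) /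
        of_real (\<Sum>i<d. cmod (w i - z i))) \<le> (\<Sum>i<d. cmod (A i w - a i))"
      unfolding eventually_at_topological
    proof (intro exI[of _ UNIV] conjI ballI impI)
      fix w assume w: "w \<in> W"
      let ?N = "\<Sum>i<d. cmod (w i - z i)"
      have "f w - f z - (\<Sum>i<d. a i * (w i - z i)) = (\<Sum>i<d. (A i w - a i) * (w i - z i))"
        by (simp add: eq[OF w] algebra_simps sum_subtractf sum.distrib)
      also have "cmod \<dots> \<le> (\<Sum>i<d. cmod (A i w - a i) * cmod (w i - z i))"
        by (rule order_trans[OF norm_sum]) (simp add: norm_mult)
      also have "\<dots> \<le> (\<Sum>i<d. cmod (A i w - a i) * ?N)"
        by (intro sum_mono mult_left_mono member_le_sum) auto
      finally have le: "cmod (f w - f z - (\<Sum>i<d. a i * (w i - z i))) \<le> (\<Sum>i<d. cmod (A i w - a i)) * ?N"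
        by (simp add: sum_distrib_right)
      have N: "0 \<le> ?N" by (simp add: sum_nonneg)
      have S: "0 \<le> (\<Sum>i<d. cmod (A i w - a i))" by (simp add: sum_nonneg)
      then show "cmod ((f w - f z - (\<Sum>i<d. a i * (w i - z i))) / of_real ?N)
          \<le> (\<Sum>i<d. cmod (A i w - a i))"
      proof (cases "?N = 0")
        case False
        with N have "cmod (f w - f z - (\<Sum>i<d. a i * (w i - z i))) / ?N \<le> (\<Sum>i<d. cmod (A i w - a i))"
          using le by (simp add: pos_divide_le_eq)
        with N show ?thesis by (simp only: norm_divide norm_of_real abs_of_nonneg)
      \<comment> \<open>For norm 0 the quotient is 0 by the convention for division, and the bound
        is the nonnegativity of the right side.\<close>
      qed (use S in \<open>simp del: of_real_sum\<close>)
    qed auto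
  qed
qed

lemma hol_on_iff:
  assumes "W \<subseteq> csp d"
  shows "hol_on d W f \<longleftrightarrow> (\<forall>z\<in>W. \<exists>a. hol_at d W f z a)"
  unfolding hol_on_def using hol_at_of_limit[OF assms] limit_of_hol_at by blast

lemma hol_at_continuous:
  assumes "hol_at d W f z a"
  shows "continuous (at z within W) f"
proof -
  obtain A where A: "\<And>i. i < d \<Longrightarrow> continuous (at z within W) (A i)"
    and eq: "\<And>w. w \<in> W \<Longrightarrow> f w = f z + (\<Sum>i<d. A i w * (w i - z i))"
    using assms unfolding hol_at_def by blast
  have c: "continuous (at z within W) (\<lambda>w. w i)" for i
  proof -
    have "continuous_on UNIV (\<lambda>w :: nat \<Rightarrow> complex. w i)"
      by (rule continuous_on_product_coordinates)
    then show ?thesis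
      by (metis UNIV_I continuous_at_imp_continuous_at_within continuous_on_eq_continuous_at open_UNIV)
  qed
  have "((\<lambda>w. f z + (\<Sum>i<d. A i w * (w i - z i))) \<longlongrightarrow> f z + (\<Sum>i<d. A i z * (z i - z i))) (at z within W)"
    using A c by (intro tendsto_intros) (auto simp: continuous_within)
  then have "((\<lambda>w. f z + (\<Sum>i<d. A i w * (w i - z i))) \<longlongrightarrow> f z) (at z within W)" by simp
  then have "(f \<longlongrightarrow> f z) (at z within W)"
    by (rule Lim_transform_eventually)
      (use eq in \<open>auto simp: eventually_at_topological intro!: exI[of _ UNIV]\<close>)
  then show ?thesis by (simp add: continuous_within)
qed

lemma hol_at_cong:
  assumes "hol_at d W f z a" "\<And>w. w \<in> W \<Longrightarrow> f w = g w" "z \<in> W"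
  shows "hol_at d W g z a"
  using assms unfolding hol_at_def by auto

lemma hol_at_const: "hol_at d W (\<lambda>_. c) z (\<lambda>_. 0)"
  unfolding hol_at_def by (rule exI[of _ "\<lambda>_ _. 0"]) simp

lemma hol_at_add:
  assumes "hol_at d W f z a" "hol_at d W g z b"
  shows "hol_at d W (\<lambda>w. f w + g w) z (\<lambda>i. a i + b i)"
proof -
  obtain A B where "\<And>i. i < d \<Longrightarrow> continuous (at z within W) (A i) \<and> A i z = a i"
    "\<And>w. w \<in> W \<Longrightarrow> f w = f z + (\<Sum>i<d. A i w * (w i - z i))"
    "\<And>i. i < d \<Longrightarrow> continuous (at z within W) (B i) \<and> B i z = b i"
    "\<And>w. w \<in> W \<Longrightarrow> g w = g z + (\<Sum>i<d. B i w * (w i - z i))"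
    using assms unfolding hol_at_def by blast
  then show ?thesis unfolding hol_at_def
    by (intro exI[of _ "\<lambda>i w. A i w + B i w"])
      (auto intro!: continuous_intros simp: distrib_right sum.distrib)
qed

lemma hol_at_mult:
  assumes "hol_at d W f z a" "hol_at d W g z b"
  shows "hol_at d W (\<lambda>w. f w * g w) z (\<lambda>i. a i * g z + f z * b i)"
proof -
  obtain A B where A: "\<And>i. i < d \<Longrightarrow> continuous (at z within W) (A i) \<and> A i z = a i"
    "\<And>w. w \<in> W \<Longrightarrow> f w = f z + (\<Sum>i<d. A i w * (w i - z i))"
    and B: "\<And>i. i < d \<Longrightarrow> continuous (at z within W) (B i) \<and> B i z = b i"
    "\<And>w. w \<in> W \<Longrightarrow> g w = g z + (\<Sum>i<d. B i w * (w i - z i))"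
    using assms unfolding hol_at_def by blast
  \<comment> \<open>The increment is split as \<open>(f w - f z) * g w + f z * (g w - g z)\<close>;
    this is why one factor is taken at \<open>w\<close> and the other at \<open>z\<close>.\<close>
  have "f w * g w = f z * g z + (\<Sum>i<d. (A i w * g w + f z * B i w) * (w i - z i))" if "w \<in> W" for w
  proof -
    have "(\<Sum>i<d. (A i w * g w + f z * B i w) * (w i - z i)) =
        (\<Sum>i<d. A i w * (w i - z i)) * g w + f z * (\<Sum>i<d. B i w * (w i - z i))"
      by (simp add: algebra_simps sum.distrib sum_distrib_left sum_subtractf sum_distrib_right)
    also have "\<dots> = (f w - f z) * g w + f z * (g w - g z)"
      using A(2)[OF that] B(2)[OF that] by simp
    finally show ?thesis by (simp add: algebra_simps)
  qed
  then show ?thesis unfolding hol_at_def using A(1) B(1)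
    by (intro exI[of _ "\<lambda>i w. A i w * g w + f z * B i w"])
      (auto intro!: continuous_intros hol_at_continuous[OF assms(2)])
qed

text \<open>Substituting one expansion into the other gives the coefficients
  \<open>A k (T w) * B k i w\<close>, summed over \<open>k\<close>. Continuity of \<open>T\<close>
  is a separate premise because differentiability is given only for the coordinates below
  \<open>d'\<close>, while the values of \<open>T\<close> have infinitely many coordinates.\<close>

lemma hol_at_compose:
  assumes f: "hol_at d' W' f (T z) a" and T: "\<And>k. k < d' \<Longrightarrow> hol_at d W (\<lambda>w. T w k) z (b k)"
    and cont: "continuous (at z within W) T" and TW: "T ` W \<subseteq> W'"
  shows "hol_at d W (\<lambda>w. f (T w)) z (\<lambda>i. \<Sum>k<d'. a k * b k i)"
proof -
  obtain A where A: "\<And>i. i < d' \<Longrightarrow> continuous (at (T z) within W') (A i)" "\<And>i. i < d' \<Longrightarrow> A i (T z) = a i"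
    "\<And>w. w \<in> W' \<Longrightarrow> f w = f (T z) + (\<Sum>i<d'. A i w * (w i - T z i))"
    using f unfolding hol_at_def by blast
  have "\<forall>k\<in>{..<d'}. \<exists>B. (\<forall>i<d. continuous (at z within W) (B i) \<and> B i z = b k i) \<and>
     (\<forall>w\<in>W. T w k = T z k + (\<Sum>i<d. B i w * (w i - z i)))"
    using T unfolding hol_at_def by blast
  then obtain B where B': "\<forall>k\<in>{..<d'}. (\<forall>i<d. continuous (at z within W) (B k i) \<and> B k i z = b k i) \<and>
     (\<forall>w\<in>W. T w k = T z k + (\<Sum>i<d. B k i w * (w i - z i)))"
    unfolding bchoice_iff by blast
  then have B: "\<And>k i. k < d' \<Longrightarrow> i < d \<Longrightarrow> continuous (at z within W) (B k i) \<and> B k i z = b k i"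
    "\<And>k w. k < d' \<Longrightarrow> w \<in> W \<Longrightarrow> T w k - T z k = (\<Sum>i<d. B k i w * (w i - z i))"
    by simp_all
  have c: "continuous (at z within W) (\<lambda>w. A k (T w))" if "k < d'" for k
    using continuous_within_compose2[OF cont] A(1)[OF that] TW continuous_within_subset by blast
  show ?thesis unfolding hol_at_def
  proof (intro exI[of _ "\<lambda>i w. \<Sum>k<d'. A k (T w) * B k i w"] conjI allI impI ballI)
    fix i assume "i < d"
    then show "continuous (at z within W) (\<lambda>w. \<Sum>k<d'. A k (T w) * B k i w)"
      using B c by (intro continuous_intros) auto
    show "(\<Sum>k<d'. A k (T z) * B k i z) = (\<Sum>k<d'. a k * b k i)"
      using A B \<open>i < d\<close> by auto
  next
    fix w assume w: "w \<in> W"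
    have "f (T w) = f (T z) + (\<Sum>k<d'. A k (T w) * (T w k - T z k))"
      using A(3) TW w by blast
    also have "(\<Sum>k<d'. A k (T w) * (T w k - T z k)) = (\<Sum>k<d'. A k (T w) * (\<Sum>i<d. B k i w * (w i - z i)))"
      using B(2) w by simp
    also have "\<dots> = (\<Sum>k<d'. \<Sum>i<d. A k (T w) * B k i w * (w i - z i))"
      by (simp add: sum_distrib_left mult.assoc)
    also have "\<dots> = (\<Sum>i<d. \<Sum>k<d'. A k (T w) * B k i w * (w i - z i))"
      by (rule sum.swap)
    finally show "f (T w) = f (T z) + (\<Sum>i<d. (\<Sum>k<d'. A k (T w) * B k i w) * (w i - z i))"
      by (simp add: sum_distrib_right)
  qed
qed

lemma hol_at_coord: 
  assumes "k < d" shows "hol_at d W (\<lambda>w. w k) z (\<lambda>i. if i = k then 1 else 0)"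
proof -
  have "(\<Sum>i<d. (if i = k then 1 else 0) * (w i - z i)) = w k - z k" for w z :: "nat \<Rightarrow> complex"
    using assms by (subst sum.cong[OF refl, of _ _ "\<lambda>i. if i = k then w i - z i else 0"]) auto
  then show ?thesis unfolding hol_at_def
    by (intro exI[of _ "\<lambda>i _. if i = k then 1 else 0"]) auto
qed

lemma cspace_eq: "cspace d = top_of_set (csp d)"
  by (simp add: cspace_def csp_def)

lemma openin_cspace_subset: "openin (cspace d) W \<Longrightarrow> W \<subseteq> csp d"
  by (metis cspace_eq openin_imp_subset)

text \<open>A basic open set of the product topology is a box. From index \<open>d\<close> on its
  constraints hold automatically, as all points of \<open>csp d\<close> are 0 there; finitely many
  remain and have a common radius.\<close>

lemma openin_cspace_ball:
  assumes "openin (cspace d) W" "z \<in> W"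
  obtains e where "0 < e" "\<And>w. w \<in> csp d \<Longrightarrow> (\<Sum>i<d. cmod (w i - z i)) < e \<Longrightarrow> w \<in> W"
proof -
  obtain T where T: "open T" "W = csp d \<inter> T"
    using assms(1) unfolding cspace_eq openin_open by blast
  have "openin (product_topology (\<lambda>i. euclidean) UNIV) T"
    using T(1) by (simp add: open_fun_def)
  from product_topology_open_contains_basis[OF this, of z] T assms(2)
  obtain X where X: "z \<in> Pi\<^sub>E UNIV X" "\<And>i. open (X i)" "Pi\<^sub>E UNIV X \<subseteq> T"
    by auto
  have "\<forall>i. \<exists>e>0. ball (z i) e \<subseteq> X i"
    using X(1,2) open_contains_ball by (metis PiE_mem UNIV_I)
  then obtain e where e: "\<And>i. 0 < e i" "\<And>i. ball (z i) (e i) \<subseteq> X i" by metis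
  \<comment> \<open>The 1 keeps the set nonempty for \<open>d = 0\<close>.\<close>
  define r where "r = Min (insert 1 (e ` {..<d}))"
  have r: "0 < r" "\<And>i. i < d \<Longrightarrow> r \<le> e i"
    using e by (auto simp: r_def)
  show ?thesis
  proof (rule that[OF r(1)])
    fix w assume w: "w \<in> csp d" "(\<Sum>i<d. cmod (w i - z i)) < r"
    have "w i \<in> X i" for i
    proof (cases "i < d")
      case True
      have "cmod (w i - z i) \<le> (\<Sum>i<d. cmod (w i - z i))"
        using True by (intro member_le_sum) auto
      then have "w i \<in> ball (z i) (e i)"
        using w(2) r(2)[OF True] by (simp add: dist_norm norm_minus_commute)
      then show ?thesis using e(2) by blast
    next
      case False
      then have "w i = z i" using w(1) assms(2) T by (simp add: csp_def)
      then show ?thesis using X(1) by auto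
    qed
    then have "w \<in> Pi\<^sub>E UNIV X" by auto
    then show "w \<in> W" using X(3) T w(1) by blast
  qed
qed

text \<open>The filter says nothing about \<open>z\<close> itself, hence the alternative
  \<open>w = z\<close>.\<close>

lemma eventually_cspace_ball:
  assumes W: "openin (cspace d) W" "z \<in> W" and P: "eventually P (at z within W)"
  obtains e where "0 < e"
    "\<And>w. w \<in> csp d \<Longrightarrow> (\<Sum>i<d. cmod (w i - z i)) < e \<Longrightarrow> w \<in> W \<and> (w = z \<or> P w)"
proof -
  obtain T where T: "open T" "z \<in> T" "\<And>w. w \<in> T \<Longrightarrow> w \<noteq> z \<Longrightarrow> w \<in> W \<Longrightarrow> P w"
    using P unfolding eventually_at_topological by blast
  have "openin (cspace d) (W \<inter> T)"
    using W T openin_Int_open unfolding cspace_eq by blast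
  moreover have "z \<in> W \<inter> T" using W T by simp
  ultimately obtain e where e: "0 < e" "\<And>w. w \<in> csp d \<Longrightarrow> (\<Sum>i<d. cmod (w i - z i)) < e \<Longrightarrow> w \<in> W \<inter> T"
    by (rule openin_cspace_ball) (rule that)
  show ?thesis
  proof (rule that[OF e(1)])
    fix w assume "w \<in> csp d" "(\<Sum>i<d. cmod (w i - z i)) < e"
    then have "w \<in> W \<inter> T" by (rule e(2))
    then show "w \<in> W \<and> (w = z \<or> P w)" using T(3) by auto
  qed
qed

section \<open>Restriction to complex lines\<close>

definition line :: "(nat \<Rightarrow> complex) \<Rightarrow> (nat \<Rightarrow> complex) \<Rightarrow> complex \<Rightarrow> nat \<Rightarrow> complex" where
  "line z v t = (\<lambda>i. z i + t * v i)"

lemma line_csp: "z \<in> csp d \<Longrightarrow> v \<in> csp d \<Longrightarrow> line z v t \<in> csp d"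
  by (simp add: csp_def line_def)

lemma line_0 [simp]: "line z v 0 = z"
  by (simp add: line_def)

text \<open>The parameters for which the line stays in \<open>W\<close> form an open set
  \<open>S\<close>, so continuity within \<open>W\<close> pulls back to an unrestricted limit at
  \<open>t0\<close>.\<close>

lemma hol_at_line:
  assumes W: "openin (cspace d) W" and zv: "z \<in> csp d" "v \<in> csp d" and t0: "line z v t0 \<in> W"
    and f: "hol_at d W f (line z v t0) a"
  shows "((\<lambda>t. f (line z v t)) has_field_derivative (\<Sum>i<d. a i * v i)) (at t0)"
proof -
  obtain A where AE: "(\<forall>i<d. continuous (at (line z v t0) within W) (A i) \<and> A i (line z v t0) = a i) \<and>
      (\<forall>w\<in>W. f w = f (line z v t0) + (\<Sum>i<d. A i w * (w i - line z v t0 i)))"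
    using f unfolding hol_at_def by (elim exE)
  have A: "continuous (at (line z v t0) within W) (A i)" "A i (line z v t0) = a i" if "i < d" for i
    using AE that by auto
  have eq: "f w = f (line z v t0) + (\<Sum>i<d. A i w * (w i - line z v t0 i))" if "w \<in> W" for w
    using AE that by blast
  define S where "S = {t. line z v t \<in> W}"
  have cl: "continuous_on UNIV (line z v)"
    unfolding line_def by (intro continuous_on_coordinatewise_then_product continuous_intros)
  obtain T where T: "open T" "W = csp d \<inter> T"
    using W unfolding cspace_eq openin_open by blast
  have "S = line z v -` T" using T zv by (auto simp: S_def line_csp)
  then have S: "open S" using T(1) cl by (simp add: open_vimage)
  have t0S: "t0 \<in> S" using t0 by (simp add: S_def)
  have "((\<lambda>t. \<Sum>i<d. A i (line z v t) * v i) \<longlongrightarrow> (\<Sum>i<d. A i (line z v t0) * v i)) (at t0 within S)"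
  proof (intro tendsto_intros)
    fix i assume i: "i \<in> {..<d}"
    have "continuous (at t0 within S) (line z v)"
      using continuous_on_subset[OF cl subset_UNIV, of S] t0S unfolding continuous_on_eq_continuous_within by blast
    moreover have "continuous (at (line z v t0) within line z v ` S) (A i)"
      by (rule continuous_within_subset[OF A(1)]) (use i in \<open>auto simp: S_def\<close>)
    ultimately have "continuous (at t0 within S) (\<lambda>t. A i (line z v t))"
      by (rule continuous_within_compose2)
    then show "((\<lambda>t. A i (line z v t)) \<longlongrightarrow> A i (line z v t0)) (at t0 within S)"
      by (simp add: continuous_within)
  qed
  then have "((\<lambda>t. \<Sum>i<d. A i (line z v t) * v i) \<longlongrightarrow> (\<Sum>i<d. a i * v i)) (at t0)"
    using A(2) by (simp add: at_within_open[OF t0S S])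
  moreover have "\<forall>\<^sub>F t in at t0. (\<Sum>i<d. A i (line z v t) * v i) = (f (line z v t) - f (line z v t0)) / (t - t0)"
    unfolding eventually_at_topological
  proof (intro exI[of _ S] conjI S t0S ballI impI)
    fix t assume t: "t \<in> S" "t \<noteq> t0"
    have "f (line z v t) - f (line z v t0) = (\<Sum>i<d. A i (line z v t) * (line z v t i - line z v t0 i))"
      using eq[of "line z v t"] t(1) by (simp add: S_def)
    also have "\<dots> = (\<Sum>i<d. A i (line z v t) * v i) * (t - t0)"
      unfolding sum_distrib_right by (rule sum.cong) (simp_all add: line_def algebra_simps)
    finally show "(\<Sum>i<d. A i (line z v t) * v i) = (f (line z v t) - f (line z v t0)) / (t - t0)"
      using t by simp
  qed
  ultimately show ?thesis
    unfolding has_field_derivative_iff by (rule Lim_transform_eventually)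
qed

definition uvec :: "nat \<Rightarrow> nat \<Rightarrow> complex" where
  "uvec i = (\<lambda>j. if j = i then 1 else 0)"

lemma uvec_csp: "i < d \<Longrightarrow> uvec i \<in> csp d"
  by (simp add: uvec_def csp_def)

lemma sum_uvec: "i < d \<Longrightarrow> (\<Sum>j<d. a j * uvec i j) = a i"
  by (simp add: uvec_def if_distrib cong: if_cong)

lemma norm_uvec: "i < d \<Longrightarrow> (\<Sum>j<d. cmod (uvec i j)) = 1"
  by (simp add: uvec_def if_distrib[of cmod] cong: if_cong)

lemma line_uvec: "line z (uvec i) t = z(i := z i + t)"
  by (auto simp: line_def uvec_def)

lemma hol_at_coord_deriv:
  assumes W: "openin (cspace d) W" and z: "z \<in> W" and i: "i < d" and f: "hol_at d W f z a"
  shows "((\<lambda>t. f (z(i := t))) has_field_derivative a i) (at (z i))"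
proof -
  have zc: "z \<in> csp d" using W z openin_cspace_subset by blast
  have "((\<lambda>t. f (line z (uvec i) t)) has_field_derivative (\<Sum>j<d. a j * uvec i j)) (at 0)"
    by (rule hol_at_line[OF W zc uvec_csp[OF i]]) (use z f in auto)
  then have *: "((\<lambda>t. f (z(i := z i + t))) has_field_derivative a i) (at 0)"
    using i by (simp add: sum_uvec line_uvec)
  show ?thesis
    using DERIV_shift[of "\<lambda>t. f (z(i := t))" "a i" "0::complex" "z i"] * by (simp add: add.commute)
qed

text \<open>Cauchy's inequality on the disc of radius \<open>R / 2\<close> about a point of
  \<open>ball 0 (R / 2)\<close> bounds the second derivative by
  \<open>2 * B / (R / 2)^2 = 8 * B / R^2\<close>; the Taylor estimate of order 1 divides this by
  \<open>fact 1\<close> only.\<close>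

lemma taylor_remainder:
  assumes f: "f holomorphic_on ball 0 R" and R: "0 < R" and B: "\<And>t. t \<in> ball 0 R \<Longrightarrow> cmod (f t) \<le> B"
    and t: "cmod t < R / 2"
  shows "cmod (f t - f 0 - t * deriv f 0) \<le> 8 * B / R\<^sup>2 * (cmod t)\<^sup>2"
proof -
  have d: "((deriv ^^ i) f has_field_derivative (deriv ^^ Suc i) f x) (at x within ball 0 (R / 2))"
    if "x \<in> ball 0 (R / 2)" for i x
  proof -
    have "x \<in> ball 0 R" using that R by auto
    then have "(deriv ^^ i) f field_differentiable at x"
      using holomorphic_higher_deriv[OF f open_ball] holomorphic_on_imp_differentiable_at open_ball by blast
    from field_differentiable_derivI[OF this] show ?thesis
      by (simp add: has_field_derivative_at_within)
  qed
  have b: "cmod ((deriv ^^ Suc 1) f x) \<le> 8 * B / R\<^sup>2" if x: "x \<in> ball 0 (R / 2)" for x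
  proof -
    have sub: "cball x (R / 2) \<subseteq> ball 0 R"
    proof
      fix y assume "y \<in> cball x (R / 2)"
      then have "cmod (y - x) \<le> R / 2" "cmod x < R / 2" using x by (auto simp: dist_norm norm_minus_commute)
      then show "y \<in> ball 0 R" using norm_triangle_ineq[of "y - x" x] by simp
    qed
    have "cmod ((deriv ^^ 2) f x) \<le> fact 2 * B / (R / 2) ^ 2"
    proof (rule Cauchy_inequality)
      show "f holomorphic_on ball x (R / 2)"
        using f sub ball_subset_cball holomorphic_on_subset by blast
      show "continuous_on (cball x (R / 2)) f"
        using f sub holomorphic_on_imp_continuous_on continuous_on_subset by blast
      show "cmod (f y) \<le> B" if "cmod (x - y) = R / 2" for y
        using that sub by (intro B) (auto simp: dist_norm subset_iff)
    qed (use R in auto)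
    then show ?thesis by (simp add: power2_eq_square numeral_2_eq_2)
  qed
  have "cmod ((deriv ^^ 0) f t - (\<Sum>i\<le>1. (deriv ^^ i) f 0 * (t - 0) ^ i / fact i))
      \<le> 8 * B / R\<^sup>2 * cmod (t - 0) ^ Suc 1 / fact 1"
    by (rule complex_Taylor[of "ball 0 (R / 2)" 1 "\<lambda>i. (deriv ^^ i) f"]) (use d b t R in auto)
  then show ?thesis by (simp add: algebra_simps power2_eq_square)
qed

lemma holomorphic_on_of_DERIV:
  assumes "\<And>x. x \<in> S \<Longrightarrow> (f has_field_derivative f' x) (at x)"
  shows "f holomorphic_on S"
  unfolding holomorphic_on_def field_differentiable_def
  using has_field_derivative_at_within[OF assms] by blast

text \<open>Let \<open>g\<close> be the partial derivative. Near \<open>z\<close>, on every complex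
  line through \<open>z\<close>, it is a uniform limit of difference quotients of \<open>f\<close>,
  hence holomorphic, and its derivative at \<open>z\<close> is a limit of expressions linear in the
  direction, hence linear itself. A quadratic Taylor remainder whose constant does not depend on the
  direction then turns differentiability along lines into joint differentiability.\<close>

theorem hol_on_coord_deriv:
  assumes W: "openin (cspace d) W" and f: "hol_on d W f" and i: "i < d"
  shows "hol_on d W (\<lambda>w. deriv (\<lambda>t. f (w(i := t))) (w i))"
proof -
  have Wd: "W \<subseteq> csp d" using W by (rule openin_cspace_subset)
  obtain a where a: "\<And>z. z \<in> W \<Longrightarrow> hol_at d W f z (a z)"
    using f hol_on_iff[OF Wd] by metis
  define g where "g w = a w i" for w
  have "\<exists>b. hol_at d W g z b" if z: "z \<in> W" for z
  proof -
    have zc: "z \<in> csp d" using z Wd by blast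
    have "continuous (at z within W) f" using a[OF z] by (rule hol_at_continuous)
    then have "\<forall>\<^sub>F w in at z within W. dist (f w) (f z) < 1"
      unfolding continuous_within by (rule tendstoD) simp
    then obtain e where e: "0 < e"
      "\<And>w. w \<in> csp d \<Longrightarrow> (\<Sum>i<d. cmod (w i - z i)) < e \<Longrightarrow> w \<in> W \<and> (w = z \<or> dist (f w) (f z) < 1)"
      by (rule eventually_cspace_ball[OF W z]) (rule that)
    define B where "B = cmod (f z) + 1"
    have fB: "cmod (f w) \<le> B" if "w \<in> csp d" "(\<Sum>i<d. cmod (w i - z i)) < e" for w
    proof -
      have "dist (f w) (f z) \<le> 1" using e(2)[OF that] by auto
      then show ?thesis unfolding B_def dist_norm using norm_triangle_sub[of "f w" "f z"] by simp
    qed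
    \<comment> \<open>For \<open>v\<close> of norm at most 1, \<open>cmod t \<le> R\<close> and
      \<open>cmod s < 2 * R\<close>, the point \<open>P v t s\<close> is at distance less than
      \<open>3 * R\<close> from \<open>z\<close>, well inside the neighbourhood of radius
      \<open>e\<close>.\<close>
    define R where "R = e / 4"
    have R: "0 < R" using e(1) by (simp add: R_def)
    define P where "P v t s = line (line z v t) (uvec i) s" for v t s
    have Pc: "P v t s \<in> csp d" if "v \<in> csp d" for v t s
      unfolding P_def by (intro line_csp zc that uvec_csp i)
    have Pn: "(\<Sum>j<d. cmod (P v t s j - z j)) < e"
      if v: "(\<Sum>j<d. cmod (v j)) \<le> 1" and ts: "cmod t + cmod s < e" for v t s
    proof -
      have "(\<Sum>j<d. cmod (P v t s j - z j)) \<le> (\<Sum>j<d. cmod t * cmod (v j) + cmod s * cmod (uvec i j))"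
        by (rule sum_mono, unfold P_def line_def)
          (metis add_diff_cancel_left' add.assoc norm_mult norm_triangle_ineq)
      also have "\<dots> = cmod t * (\<Sum>j<d. cmod (v j)) + cmod s"
        by (simp add: sum.distrib flip: sum_distrib_left, simp add: norm_uvec[OF i])
      also have "\<dots> \<le> cmod t + cmod s" using v by (simp add: mult_left_le)
      finally show ?thesis using ts by simp
    qed
    have P0: "P v t 0 = line z v t" for v t by (simp add: P_def)
    have Ps: "P v t s = line (line z (uvec i) s) v t" for v t s
      by (simp add: P_def line_def add.commute add.left_commute)
    have Ds: "((\<lambda>s. f (P v t s)) has_field_derivative g (P v t s)) (at s)"
      if v: "v \<in> csp d" "(\<Sum>j<d. cmod (v j)) \<le> 1" and ts: "cmod t + cmod s < e" for v t s
    proof -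
      have "P v t s \<in> W" using e(2)[OF Pc Pn] that by blast
      then have "((\<lambda>s. f (line (line z v t) (uvec i) s)) has_field_derivative
          (\<Sum>j<d. a (P v t s) j * uvec i j)) (at s)"
        unfolding P_def by (intro hol_at_line[OF W] line_csp zc v uvec_csp i a)
      then show ?thesis by (simp add: sum_uvec[OF i] g_def P_def)
    qed
    have Dt: "((\<lambda>t. f (P v t s)) has_field_derivative (\<Sum>j<d. a (P v t s) j * v j)) (at t)"
      if v: "v \<in> csp d" "(\<Sum>j<d. cmod (v j)) \<le> 1" and ts: "cmod t + cmod s < e" for v t s
    proof -
      have "P v t s \<in> W" using e(2)[OF Pc Pn] that by blast
      then show ?thesis
        unfolding Ps by (intro hol_at_line[OF W] line_csp zc v uvec_csp i a)
    qed
    \<comment> \<open>Taylor's estimate in \<open>s\<close> on the disc of radius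
      \<open>2 * R\<close> makes the error of the difference quotient small uniformly in
      \<open>t\<close>; Cauchy's inequality on radius \<open>R\<close> bounds \<open>g\<close>,
      which its own Taylor remainder will require.\<close>
    have q: "cmod ((f (P v t s) - f (P v t 0)) / s - g (P v t 0)) \<le> 8 * B / (2 * R)\<^sup>2 * cmod s"
      and gB: "cmod (g (P v t 0)) \<le> B / R"
      if v: "v \<in> csp d" "(\<Sum>j<d. cmod (v j)) \<le> 1" and t: "cmod t \<le> R" and s: "cmod s < R" "s \<noteq> 0" for v t s
    proof -
      have h: "(\<lambda>s. f (P v t s)) holomorphic_on ball 0 (2 * R)"
        by (rule holomorphic_on_of_DERIV[OF Ds[OF v]]) (use t e(1) in \<open>simp add: R_def\<close>)
      have b: "cmod (f (P v t s)) \<le> B" if "s \<in> ball 0 (2 * R)" for s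
        using that t R by (intro fB Pc v Pn) (auto simp: R_def)
      have dg: "deriv (\<lambda>s. f (P v t s)) 0 = g (P v t 0)"
        using Ds[OF v, of t 0] t R by (intro DERIV_imp_deriv) (auto simp: R_def)
      have "cmod (f (P v t s) - f (P v t 0) - s * g (P v t 0)) \<le> 8 * B / (2 * R)\<^sup>2 * (cmod s)\<^sup>2"
        using taylor_remainder[OF h _ b, of s] R s(1) by (simp add: dg)
      then have "cmod (f (P v t s) - f (P v t 0) - s * g (P v t 0)) \<le> 8 * B / (2 * R)\<^sup>2 * cmod s * cmod s"
        by (simp only: power2_eq_square mult.assoc)
      moreover have s_pos: "0 < cmod s" using s(2) by simp
      ultimately have "cmod (f (P v t s) - f (P v t 0) - s * g (P v t 0)) / cmod s \<le> 8 * B / (2 * R)\<^sup>2 * cmod s"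
        by (simp only: pos_divide_le_eq[OF s_pos])
      moreover have "(f (P v t s) - f (P v t 0)) / s - g (P v t 0) = (f (P v t s) - f (P v t 0) - s * g (P v t 0)) / s"
        using s(2) by (simp add: divide_simps)
      ultimately show "cmod ((f (P v t s) - f (P v t 0)) / s - g (P v t 0)) \<le> 8 * B / (2 * R)\<^sup>2 * cmod s"
        by (simp only: norm_divide)
      have "cmod ((deriv ^^ 1) (\<lambda>s. f (P v t s)) 0) \<le> fact 1 * B / R ^ 1"
      proof (rule Cauchy_inequality)
        show "(\<lambda>s. f (P v t s)) holomorphic_on ball 0 R"
          using h by (rule holomorphic_on_subset) (use R in auto)
        show "continuous_on (cball 0 R) (\<lambda>s. f (P v t s))"
          by (rule holomorphic_on_imp_continuous_on[OF holomorphic_on_subset[OF h]]) (use R in auto)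
        show "cmod (f (P v t x)) \<le> B" if "cmod (0 - x) = R" for x
          using that R by (intro b) auto
      qed (use R in auto)
      then show "cmod (g (P v t 0)) \<le> B / R" by (simp add: dg)
    qed
    \<comment> \<open>A null sequence of nonzero increments of modulus at most
      \<open>R / 2\<close>.\<close>
    define s :: "nat \<Rightarrow> complex" where "s n = of_real (R / real (n + 2))" for n
    have cs: "cmod (s n) = R / real (n + 2)" for n
      using R unfolding s_def norm_of_real by simp
    have s: "cmod (s n) < R" "s n \<noteq> 0" for n
      using R cs[of n] by (auto simp: divide_less_eq)
    have s_lim: "(\<lambda>n. cmod (s n)) \<longlonglongrightarrow> 0"
    proof -
      have "(\<lambda>n. R / real (n + 2)) \<longlonglongrightarrow> 0"
        using LIMSEQ_ignore_initial_segment[OF lim_const_over_n[of R], of 2] by simp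
      then show ?thesis by (simp only: cs)
    qed
    \<comment> \<open>The difference quotient in direction \<open>i\<close> of the gradient of
      \<open>f\<close> at \<open>z\<close>. It does not involve \<open>v\<close>, because at
      \<open>t = 0\<close> the direction drops out of \<open>P\<close>; so the
      \<open>t\<close>-derivative of the difference quotient of \<open>f\<close> at 0 is linear in
      \<open>v\<close> with these coefficients.\<close>
    define c where "c n j = (a (P (\<lambda>_. 0) 0 (s n)) j - a z j) / s n" for n j
    have P00: "P v 0 s = P (\<lambda>_. 0) 0 s" for v s by (simp add: P_def)
    have lim: "\<exists>g'. (\<forall>t\<in>ball 0 R. ((\<lambda>t. g (P v t 0)) has_field_derivative g' t) (at t)) \<and>
        (\<lambda>n. \<Sum>j<d. c n j * v j) \<longlonglongrightarrow> g' 0"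
      if v: "v \<in> csp d" "(\<Sum>j<d. cmod (v j)) \<le> 1" for v
    proof -
      define F where "F n t = (f (P v t (s n)) - f (P v t 0)) / s n" for n t
      define F' where "F' n t = ((\<Sum>j<d. a (P v t (s n)) j * v j) - (\<Sum>j<d. a (P v t 0) j * v j)) / s n" for n t
      have FD: "(F n has_field_derivative F' n t) (at t)" if "cmod t \<le> R" for n t
        unfolding F_def F'_def using that s[of n] R
        by (intro DERIV_cdivide DERIV_diff Dt v) (auto simp: R_def)
      have cont: "\<forall>\<^sub>F n in sequentially. continuous_on (cball 0 R) (F n) \<and>
          (\<forall>t\<in>ball 0 R. (F n has_field_derivative F' n t) (at t))"
        using FD by (intro always_eventually allI conjI continuous_at_imp_continuous_on ballI DERIV_isCont) auto
      have "uniform_limit (cball 0 R) F (\<lambda>t. g (P v t 0)) sequentially"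
      proof (rule uniform_limitI)
        fix \<epsilon> :: real assume \<epsilon>: "0 < \<epsilon>"
        have "(\<lambda>n. 8 * B / (2 * R)\<^sup>2 * cmod (s n)) \<longlonglongrightarrow> 8 * B / (2 * R)\<^sup>2 * 0"
          by (intro tendsto_intros s_lim)
        then have "\<forall>\<^sub>F n in sequentially. 8 * B / (2 * R)\<^sup>2 * cmod (s n) < \<epsilon>"
          using \<epsilon> by (intro order_tendstoD(2)) auto
        then show "\<forall>\<^sub>F n in sequentially. \<forall>t\<in>cball 0 R. dist (F n t) (g (P v t 0)) < \<epsilon>"
        proof (rule eventually_mono, intro ballI)
          fix n t assume n: "8 * B / (2 * R)\<^sup>2 * cmod (s n) < \<epsilon>" and "t \<in> cball (0::complex) R"
          then have "cmod t \<le> R" by simp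
          from q[OF v this s] n show "dist (F n t) (g (P v t 0)) < \<epsilon>"
            unfolding dist_norm F_def by (rule le_less_trans)
        qed
      qed
      then obtain g' where g':
        "\<And>w. w \<in> ball 0 R \<Longrightarrow> ((\<lambda>t. g (P v t 0)) has_field_derivative g' w) (at w) \<and> (\<lambda>n. F' n w) \<longlonglongrightarrow> g' w"
        by (rule has_complex_derivative_uniform_limit[OF cont _ trivial_limit_sequentially R]) (rule that)
      have "F' n 0 = (\<Sum>j<d. c n j * v j)" for n
      proof -
        have "F' n 0 = (\<Sum>j<d. a (P (\<lambda>_. 0) 0 (s n)) j * v j - a z j * v j) / s n"
          unfolding F'_def P00[of v "s n"] P0 line_0 by (simp only: sum_subtractf)
        also have "\<dots> = (\<Sum>j<d. c n j * v j)"
          unfolding sum_divide_distrib c_def by (rule sum.cong) (simp_all add: left_diff_distrib)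
        finally show ?thesis .
      qed
      then have "(\<lambda>n. \<Sum>j<d. c n j * v j) \<longlonglongrightarrow> g' 0"
        using g'[of 0] R by simp
      then show ?thesis using g' by blast
    qed
    \<comment> \<open>The gradient of \<open>g\<close> at \<open>z\<close>; these limits exist by
      the preceding fact applied to unit vectors.\<close>
    define b where "b j = lim (\<lambda>n. c n j)" for j
    have b: "(\<lambda>n. c n j) \<longlonglongrightarrow> b j" if j: "j < d" for j
      using lim[OF uvec_csp[OF j]] norm_uvec[OF j] by (auto simp: sum_uvec[OF j] b_def convergent_LIMSEQ_iff[symmetric] convergent_def)
    have main: "cmod (g w - g z - (\<Sum>j<d. b j * (w j - z j))) \<le>
        8 * (B / R) / R\<^sup>2 * (\<Sum>j<d. cmod (w j - z j))\<^sup>2"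
      if w: "w \<in> csp d" "(\<Sum>j<d. cmod (w j - z j)) < R / 2" for w
    proof (cases "(\<Sum>j<d. cmod (w j - z j)) = 0")
      case True
      then have "w = z" using csp_eqI w(1) zc by blast
      then show ?thesis by simp
    next
      case False
      define \<rho> where "\<rho> = (\<Sum>j<d. cmod (w j - z j))"
      have \<rho>: "0 < \<rho>" "\<rho> < R / 2" using False w(2) sum_nonneg[of "{..<d}" "\<lambda>j. cmod (w j - z j)"]
        by (auto simp: \<rho>_def)
      \<comment> \<open>The direction from \<open>z\<close> to \<open>w\<close> scaled to norm 1, so
        that \<open>w\<close> is the point with parameter \<open>\<rho>\<close> on the line.\<close>
      define v where "v j = (w j - z j) / of_real \<rho>" for j
      have vc: "v \<in> csp d" using w(1) zc by (simp add: csp_def v_def)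
      have "(\<Sum>j<d. cmod (v j)) = \<rho> / \<rho>"
        unfolding v_def norm_divide sum_divide_distrib[symmetric] \<rho>_def[symmetric] using \<rho> by simp
      then have vn: "(\<Sum>j<d. cmod (v j)) \<le> 1" using \<rho> by simp
      obtain g' where g': "\<And>t. t \<in> ball 0 R \<Longrightarrow> ((\<lambda>t. g (P v t 0)) has_field_derivative g' t) (at t)"
        "(\<lambda>n. \<Sum>j<d. c n j * v j) \<longlonglongrightarrow> g' 0"
        using lim[OF vc vn] by blast
      have "(\<lambda>n. \<Sum>j<d. c n j * v j) \<longlonglongrightarrow> (\<Sum>j<d. b j * v j)"
        by (intro tendsto_intros b) auto
      then have g'0: "g' 0 = (\<Sum>j<d. b j * v j)" using g'(2) LIMSEQ_unique by blast
      have h: "(\<lambda>t. g (P v t 0)) holomorphic_on ball 0 R"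
        using g'(1) by (rule holomorphic_on_of_DERIV)
      have "cmod (g (P v (of_real \<rho>) 0) - g (P v 0 0) - of_real \<rho> * deriv (\<lambda>t. g (P v t 0)) 0) \<le>
          8 * (B / R) / R\<^sup>2 * (cmod (of_real \<rho>))\<^sup>2"
        by (rule taylor_remainder[OF h R]) (use gB[OF vc vn _ s[of 0]] \<rho> in auto)
      moreover have "deriv (\<lambda>t. g (P v t 0)) 0 = (\<Sum>j<d. b j * v j)"
        using DERIV_imp_deriv[OF g'(1)[of 0]] R g'0 by simp
      moreover have "P v (of_real \<rho>) 0 = w" using \<rho> by (auto simp: P_def line_def v_def)
      moreover have "of_real \<rho> * (\<Sum>j<d. b j * v j) = (\<Sum>j<d. b j * (w j - z j))"
        unfolding sum_distrib_left v_def using \<rho> by (intro sum.cong) auto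
      ultimately show ?thesis using \<rho> by (simp add: P_def \<rho>_def[symmetric])
    qed
    have "((\<lambda>w. (g w - g z - (\<Sum>j<d. b j * (w j - z j))) / of_real (\<Sum>j<d. cmod (w j - z j))) \<longlongrightarrow> 0) (at z within W)"
    proof (rule Lim_null_comparison)
      have N: "((\<lambda>w. \<Sum>j<d. cmod (w j - z j)) \<longlongrightarrow> (\<Sum>j<d. cmod (z j - z j))) (at z within W)"
        by (intro tendsto_intros hol_at_continuous[OF hol_at_coord, of _ d, unfolded continuous_within]) auto
      have "((\<lambda>w. 8 * (B / R) / R\<^sup>2 * (\<Sum>j<d. cmod (w j - z j))) \<longlongrightarrow> 8 * (B / R) / R\<^sup>2 * (\<Sum>j<d. cmod (z j - z j))) (at z within W)"
        by (intro tendsto_mult tendsto_const N)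
      then show "((\<lambda>w. 8 * (B / R) / R\<^sup>2 * (\<Sum>j<d. cmod (w j - z j))) \<longlongrightarrow> 0) (at z within W)" by simp
      have "\<forall>\<^sub>F w in at z within W. (\<Sum>j<d. cmod (w j - z j)) < R / 2"
        by (rule order_tendstoD(2)[OF N]) (use R in simp)
      moreover have "\<forall>\<^sub>F w in at z within W. w \<in> W" by (simp add: eventually_at_filter)
      ultimately show "\<forall>\<^sub>F w in at z within W. cmod ((g w - g z - (\<Sum>j<d. b j * (w j - z j))) /
          of_real (\<Sum>j<d. cmod (w j - z j))) \<le> 8 * (B / R) / R\<^sup>2 * (\<Sum>j<d. cmod (w j - z j))"
      proof eventually_elim
        case (elim w)
        define \<rho> where "\<rho> = (\<Sum>j<d. cmod (w j - z j))"
        have "0 \<le> \<rho>" by (simp add: \<rho>_def sum_nonneg)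
        moreover have "cmod (g w - g z - (\<Sum>j<d. b j * (w j - z j))) \<le> 8 * (B / R) / R\<^sup>2 * \<rho>\<^sup>2"
          unfolding \<rho>_def using main elim Wd by blast
        ultimately show ?case
          unfolding \<rho>_def[symmetric] norm_divide
          by (cases "\<rho> = 0") (simp_all add: pos_divide_le_eq power2_eq_square mult.assoc)
      qed
    qed
    from hol_at_of_limit[OF Wd z this] show ?thesis by blast
  qed
  moreover have "deriv (\<lambda>t. f (w(i := t))) (w i) = g w" if "w \<in> W" for w
    using DERIV_imp_deriv[OF hol_at_coord_deriv[OF W that i a[OF that]]] by (simp add: g_def)
  ultimately show ?thesis
    unfolding hol_on_iff[OF Wd]
    using hol_at_cong[of d W g _ _ "\<lambda>w. deriv (\<lambda>t. f (w(i := t))) (w i)"] by simp blast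
qed

section \<open>Holomorphic functions and tangent vectors on a manifold\<close>

lemma hol_at_subset:
  assumes "hol_at d W f z a" "W' \<subseteq> W"
  shows "hol_at d W' f z a"
proof -
  obtain A where A: "(\<forall>i<d. continuous (at z within W) (A i) \<and> A i z = a i) \<and>
      (\<forall>w\<in>W. f w = f z + (\<Sum>i<d. A i w * (w i - z i)))"
    using assms(1) unfolding hol_at_def by (elim exE)
  then have "(\<forall>i<d. continuous (at z within W') (A i) \<and> A i z = a i) \<and>
      (\<forall>w\<in>W'. f w = f z + (\<Sum>i<d. A i w * (w i - z i)))"
    using assms(2) continuous_within_subset[OF _ assms(2)] by blast
  then show ?thesis unfolding hol_at_def by (intro exI[of _ A])
qed

text \<open>The Caratheodory coefficients are controlled on \<open>W'\<close> only, so the passage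
  to \<open>W\<close> goes through the limit form: as \<open>W'\<close> is open, both limits run
  along the same filter.\<close>

lemma hol_at_local:
  assumes "hol_at d W' f z a" "openin (cspace d) W'" "W' \<subseteq> W" "W \<subseteq> csp d" "z \<in> W'"
  shows "hol_at d W f z a"
proof -
  obtain T where T: "open T" "W' = csp d \<inter> T"
    using assms(2) unfolding cspace_eq openin_open by blast
  have "at z within W = at z within W'"
    by (rule at_within_nhd[of z T]) (use T assms in auto)
  then show ?thesis
    using limit_of_hol_at[OF assms(1)] assms by (intro hol_at_of_limit) auto
qed

locale cmanifold =
  fixes M :: "'a cmfd"
  assumes M: "complex_manifold M"
begin

abbreviation rep :: "'a set \<Rightarrow> ('a \<Rightarrow> nat \<Rightarrow> complex) \<Rightarrow> ('a \<Rightarrow> complex) \<Rightarrow> (nat \<Rightarrow> complex) \<Rightarrow> complex" where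
  "rep D \<phi> f \<equiv> (\<lambda>z. f (inv_into D \<phi> z))"

abbreviation has_grad :: "'a set \<Rightarrow> ('a \<Rightarrow> nat \<Rightarrow> complex) \<Rightarrow> 'a set \<Rightarrow> ('a \<Rightarrow> complex) \<Rightarrow> 'a \<Rightarrow> (nat \<Rightarrow> complex) \<Rightarrow> bool" where
  "has_grad D \<phi> V f p \<equiv> hol_at (mdim M) (\<phi> ` (V \<inter> D)) (rep D \<phi> f) (\<phi> p)"

lemma chart:
  assumes "(D, \<phi>) \<in> matlas M"
  shows "openin (mtop M) D" "openin (cspace (mdim M)) (\<phi> ` D)"
    "homeomorphic_map (subtopology (mtop M) D) (subtopology (cspace (mdim M)) (\<phi> ` D)) \<phi>"
  using M assms unfolding complex_manifold_def by auto

lemma transition: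
  assumes "(D, \<phi>) \<in> matlas M" "(D', \<psi>) \<in> matlas M" "i < mdim M"
  shows "hol_on (mdim M) (\<phi> ` (D \<inter> D')) (\<lambda>z. \<psi> (inv_into D \<phi> z) i)"
  using M assms unfolding complex_manifold_def by blast

lemma chart_inj:
  assumes "(D, \<phi>) \<in> matlas M" shows "inj_on \<phi> D"
proof -
  have "topspace (subtopology (mtop M) D) = D"
    using openin_subset[OF chart(1)[OF assms]] by auto
  then show ?thesis using homeomorphic_imp_injective_map[OF chart(3)[OF assms]] by simp
qed

lemma chart_inv: "(D, \<phi>) \<in> matlas M \<Longrightarrow> p \<in> D \<Longrightarrow> inv_into D \<phi> (\<phi> p) = p"
  using chart_inj by (simp add: inv_into_f_f)

lemma chart_open_image:
  assumes c: "(D, \<phi>) \<in> matlas M" and V: "openin (mtop M) V"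
  shows "openin (cspace (mdim M)) (\<phi> ` (V \<inter> D))"
proof -
  have "openin (subtopology (mtop M) D) (V \<inter> D)"
    using V by (rule openin_subtopology_Int)
  then have "openin (subtopology (cspace (mdim M)) (\<phi> ` D)) (\<phi> ` (V \<inter> D))"
    using homeomorphic_imp_open_map[OF chart(3)[OF c]] unfolding open_map_def by blast
  then show ?thesis using chart(2)[OF c] openin_trans_full by blast
qed

lemma chart_csp: "(D, \<phi>) \<in> matlas M \<Longrightarrow> \<phi> ` D \<subseteq> csp (mdim M)"
  using chart(2) openin_cspace_subset by blast

lemma chart_csp': "(D, \<phi>) \<in> matlas M \<Longrightarrow> \<phi> ` (V \<inter> D) \<subseteq> csp (mdim M)"
  using chart_csp by blast

lemma holfun_iff:
  "holfun M V f \<longleftrightarrow> (\<forall>(D, \<phi>)\<in>matlas M. \<forall>p\<in>V \<inter> D. \<exists>a. has_grad D \<phi> V f p a)"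
proof -
  have "hol_on (mdim M) (\<phi> ` (V \<inter> D)) (rep D \<phi> f) \<longleftrightarrow>
      (\<forall>p\<in>V \<inter> D. \<exists>a. has_grad D \<phi> V f p a)"
    if "(D, \<phi>) \<in> matlas M" for D \<phi>
    unfolding hol_on_iff[OF chart_csp'[OF that]] by simp
  then show ?thesis unfolding holfun_def by (intro ball_cong refl) auto
qed

lemma holfunI:
  assumes "\<And>D \<phi> p. (D, \<phi>) \<in> matlas M \<Longrightarrow> p \<in> V \<Longrightarrow> p \<in> D \<Longrightarrow> \<exists>a. has_grad D \<phi> V f p a"
  shows "holfun M V f"
  unfolding holfun_iff using assms by auto

lemma holfunE:
  assumes "holfun M V f" "(D, \<phi>) \<in> matlas M" "p \<in> V" "p \<in> D"
  obtains a where "has_grad D \<phi> V f p a"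
proof -
  have "\<exists>a. has_grad D \<phi> V f p a"
    using assms unfolding holfun_iff by auto
  then show ?thesis using that by (elim exE)
qed

lemma holfun_const: "holfun M V (\<lambda>_. c)"
  by (rule holfunI, rule exI, rule hol_at_const)

lemma holfun_add:
  assumes "holfun M V f" "holfun M V g" shows "holfun M V (\<lambda>x. f x + g x)"
proof (rule holfunI)
  fix D \<phi> p assume c: "(D, \<phi>) \<in> matlas M" "p \<in> V" "p \<in> D"
  obtain a where a: "has_grad D \<phi> V f p a" using assms(1) c by (rule holfunE)
  obtain b where b: "has_grad D \<phi> V g p b" using assms(2) c by (rule holfunE)
  show "\<exists>a. has_grad D \<phi> V (\<lambda>x. f x + g x) p a"
    by (rule exI, rule hol_at_add[OF a b])
qed

lemma holfun_mult:
  assumes "holfun M V f" "holfun M V g" shows "holfun M V (\<lambda>x. f x * g x)"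
proof (rule holfunI)
  fix D \<phi> p assume c: "(D, \<phi>) \<in> matlas M" "p \<in> V" "p \<in> D"
  obtain a where a: "has_grad D \<phi> V f p a" using assms(1) c by (rule holfunE)
  obtain b where b: "has_grad D \<phi> V g p b" using assms(2) c by (rule holfunE)
  show "\<exists>a. has_grad D \<phi> V (\<lambda>x. f x * g x) p a"
    by (rule exI, rule hol_at_mult[OF a b])
qed

lemma holfun_uminus: "holfun M V f \<Longrightarrow> holfun M V (\<lambda>x. - f x)"
  using holfun_mult[OF holfun_const[of V "-1"], of f] by simp

lemma holfun_sum:
  assumes "\<And>k. k \<in> K \<Longrightarrow> holfun M V (f k)"
  shows "holfun M V (\<lambda>x. \<Sum>k\<in>K. f k x)"
  using assms by (induction K rule: infinite_finite_induct) (auto intro: holfun_const holfun_add)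

lemma holfun_cong:
  assumes "holfun M V f" "\<And>x. x \<in> V \<Longrightarrow> f x = g x"
  shows "holfun M V g"
proof (rule holfunI)
  fix D \<phi> p assume c: "(D, \<phi>) \<in> matlas M" "p \<in> V" "p \<in> D"
  obtain a where a: "has_grad D \<phi> V f p a" using assms(1) c by (rule holfunE)
  have "has_grad D \<phi> V g p a"
    by (rule hol_at_cong[OF a]) (use assms(2) c chart_inv[OF c(1)] in auto)
  then show "\<exists>a. has_grad D \<phi> V g p a" by (rule exI[of _ a])
qed

lemma holfun_subset:
  assumes "holfun M V f" "V' \<subseteq> V"
  shows "holfun M V' f"
proof (rule holfunI)
  fix D \<phi> p assume c: "(D, \<phi>) \<in> matlas M" "p \<in> V'" "p \<in> D"
  have "p \<in> V" using c assms by blast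
  obtain a where a: "has_grad D \<phi> V f p a" using assms(1) c(1) \<open>p \<in> V\<close> c(3) by (rule holfunE)
  have "has_grad D \<phi> V' f p a"
    by (rule hol_at_subset[OF a]) (use assms(2) in auto)
  then show "\<exists>a. has_grad D \<phi> V' f p a" by (rule exI[of _ a])
qed

lemma holfun_local:
  assumes "\<And>p. p \<in> V \<Longrightarrow> \<exists>V'. openin (mtop M) V' \<and> p \<in> V' \<and> V' \<subseteq> V \<and> holfun M V' f"
  shows "holfun M V f"
proof (rule holfunI)
  fix D \<phi> p assume c: "(D, \<phi>) \<in> matlas M" "p \<in> V" "p \<in> D"
  then obtain V' where V': "openin (mtop M) V'" "p \<in> V'" "V' \<subseteq> V" "holfun M V' f" using assms by blast
  obtain a where a: "has_grad D \<phi> V' f p a" using V'(4) c(1) V'(2) c(3) by (rule holfunE)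
  have "has_grad D \<phi> V f p a"
    by (rule hol_at_local[OF a chart_open_image[OF c(1) V'(1)] _ chart_csp'[OF c(1)]]) (use V' c in auto)
  then show "\<exists>a. has_grad D \<phi> V f p a" by (rule exI[of _ a])
qed

text \<open>The matrix \<open>J\<close> depends on the charts and the point only. Quantifying over
  \<open>V\<close>, \<open>f\<close> and \<open>a\<close> after it allows a single matrix to convert
  a tangent vector, which acts on all functions at once.\<close>

lemma chain_rule:
  assumes c: "(D, \<phi>) \<in> matlas M" and c': "(D', \<psi>) \<in> matlas M" and p: "p \<in> D" "p \<in> D'"
  shows "\<exists>J. \<forall>V f a. p \<in> V \<longrightarrow> has_grad D \<phi> V f p a \<longrightarrow>
    has_grad D' \<psi> (V \<inter> D) f p (\<lambda>i. \<Sum>k<mdim M. a k * J k i)"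
proof -
  define T where "T z = \<phi> (inv_into D' \<psi> z)" for z
  let ?W = "\<psi> ` (D \<inter> D')"
  have Wc: "?W \<subseteq> csp (mdim M)" using chart_csp[OF c'] by blast
  have tr: "hol_on (mdim M) ?W (\<lambda>z. T z k)" if "k < mdim M" for k
    using transition[OF c' c that] by (simp add: T_def Int_commute)
  have "\<forall>k\<in>{..<mdim M}. \<exists>b. hol_at (mdim M) ?W (\<lambda>z. T z k) (\<psi> p) b"
    using tr p unfolding hol_on_iff[OF Wc] by blast
  then obtain J where J: "\<forall>k\<in>{..<mdim M}. hol_at (mdim M) ?W (\<lambda>z. T z k) (\<psi> p) (J k)"
    unfolding bchoice_iff by (elim exE)
  have "continuous_on ?W (\<lambda>z. T z k)" for k
  proof (cases "k < mdim M")
    case True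
    then show ?thesis using tr[OF True] hol_at_continuous
      unfolding hol_on_iff[OF Wc] continuous_on_eq_continuous_within by blast
  next
    \<comment> \<open>From index \<open>mdim M\<close> on, the coordinates of a chart are constantly
      0.\<close>
    case False
    have "T z k = 0" if "z \<in> ?W" for z
      using that False chart_csp[OF c] chart_inv[OF c'] by (auto simp: T_def csp_def)
    then show ?thesis using continuous_on_cong[OF refl, of ?W "\<lambda>_. 0" "\<lambda>z. T z k"] by auto
  qed
  then have "continuous_on ?W T" by (rule continuous_on_coordinatewise_then_product)
  then have cont: "continuous (at (\<psi> p) within ?W) T"
    using p unfolding continuous_on_eq_continuous_within by blast
  show ?thesis
  proof (intro exI[of _ J] allI impI)
    fix V f a assume V: "p \<in> V" and a: "has_grad D \<phi> V f p a"
    let ?W' = "\<psi> ` (V \<inter> D \<inter> D')"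
    have sub: "?W' \<subseteq> ?W" by blast
    have Tp: "T (\<psi> p) = \<phi> p" using p by (simp add: T_def chart_inv[OF c'])
    have h: "hol_at (mdim M) ?W' (\<lambda>w. rep D \<phi> f (T w)) (\<psi> p) (\<lambda>i. \<Sum>k<mdim M. a k * J k i)"
    proof (rule hol_at_compose[where f = "rep D \<phi> f" and T = T and W' = "\<phi> ` (V \<inter> D)" and a = a and b = J])
      show "hol_at (mdim M) (\<phi> ` (V \<inter> D)) (rep D \<phi> f) (T (\<psi> p)) a" using a Tp by simp
      show "hol_at (mdim M) ?W' (\<lambda>w. T w k) (\<psi> p) (J k)" if "k < mdim M" for k
        using J that hol_at_subset[OF _ sub] by blast
      show "continuous (at (\<psi> p) within ?W') T" using cont sub by (rule continuous_within_subset)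
      show "T ` ?W' \<subseteq> \<phi> ` (V \<inter> D)" using chart_inv[OF c'] by (auto simp: T_def)
    qed
    show "hol_at (mdim M) ?W' (rep D' \<psi> f) (\<psi> p) (\<lambda>i. \<Sum>k<mdim M. a k * J k i)"
      by (rule hol_at_cong[OF h]) (use V p chart_inv[OF c'] chart_inv[OF c] in \<open>auto simp: T_def\<close>)
  qed
qed

text \<open>The chain rule carries a gradient from one chart at a point to any other, so one chart
  per point is enough for \<open>holfun\<close>.\<close>

lemma holfun_chartI:
  assumes V: "openin (mtop M) V"
    and ex: "\<And>p. p \<in> V \<Longrightarrow> \<exists>D \<phi> a. (D, \<phi>) \<in> matlas M \<and> p \<in> D \<and> has_grad D \<phi> V f p a"
  shows "holfun M V f"
proof (rule holfunI)
  fix D' \<psi> p assume c': "(D', \<psi>) \<in> matlas M" "p \<in> V" "p \<in> D'"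
  from ex[OF c'(2)] obtain D \<phi> a where c: "(D, \<phi>) \<in> matlas M" "p \<in> D"
    and a: "has_grad D \<phi> V f p a" by (elim exE conjE)
  obtain J where J: "\<forall>V f a. p \<in> V \<longrightarrow> has_grad D \<phi> V f p a \<longrightarrow>
    has_grad D' \<psi> (V \<inter> D) f p (\<lambda>i. \<Sum>k<mdim M. a k * J k i)"
    using chain_rule[OF c(1) c'(1) c(2) c'(3)] by (elim exE)
  define b where "b i = (\<Sum>k<mdim M. a k * J k i)" for i
  have b: "has_grad D' \<psi> (V \<inter> D) f p b"
    unfolding b_def[abs_def] using J a c'(2) by blast
  have "openin (mtop M) (V \<inter> D)" using V chart(1)[OF c(1)] by blast
  from chart_open_image[OF c'(1) this] have "has_grad D' \<psi> V f p b"
    by (rule hol_at_local[OF b _ _ chart_csp'[OF c'(1)]]) (use c c' in auto)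
  then show "\<exists>a. has_grad D' \<psi> V f p a" by (rule exI[of _ b])
qed

lemma coord_vec_eq:
  assumes c: "(D, \<phi>) \<in> matlas M" "p \<in> D" and V: "openin (mtop M) V" "p \<in> V" and f: "holfun M V f"
    and a: "has_grad D \<phi> V f p a" and i: "i < mdim M"
  shows "coord_vec M (D, \<phi>) i p f = a i"
proof -
  have "hol_near M p f" using V f by (auto simp: hol_near_def)
  moreover have "((\<lambda>t. rep D \<phi> f ((\<phi> p)(i := t))) has_field_derivative a i) (at (\<phi> p i))"
    by (rule hol_at_coord_deriv[OF chart_open_image[OF c(1) V(1)] _ i a]) (use c V in auto)
  ultimately show ?thesis by (simp add: coord_vec_def DERIV_imp_deriv)
qed

lemma coord_vec_tangent:
  assumes c: "(D, \<phi>) \<in> matlas M" "p \<in> D" and i: "i < mdim M"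
  shows "coord_vec M (D, \<phi>) i p \<in> tangent M p"
proof -
  have "coord_vec M (D, \<phi>) i p = (\<lambda>f. \<Sum>j<mdim M. (if j = i then 1 else 0) * coord_vec M (D, \<phi>) j p f)"
  proof
    fix f
    have "(\<Sum>j<mdim M. (if j = i then 1 else 0) * coord_vec M (D, \<phi>) j p f) =
        (\<Sum>j<mdim M. if j = i then coord_vec M (D, \<phi>) j p f else 0)"
      by (rule sum.cong) auto
    then show "coord_vec M (D, \<phi>) i p f = (\<Sum>j<mdim M. (if j = i then 1 else 0) * coord_vec M (D, \<phi>) j p f)"
      using i by simp
  qed
  then have "\<exists>c. coord_vec M (D, \<phi>) i p = (\<lambda>f. \<Sum>j<mdim M. c j * coord_vec M (D, \<phi>) j p f)"
    by (intro exI[of _ "\<lambda>j. if j = i then 1 else 0"])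
  then show ?thesis unfolding tangent_def using c by blast
qed

text \<open>The coefficients are converted by the Jacobian of \<open>chain_rule\<close>, which
  serves all functions holomorphic near \<open>p\<close>; on the other functions both sides are 0 by
  the default value in \<open>coord_vec\<close>.\<close>

lemma tangent_chart:
  assumes v: "v \<in> tangent M p" and c': "(D', \<psi>) \<in> matlas M" "p \<in> D'"
  obtains c where "v = (\<lambda>f. \<Sum>i<mdim M. c i * coord_vec M (D', \<psi>) i p f)"
proof -
  from v obtain D \<phi> b where c: "(D, \<phi>) \<in> matlas M" "p \<in> D"
    and b: "v = (\<lambda>f. \<Sum>i<mdim M. b i * coord_vec M (D, \<phi>) i p f)"
    unfolding tangent_def by blast
  obtain J where J: "\<forall>V f a. p \<in> V \<longrightarrow> has_grad D' \<psi> V f p a \<longrightarrow>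
    has_grad D \<phi> (V \<inter> D') f p (\<lambda>i. \<Sum>k<mdim M. a k * J k i)"
    using chain_rule[OF c'(1) c(1) c'(2) c(2)] by (elim exE)
  define e where "e k = (\<Sum>i<mdim M. b i * J k i)" for k
  have "v f = (\<Sum>k<mdim M. e k * coord_vec M (D', \<psi>) k p f)" for f
  proof (cases "hol_near M p f")
    case True
    then obtain V where V: "openin (mtop M) V" "p \<in> V" "holfun M V f" by (auto simp: hol_near_def)
    obtain a where a: "has_grad D' \<psi> V f p a"
      using V(3) c'(1) V(2) c'(2) by (rule holfunE)
    have V': "openin (mtop M) (V \<inter> D')" "p \<in> V \<inter> D'" "holfun M (V \<inter> D') f"
      using V chart(1)[OF c'(1)] c' holfun_subset[OF V(3)] by auto
    have "v f = (\<Sum>i<mdim M. b i * (\<Sum>k<mdim M. a k * J k i))"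
      unfolding b using coord_vec_eq[OF c V' J[rule_format, OF V(2) a]] by simp
    also have "\<dots> = (\<Sum>i<mdim M. \<Sum>k<mdim M. b i * J k i * a k)"
      by (simp add: sum_distrib_left mult_ac)
    also have "\<dots> = (\<Sum>k<mdim M. \<Sum>i<mdim M. b i * J k i * a k)" by (rule sum.swap)
    also have "\<dots> = (\<Sum>k<mdim M. e k * coord_vec M (D', \<psi>) k p f)"
      using coord_vec_eq[OF c' V a] by (simp add: e_def sum_distrib_right)
    finally show ?thesis .
  qed (simp add: b coord_vec_def)
  then show ?thesis using that[of e] by blast
qed

lemma tangent_combine:
  assumes v: "v \<in> tangent M p" and w: "w \<in> tangent M p"
  shows "(\<lambda>f. a * v f + w f) \<in> tangent M p"
proof -
  from w obtain D \<phi> b where c: "(D, \<phi>) \<in> matlas M" "p \<in> D"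
    and b: "w = (\<lambda>f. \<Sum>i<mdim M. b i * coord_vec M (D, \<phi>) i p f)"
    unfolding tangent_def by blast
  obtain e where e: "v = (\<lambda>f. \<Sum>i<mdim M. e i * coord_vec M (D, \<phi>) i p f)"
    using v c by (rule tangent_chart)
  have "(\<lambda>f. a * v f + w f) = (\<lambda>f. \<Sum>i<mdim M. (a * e i + b i) * coord_vec M (D, \<phi>) i p f)"
    unfolding e b by (simp add: sum_distrib_left distrib_right sum.distrib mult.assoc)
  then have "\<exists>e. (\<lambda>f. a * v f + w f) = (\<lambda>f. \<Sum>i<mdim M. e i * coord_vec M (D, \<phi>) i p f)"
    by (intro exI[of _ "\<lambda>i. a * e i + b i"])
  then show ?thesis unfolding tangent_def using c by blast
qed

text \<open>Presents a tangent vector as one linear functional of gradients in a fixed chart. The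
  rules for sums, products, constants and locality are then read off from those for
  \<open>hol_at\<close>.\<close>

lemma tangent_grad:
  assumes v: "v \<in> tangent M p"
  obtains D \<phi> c where "(D, \<phi>) \<in> matlas M" "p \<in> D"
    "\<And>V f a. openin (mtop M) V \<Longrightarrow> p \<in> V \<Longrightarrow> has_grad D \<phi> V f p a \<Longrightarrow>
      holfun M V f \<Longrightarrow> v f = (\<Sum>i<mdim M. c i * a i)"
proof -
  from v obtain D \<phi> b where c: "(D, \<phi>) \<in> matlas M" "p \<in> D"
    and b: "v = (\<lambda>f. \<Sum>i<mdim M. b i * coord_vec M (D, \<phi>) i p f)"
    unfolding tangent_def by blast
  show ?thesis
  proof (rule that[OF c, of b])
    fix V f a assume V: "openin (mtop M) V" "p \<in> V" and f: "holfun M V f"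
      and a: "has_grad D \<phi> V f p a"
    show "v f = (\<Sum>i<mdim M. b i * a i)"
      unfolding b using coord_vec_eq[OF c V f a] by simp
  qed
qed

context
  fixes v p V
  assumes v: "v \<in> tangent M p" and V: "openin (mtop M) V" "p \<in> V"
begin

lemma tangent_add:
  assumes f: "holfun M V f" and g: "holfun M V g"
  shows "v (\<lambda>x. f x + g x) = v f + v g"
proof (rule tangent_grad[OF v])
  fix D \<phi> c assume c: "(D, \<phi>) \<in> matlas M" "p \<in> D"
    and G: "\<And>V f a. openin (mtop M) V \<Longrightarrow> p \<in> V \<Longrightarrow> has_grad D \<phi> V f p a \<Longrightarrow>
      holfun M V f \<Longrightarrow> v f = (\<Sum>i<mdim M. c i * a i)"
  obtain a where a: "has_grad D \<phi> V f p a" using f c(1) V(2) c(2) by (rule holfunE)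
  obtain b where b: "has_grad D \<phi> V g p b" using g c(1) V(2) c(2) by (rule holfunE)
  show ?thesis
    unfolding G[OF V a f] G[OF V b g] G[OF V hol_at_add[OF a b] holfun_add[OF f g]]
    by (simp add: distrib_left sum.distrib)
qed

lemma tangent_mult:
  assumes f: "holfun M V f" and g: "holfun M V g"
  shows "v (\<lambda>x. f x * g x) = v f * g p + f p * v g"
proof (rule tangent_grad[OF v])
  fix D \<phi> c assume c: "(D, \<phi>) \<in> matlas M" "p \<in> D"
    and G: "\<And>V f a. openin (mtop M) V \<Longrightarrow> p \<in> V \<Longrightarrow> has_grad D \<phi> V f p a \<Longrightarrow>
      holfun M V f \<Longrightarrow> v f = (\<Sum>i<mdim M. c i * a i)"
  obtain a where a: "has_grad D \<phi> V f p a" using f c(1) V(2) c(2) by (rule holfunE)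
  obtain b where b: "has_grad D \<phi> V g p b" using g c(1) V(2) c(2) by (rule holfunE)
  show ?thesis
    unfolding G[OF V a f] G[OF V b g] G[OF V hol_at_mult[OF a b] holfun_mult[OF f g]] chart_inv[OF c]
    by (simp add: distrib_left sum.distrib sum_distrib_left sum_distrib_right mult_ac)
qed

lemma tangent_const: "v (\<lambda>_. c) = 0"
proof (rule tangent_grad[OF v])
  fix D \<phi> e assume c: "(D, \<phi>) \<in> matlas M" "p \<in> D"
    and G: "\<And>V f a. openin (mtop M) V \<Longrightarrow> p \<in> V \<Longrightarrow> has_grad D \<phi> V f p a \<Longrightarrow>
      holfun M V f \<Longrightarrow> v f = (\<Sum>i<mdim M. e i * a i)"
  show ?thesis unfolding G[OF V hol_at_const holfun_const] by simp
qed

lemma tangent_cong: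
  assumes f: "holfun M V f" and eq: "\<And>x. x \<in> V \<Longrightarrow> f x = g x"
  shows "v f = v g"
proof (rule tangent_grad[OF v])
  fix D \<phi> c assume c: "(D, \<phi>) \<in> matlas M" "p \<in> D"
    and G: "\<And>V f a. openin (mtop M) V \<Longrightarrow> p \<in> V \<Longrightarrow> has_grad D \<phi> V f p a \<Longrightarrow>
      holfun M V f \<Longrightarrow> v f = (\<Sum>i<mdim M. c i * a i)"
  obtain a where a: "has_grad D \<phi> V f p a" using f c(1) V(2) c(2) by (rule holfunE)
  have "has_grad D \<phi> V g p a"
    by (rule hol_at_cong[OF a]) (use eq c V chart_inv[OF c(1)] in auto)
  from G[OF V this holfun_cong[OF f eq]] G[OF V a f] show ?thesis by simp
qed

lemma tangent_sum:
  assumes "\<And>k. k \<in> K \<Longrightarrow> holfun M V (f k)"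
  shows "v (\<lambda>x. \<Sum>k\<in>K. f k x) = (\<Sum>k\<in>K. v (f k))"
  using assms
proof (induction K rule: infinite_finite_induct)
  case (insert k K)
  then show ?case using tangent_add[OF insert.prems[of k] holfun_sum[of K V f]] by simp
qed (simp_all add: tangent_const)

end

text \<open>In the chart itself this is the theorem on partial derivatives. It is the source of the
  holomorphy of both the derivatives of \<open>h\<close> and the connection on a product
  bundle.\<close>

lemma holfun_coord_vec:
  assumes V: "openin (mtop M) V" and f: "holfun M V f" and c: "(D, \<phi>) \<in> matlas M" and i: "i < mdim M"
  shows "holfun M (V \<inter> D) (\<lambda>p. coord_vec M (D, \<phi>) i p f)"
proof (rule holfun_chartI)
  show "openin (mtop M) (V \<inter> D)" using V chart(1)[OF c] by blast
  let ?W = "\<phi> ` (V \<inter> D)"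
  have W: "openin (cspace (mdim M)) ?W" by (rule chart_open_image[OF c V])
  have "hol_on (mdim M) ?W (rep D \<phi> f)" using f c unfolding holfun_def by blast
  from hol_on_coord_deriv[OF W this i]
  have h: "\<forall>z\<in>?W. \<exists>a. hol_at (mdim M) ?W (\<lambda>w. deriv (\<lambda>t. rep D \<phi> f (w(i := t))) (w i)) z a"
    unfolding hol_on_iff[OF chart_csp'[OF c]] .
  fix p assume p: "p \<in> V \<inter> D"
  then obtain a where a: "hol_at (mdim M) ?W (\<lambda>w. deriv (\<lambda>t. rep D \<phi> f (w(i := t))) (w i)) (\<phi> p) a"
    using h by blast
  have "hol_at (mdim M) ?W (rep D \<phi> (\<lambda>p. coord_vec M (D, \<phi>) i p f)) (\<phi> p) a"
  proof (rule hol_at_cong[OF a])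
    fix w assume "w \<in> ?W"
    then obtain q where q: "q \<in> V" "q \<in> D" "w = \<phi> q" by blast
    have "hol_near M q f" using V q f by (auto simp: hol_near_def)
    then show "deriv (\<lambda>t. rep D \<phi> f (w(i := t))) (w i) = coord_vec M (D, \<phi>) i (inv_into D \<phi> w) f"
      using q by (simp add: coord_vec_def chart_inv[OF c])
  qed (use p in auto)
  then show "\<exists>D' \<psi> a. (D', \<psi>) \<in> matlas M \<and> p \<in> D' \<and>
      has_grad D' \<psi> (V \<inter> D) (\<lambda>p. coord_vec M (D, \<phi>) i p f) p a"
    using c p by (intro exI[of _ D] exI[of _ \<phi>] exI[of _ a]) (simp add: Int_assoc)
qed

end

section \<open>Lattice paths and shuffles\<close>

lemma alt_0 [simp]: "alt j 0 = 0"
  by (simp add: alt_def)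

lemma alt_zero_left [simp]: "alt 0 c = c"
  by (simp add: alt_def)

lemma alt_Suc [simp]: "alt (Suc j) c = - alt j c"
  by (simp add: alt_def)

lemma alt_add: "alt j (a + b) = alt j a + alt j b"
  by (simp add: alt_def)

lemma alt_diff: "alt j (a - b) = alt j a - alt j b"
  by (simp add: alt_def)

lemma alt_alt: "alt i (alt j c) = alt (i + j) c"
  by (simp add: alt_def)

lemma alt_sum: "alt j (sum f A) = (\<Sum>x\<in>A. alt j (f x))"
  by (simp add: alt_def sum_negf)

lemma alt_apply: "alt j f x = alt j (f x)"
  by (simp add: alt_def)

lemma del_0 [simp]: "del 0 (x # xs) = xs"
  by (simp add: del_def)

lemma del_Suc [simp]: "del (Suc j) (x # xs) = x # del j xs"
  by (simp add: del_def)

lemma length_del: "j < length xs \<Longrightarrow> length (del j xs) = length xs - 1"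
  by (simp add: del_def)

lemma map_del: "map f (del j xs) = del j (map f xs)"
  by (simp add: del_def take_map drop_map)

lemma set_del_subset: "set (del j xs) \<subseteq> set xs"
  by (auto simp: del_def dest: in_set_takeD in_set_dropD)

text \<open>The Cech coboundary before restriction to the smaller intersection.\<close>

definition face_sum :: "('b list \<Rightarrow> 'c::ab_group_add) \<Rightarrow> 'b list \<Rightarrow> 'c" where
  "face_sum f w = (\<Sum>t<length w. alt t (f (del t w)))"

lemma face_sum_Nil [simp]: "face_sum f [] = 0"
  by (simp add: face_sum_def)

lemma face_sum_Cons: "face_sum f (x # w) = f w - face_sum (\<lambda>w. f (x # w)) w"
  unfolding face_sum_def list.size(4) Suc_eq_plus1[symmetric] add_0_right add_Suc_right sum.lessThan_Suc_shift
  by (simp add: sum_negf)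

lemma face_sum_zero [simp]: "face_sum (\<lambda>_. 0) w = 0"
  by (simp add: face_sum_def)

lemma face_sum_add: "face_sum (\<lambda>w. f w + g w) w = face_sum f w + face_sum g w"
  by (simp add: face_sum_def alt_add sum.distrib)

lemma face_sum_alt: "face_sum (\<lambda>w. alt j (f w)) w = alt j (face_sum f w)"
  by (simp add: face_sum_def alt_sum alt_alt add.commute)

lemma face_sum_cong:
  assumes "\<And>t. t < length w \<Longrightarrow> f (del t w) = g (del t w)"
  shows "face_sum f w = face_sum g w"
  using assms by (simp add: face_sum_def)

text \<open>Sums over the lattice paths from \<open>(hd js, hd Ls)\<close> to \<open>(last js, last Ls)\<close>, a step in the first
  coordinate having as sign the parity of the number of steps in the second coordinate that follow.\<close>

fun path_sum :: "(('i \<times> 'n) list \<Rightarrow> 'c::ab_group_add) \<Rightarrow> 'i list \<Rightarrow> 'n list \<Rightarrow> 'c" where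
  "path_sum f [] Ls = 0"
| "path_sum f (x # xs) [] = 0"
| "path_sum f (x # xs) (a # as) = (if xs = [] \<and> as = [] then f [(x, a)]
     else alt (length as) (path_sum (\<lambda>w. f ((x, a) # w)) xs (a # as)) +
       path_sum (\<lambda>w. f ((x, a) # w)) (x # xs) as)"

lemma path_sum_Nil2 [simp]: "path_sum f js [] = 0"
  by (cases js) auto

text \<open>Inducts on the two lists alone; the integrand changes at every recursive call of
  \<open>path_sum\<close> and is left to \<open>arbitrary\<close>.\<close>

lemma path_induct [case_names Nil1 Nil2 Cons]:
  assumes "\<And>Ls. P [] Ls" "\<And>x xs. P (x # xs) []"
    "\<And>x xs a as. P xs (a # as) \<Longrightarrow> P (x # xs) as \<Longrightarrow> P (x # xs) (a # as)"
  shows "P js Ls"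
proof (induction js arbitrary: Ls)
  case (Cons x xs)
  then show ?case using assms by (induction Ls) auto
qed (rule assms)

lemma path_sum_diff:
  "path_sum (\<lambda>w. f w - g w) js Ls = path_sum f js Ls - path_sum g js Ls"
proof (induction js Ls arbitrary: f g rule: path_induct)
  case (Cons x xs a as)
  show ?case by (simp add: Cons alt_diff)
qed auto

lemma path_sum_zero [simp]: "path_sum (\<lambda>_. 0) js Ls = 0"
  by (induction js Ls rule: path_induct) auto

text \<open>The premises on \<open>w\<close> collect what later arguments know about a path: it
  visits every column and every row, it has one vertex less than there are columns and rows
  together, and it starts at the corner.\<close>

lemma path_sum_cong:
  assumes "\<And>w. w \<noteq> [] \<Longrightarrow> fst ` set w = set js \<Longrightarrow> snd ` set w = set Ls \<Longrightarrow>
      length w + 1 = length js + length Ls \<Longrightarrow> hd w = (hd js, hd Ls) \<Longrightarrow> f w = g w"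
  shows "path_sum f js Ls = path_sum g js Ls"
  using assms
proof (induction js Ls arbitrary: f g rule: path_induct)
  case (Cons x xs a as)
  show ?case
  proof (cases "xs = [] \<and> as = []")
    case True
    then show ?thesis using Cons.prems[of "[(x, a)]"] by simp
  next
    case False
    have "path_sum (\<lambda>w. f ((x, a) # w)) xs (a # as) = path_sum (\<lambda>w. g ((x, a) # w)) xs (a # as)"
      by (rule Cons.IH(1), rule Cons.prems) auto
    moreover have "path_sum (\<lambda>w. f ((x, a) # w)) (x # xs) as = path_sum (\<lambda>w. g ((x, a) # w)) (x # xs) as"
      by (rule Cons.IH(2), rule Cons.prems) auto
    ultimately show ?thesis using False by auto
  qed
qed auto

lemma path_sum_map:
  "path_sum (\<lambda>w. f (map (\<lambda>(i, j). (i, g j)) w)) js Ls = path_sum f js (map g Ls)"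
proof (induction js Ls arbitrary: f rule: path_induct)
  case (Cons x xs a as)
  show ?case
    using Cons.IH(1)[of "\<lambda>w. f ((x, g a) # w)"] Cons.IH(2)[of "\<lambda>w. f ((x, g a) # w)"] by simp
qed auto

text \<open>Between two equal neighbouring rows every path makes a step that repeats its vertex, so
  each single term vanishes.\<close>

lemma path_sum_not_distinct_adj:
  assumes "\<And>w. \<not> distinct_adj w \<Longrightarrow> f w = 0" "\<not> distinct_adj Ls"
  shows "path_sum f js Ls = 0"
  using assms
proof (induction js Ls arbitrary: f rule: path_induct)
  case (Cons x xs a as)
  have ne: "as \<noteq> []" using Cons.prems(2) by auto
  have g: "f ((x, a) # w) = 0" if "\<not> distinct_adj w" for w
    using that Cons.prems(1)[of "(x, a) # w"] by (cases w) (auto simp: distinct_adj_Cons)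
  have 1: "path_sum (\<lambda>w. f ((x, a) # w)) xs (a # as) = 0"
    using Cons.IH(1)[of "\<lambda>w. f ((x, a) # w)"] g Cons.prems(2) by blast
  have 2: "path_sum (\<lambda>w. f ((x, a) # w)) (x # xs) as = 0"
  proof (cases "distinct_adj as")
    case True
    then have "hd as = a" using Cons.prems(2) ne by (auto simp: distinct_adj_Cons)
    have "path_sum (\<lambda>w. f ((x, a) # w)) (x # xs) as = path_sum (\<lambda>_. 0) (x # xs) as"
    proof (rule path_sum_cong)
      fix w :: "('a \<times> 'b) list" assume "w \<noteq> []" "hd w = (hd (x # xs), hd as)"
      then show "f ((x, a) # w) = 0"
        using \<open>hd as = a\<close> by (intro Cons.prems(1)) (simp add: distinct_adj_Cons)
    qed
    then show ?thesis by simp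
  next
    case False
    then show ?thesis using Cons.IH(2)[of "\<lambda>w. f ((x, a) # w)"] g by blast
  qed
  show ?case using ne 1 2 by simp
qed auto

text \<open>Dual form of the statement that the Eilenberg-Zilber map is a chain map. The bound on
  the lengths excludes the one-point path, whose only face is the empty list.\<close>

theorem path_sum_face_sum:
  assumes "js \<noteq> []" "Ls \<noteq> []" "2 < length js + length Ls"
  shows "path_sum (face_sum f) js Ls =
    alt (length Ls - 1) (face_sum (\<lambda>ys. path_sum f ys Ls) js) + face_sum (path_sum f js) Ls"
  using assms
proof (induction js Ls arbitrary: f rule: path_induct)
  case (Cons x xs a as)
  define g where "g w = f ((x, a) # w)" for w
  have g_eta: "(\<lambda>w. f ((x, a) # w)) = g"
    by (simp add: g_def fun_eq_iff)
  have fs: "face_sum f ((x, a) # w) = f w - face_sum g w" for w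
    by (simp add: face_sum_Cons g_eta)
  let ?l = "length as"
  have L: "path_sum (face_sum f) (x # xs) (a # as) =
      alt ?l (path_sum f xs (a # as)) - alt ?l (path_sum (face_sum g) xs (a # as)) +
      (path_sum f (x # xs) as - path_sum (face_sum g) (x # xs) as)"
    using Cons.prems by (auto simp: fs path_sum_diff alt_diff)
  have R1: "face_sum (\<lambda>ys. path_sum f ys (a # as)) (x # xs) =
      path_sum f xs (a # as) - face_sum (\<lambda>ys. path_sum f (x # ys) (a # as)) xs"
    by (rule face_sum_Cons)
  have R2: "face_sum (path_sum f (x # xs)) (a # as) =
      path_sum f (x # xs) as - face_sum (\<lambda>bs. path_sum f (x # xs) (a # bs)) as"
    by (rule face_sum_Cons)
  have H: "face_sum (\<lambda>ys. path_sum f (x # ys) (a # as)) xs =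
      alt ?l (face_sum (\<lambda>ys. path_sum g ys (a # as)) xs) + face_sum (\<lambda>ys. path_sum g (x # ys) as) xs"
    if "as \<noteq> [] \<or> 1 < length xs"
  proof -
    have "face_sum (\<lambda>ys. path_sum f (x # ys) (a # as)) xs =
        face_sum (\<lambda>ys. alt ?l (path_sum g ys (a # as)) + path_sum g (x # ys) as) xs"
    proof (rule face_sum_cong)
      fix t assume "t < length xs"
      then have "del t xs = [] \<longrightarrow> length xs = 1" using length_del[of t xs] by auto
      then show "path_sum f (x # del t xs) (a # as) =
          alt ?l (path_sum g (del t xs) (a # as)) + path_sum g (x # del t xs) as"
        using that by (auto simp: g_eta)
    qed
    then show ?thesis by (simp add: face_sum_add face_sum_alt)
  qed
  have V: "face_sum (\<lambda>bs. path_sum f (x # xs) (a # bs)) as =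
      alt (?l - 1) (face_sum (\<lambda>bs. path_sum g xs (a # bs)) as) + face_sum (path_sum g (x # xs)) as"
    if "xs \<noteq> [] \<or> 1 < length as"
  proof -
    have "face_sum (\<lambda>bs. path_sum f (x # xs) (a # bs)) as =
        face_sum (\<lambda>bs. alt (?l - 1) (path_sum g xs (a # bs)) + path_sum g (x # xs) bs) as"
    proof (rule face_sum_cong)
      fix t assume t: "t < length as"
      then have "del t as = [] \<longrightarrow> length as = 1" using length_del[of t as] by auto
      then show "path_sum f (x # xs) (a # del t as) =
          alt (?l - 1) (path_sum g xs (a # del t as)) + path_sum g (x # xs) (del t as)"
        using that length_del[OF t] by (auto simp: g_eta)
    qed
    then show ?thesis by (simp add: face_sum_add face_sum_alt)
  qed
  \<comment> \<open>Grids with a single column or row are treated apart: \<open>H\<close> and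
    \<open>V\<close> break down if a deletion leaves a single point, where the recursion of
    \<open>path_sum\<close> takes another form.\<close>
  consider "xs = []" "length as = 1" | "xs = []" "1 < length as" | "as = []" "length xs = 1"
    | "as = []" "1 < length xs" | "xs \<noteq> []" "as \<noteq> []"
    using Cons.prems(3) by (cases xs; cases as; force)
  then show ?case
  proof cases
    case 1
    then obtain b where "as = [b]" by (cases as) auto
    then show ?thesis using 1 by (simp add: face_sum_Cons)
  next
    case 2
    then have "as \<noteq> []" by auto
    show ?thesis unfolding L R1 R2 using 2 \<open>as \<noteq> []\<close> Cons.IH(2)[of g] V
      by (simp add: face_sum_Cons)
  next
    case 3
    then obtain y where "xs = [y]" by (cases xs) auto
    then show ?thesis using 3 by (simp add: face_sum_Cons)
  next
    case 4
    then have "xs \<noteq> []" by auto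
    show ?thesis unfolding L R1 R2 using 4 \<open>xs \<noteq> []\<close> Cons.IH(1)[of g] H
      by (simp add: face_sum_Cons)
  next
    case 5
    have gt: "2 < length xs + length (a # as)" "2 < length (x # xs) + length as"
      using 5 by (cases xs; cases as; simp)+
    \<comment> \<open>The two ways around the first unit square leave the same diagonal term
      \<open>path_sum g xs as\<close>, once in \<open>I1\<close> and once in \<open>I2\<close>; the
      exponents of their signs differ by one, so the terms cancel.\<close>
    have I1: "path_sum (face_sum g) xs (a # as) =
        alt ?l (face_sum (\<lambda>ys. path_sum g ys (a # as)) xs) +
        (path_sum g xs as - face_sum (\<lambda>bs. path_sum g xs (a # bs)) as)"
      using Cons.IH(1)[OF 5(1) _ gt(1), of g] by (simp add: face_sum_Cons)
    have I2: "path_sum (face_sum g) (x # xs) as =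
        alt (?l - 1) (path_sum g xs as - face_sum (\<lambda>ys. path_sum g (x # ys) as) xs) +
        face_sum (path_sum g (x # xs)) as"
      using Cons.IH(2)[OF _ 5(2) gt(2), of g] by (simp add: face_sum_Cons)
    obtain m where m: "?l = Suc m" using 5 by (cases as) auto
    have H': "as \<noteq> [] \<or> 1 < length xs" and V': "xs \<noteq> [] \<or> 1 < length as" using 5 by auto
    show ?thesis unfolding L R1 R2 I1 I2 H[OF H'] V[OF V'] list.size m
      by (cases "even m") (simp_all add: alt_def algebra_simps)
  qed
qed auto

text \<open>\<open>simplex_path\<close> with arbitrary row labels in place of 0, ..., k, so that an
  induction can drop the first row.\<close>

definition path_of :: "'i list \<Rightarrow> 'n list \<Rightarrow> nat list \<Rightarrow> ('i \<times> 'n) list" where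
  "path_of js Ls s = (let S = 0 # s @ [length js - 1] in
     concat (map (\<lambda>t. map (\<lambda>v. (js ! v, Ls ! t)) [S ! t..<Suc (S ! Suc t)]) [0..<Suc (length s)]))"

lemma simplex_path_eq: "simplex_path js s = path_of js [0..<Suc (length s)] s"
  unfolding simplex_path_def path_of_def Let_def
  by (intro arg_cong[of _ _ concat] map_cong refl) (auto simp del: upt_Suc)

lemma upt_Suc_map: "[0..<Suc n] = 0 # map Suc [0..<n]"
  by (simp add: map_Suc_upt upt_conv_Cons del: upt_Suc)

lemma path_of_Cons_0:
  "path_of (x # xs) (a # as) (0 # s) = (x, a) # path_of (x # xs) as s"
  unfolding path_of_def Let_def
  by (subst upt_Suc_map) (simp add: comp_def del: upt_Suc, simp)

text \<open>As all cuts are positive, the path begins with a step in the first coordinate; lowering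
  the cuts by one describes the rest of it in the grid without the first column.\<close>

lemma path_of_map_Suc:
  assumes "xs \<noteq> []"
  shows "path_of (x # xs) (a # as) (map Suc s) = (x, a) # path_of xs (a # as) s"
proof -
  define S where "S = s @ [length xs - 1]"
  have S': "map Suc s @ [length (x # xs) - 1] = map Suc S"
    using assms by (simp add: S_def)
  have len: "length S = Suc (length s)" by (simp add: S_def)
  obtain s0 S1 where S01: "S = s0 # S1" by (cases S) (auto simp: S_def)
  have A: "map (\<lambda>v. ((x # xs) ! v, c)) [Suc m..<Suc (Suc n)] = map (\<lambda>v. (xs ! v, c)) [m..<Suc n]" for m n and c :: 'b
    unfolding map_Suc_upt[symmetric] map_map by (rule map_cong) auto
  have B: "map (\<lambda>v. ((x # xs) ! v, a)) [0..<Suc (Suc s0)] = (x, a) # map (\<lambda>v. (xs ! v, a)) [0..<Suc s0]"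
    unfolding upt_Suc_map[of "Suc s0"] by (simp add: comp_def del: upt_Suc)
  \<comment> \<open>\<open>h t\<close> and \<open>h' t\<close> are the vertices in row
    \<open>t\<close> in the large and in the small grid. They agree from row 1 on; row 0 gains the
    start vertex, because its left end 0 is not shifted.\<close>
  define h where "h t = map (\<lambda>v. ((x # xs) ! v, (a # as) ! t)) [(0 # map Suc S) ! t..<Suc ((0 # map Suc S) ! Suc t)]" for t
  define h' where "h' t = map (\<lambda>v. (xs ! v, (a # as) ! t)) [(0 # S) ! t..<Suc ((0 # S) ! Suc t)]" for t
  have h0: "h 0 = (x, a) # h' 0"
    using B by (simp add: h_def h'_def S01 del: upt_Suc)
  have hS: "h (Suc t) = h' (Suc t)" if "t < length s" for t
    using that len A[of "(a # as) ! Suc t" "S ! t" "S ! Suc t"] by (simp add: h_def h'_def del: upt_Suc)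
  have c: "concat (map h [0..<Suc (length s)]) = h 0 @ concat (map (\<lambda>t. h (Suc t)) [0..<length s])" for h :: "nat \<Rightarrow> ('a \<times> 'b) list"
    unfolding upt_Suc_map by (simp add: comp_def)
  have mm: "map (\<lambda>t. h (Suc t)) [0..<length s] = map (\<lambda>t. h' (Suc t)) [0..<length s]"
    by (rule map_cong) (simp_all add: hS)
  have "concat (map h [0..<Suc (length s)]) = (x, a) # concat (map h' [0..<Suc (length s)])"
    unfolding c[of h] c[of h'] h0 mm by simp
  then show ?thesis
    unfolding path_of_def Let_def S' S_def[symmetric] length_map h_def h'_def .
qed

definition cuts :: "nat \<Rightarrow> nat \<Rightarrow> nat list set" where
  "cuts k n = {s. length s = k \<and> sorted s \<and> set s \<subseteq> {..<n}}"

lemma finite_cuts: "finite (cuts k n)"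
  by (rule finite_subset[OF _ finite_lists_length_eq[of "{..<n}" k]]) (auto simp: cuts_def)

lemma cuts_0 [simp]: "cuts 0 n = {[]}"
  by (auto simp: cuts_def)

lemma cuts_Suc_0 [simp]: "cuts (Suc k) 0 = {}"
  by (auto simp: cuts_def)

text \<open>A weakly increasing list either starts with 0 or has only positive entries. This is the
  dichotomy of first steps in \<open>path_sum\<close>.\<close>

lemma cuts_Suc: "cuts (Suc k) (Suc n) = Cons 0 ` cuts k (Suc n) \<union> map Suc ` cuts (Suc k) n"
proof (intro equalityI subsetI)
  fix s assume s: "s \<in> cuts (Suc k) (Suc n)"
  then obtain a s' where as: "s = a # s'" by (cases s) (auto simp: cuts_def)
  show "s \<in> Cons 0 ` cuts k (Suc n) \<union> map Suc ` cuts (Suc k) n"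
  proof (cases "a = 0")
    case True
    then show ?thesis using s as by (auto simp: cuts_def)
  next
    case False
    then have pos: "\<forall>t\<in>set s. 0 < t" using s as by (auto simp: cuts_def)
    have "s = map Suc (map (\<lambda>t. t - 1) s)"
      using pos by (simp add: map_idI)
    moreover have "sorted (map (\<lambda>t. t - 1) s)"
      using s by (auto simp: cuts_def sorted_iff_nth_mono intro: diff_le_mono)
    then have "map (\<lambda>t. t - 1) s \<in> cuts (Suc k) n"
      using s pos by (force simp: cuts_def)
    ultimately show ?thesis by blast
  qed
qed (auto simp: cuts_def sorted_map intro: sorted_wrt_mono_rel)

lemma path_sum_row: "js \<noteq> [] \<Longrightarrow> path_sum f js [a] = f (map (\<lambda>y. (y, a)) js)"
  by (induction js arbitrary: f) auto

text \<open>Raising all cuts by one raises their sum by their number. This number is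
  \<open>length as\<close>, the exponent that \<open>path_sum\<close> gives to a first step in the
  first coordinate.\<close>

lemma path_sum_eq_cuts:
  assumes "js \<noteq> []" "length Ls = Suc k"
  shows "path_sum f js Ls = (\<Sum>s\<in>cuts k (length js). alt (sum_list s) (f (path_of js Ls s)))"
  using assms
proof (induction js Ls arbitrary: f k rule: path_induct)
  case (Cons x xs a as)
  show ?case
  proof (cases k)
    case 0
    have "map (\<lambda>v. ((x # xs) ! v, a)) [0..<length (x # xs)] = map (\<lambda>y. (y, a)) (map ((!) (x # xs)) [0..<length (x # xs)])"
      by (simp del: upt_Suc)
    then have "map (\<lambda>v. ((x # xs) ! v, a)) [0..<length (x # xs)] = map (\<lambda>y. (y, a)) (x # xs)"
      by (simp only: map_nth)
    moreover have "path_of (x # xs) (a # as) [] = map (\<lambda>v. ((x # xs) ! v, a)) [0..<length (x # xs)]"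
      unfolding path_of_def Let_def by (simp add: upt_Suc_map[of 0] del: upt_Suc)
    ultimately have "path_of (x # xs) (a # as) [] = map (\<lambda>y. (y, a)) (x # xs)" by simp
    then show ?thesis using 0 Cons.prems path_sum_row[of "x # xs" f a]
      by (simp del: path_sum.simps)
  next
    case (Suc k')
    define g where "g w = f ((x, a) # w)" for w
    have g_eta: "(\<lambda>w. f ((x, a) # w)) = g"
      by (simp add: g_def fun_eq_iff)
    have as: "as \<noteq> []" "length as = Suc k'" using Cons.prems Suc by auto
    have "(\<Sum>s\<in>cuts (Suc k') (length (x # xs)). alt (sum_list s) (f (path_of (x # xs) (a # as) s))) =
        (\<Sum>s\<in>Cons 0 ` cuts k' (length (x # xs)). alt (sum_list s) (f (path_of (x # xs) (a # as) s))) +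
        (\<Sum>s\<in>map Suc ` cuts (Suc k') (length xs). alt (sum_list s) (f (path_of (x # xs) (a # as) s)))"
      unfolding list.size Suc_eq_plus1[symmetric] add_0_right add_Suc_right cuts_Suc
      by (rule sum.union_disjoint) (auto simp: finite_cuts Cons_eq_map_conv)
    also have "(\<Sum>s\<in>Cons 0 ` cuts k' (length (x # xs)). alt (sum_list s) (f (path_of (x # xs) (a # as) s))) =
        path_sum g (x # xs) as"
      using Cons.IH(2)[OF _ as(2), of g]
      by (subst sum.reindex) (simp_all add: inj_on_def path_of_Cons_0 g_def[symmetric] o_def)
    also have "(\<Sum>s\<in>map Suc ` cuts (Suc k') (length xs). alt (sum_list s) (f (path_of (x # xs) (a # as) s))) =
        alt (length as) (path_sum g xs (a # as))"
    proof (cases "xs = []")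
      case True
      then show ?thesis by simp
    next
      case False
      have "(\<Sum>s\<in>map Suc ` cuts (Suc k') (length xs). alt (sum_list s) (f (path_of (x # xs) (a # as) s))) =
          (\<Sum>s\<in>cuts (Suc k') (length xs). alt (length as) (alt (sum_list s) (g (path_of xs (a # as) s))))"
      proof (subst sum.reindex)
        show "inj_on (map Suc) (cuts (Suc k') (length xs))" by (simp add: inj_on_def)
        show "sum ((\<lambda>s. alt (sum_list s) (f (path_of (x # xs) (a # as) s))) \<circ> map Suc) (cuts (Suc k') (length xs)) =
            (\<Sum>s\<in>cuts (Suc k') (length xs). alt (length as) (alt (sum_list s) (g (path_of xs (a # as) s))))"
        proof (rule sum.cong[OF refl])
          fix s assume "s \<in> cuts (Suc k') (length xs)"
          then have "sum_list (map Suc s) = length as + sum_list s"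
            using as by (simp add: cuts_def sum_list_Suc)
          then show "((\<lambda>s. alt (sum_list s) (f (path_of (x # xs) (a # as) s))) \<circ> map Suc) s =
              alt (length as) (alt (sum_list s) (g (path_of xs (a # as) s)))"
            by (simp add: path_of_map_Suc[OF False] g_def alt_alt)
        qed
      qed
      also have "\<dots> = alt (length as) (path_sum g xs (a # as))"
        using Cons.IH(1)[OF False, of "Suc k'" g] as by (simp add: alt_sum)
      finally show ?thesis .
    qed
    finally show ?thesis using as Suc by (simp add: g_def[symmetric] add.commute)
  qed
qed auto

lemma simplex_int_eq_path_sum:
  assumes "js \<in> cidx_all I"
  shows "simplex_int I k \<mu> js = path_sum \<mu> js [0..<Suc k]"
proof -
  have "js \<noteq> []" using assms by (auto simp: cidx_all_def cidx_def)
  then have "path_sum \<mu> js [0..<Suc k] = (\<Sum>s\<in>cuts k (length js). alt (sum_list s) (\<mu> (path_of js [0..<Suc k] s)))"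
    by (rule path_sum_eq_cuts) simp
  also have "\<dots> = (\<Sum>s\<in>cuts k (length js). alt (sum_list s) (\<mu> (simplex_path js s)))"
    by (rule sum.cong) (auto simp: simplex_path_eq cuts_def)
  finally show ?thesis using assms by (simp add: simplex_int_def cuts_def)
qed

section \<open>Lattice paths encoded by shuffles\<close>

lemma fold_dup_Nil [simp]: "fold dup \<nu> [] = []"
  by (induction \<nu>) (auto simp: dup_def)

lemma dup_0 [simp]: "dup 0 (x # xs) = x # x # xs"
  by (simp add: dup_def)

lemma dup_Suc [simp]: "dup (Suc j) (x # xs) = x # dup j xs"
  by (simp add: dup_def)

lemma fold_dup_map_Suc: "fold dup (map Suc \<nu>) (x # xs) = x # fold dup \<nu> xs"
  by (induction \<nu> arbitrary: xs) auto

lemma map_dup: "map f (dup j xs) = dup j (map f xs)"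
  by (simp add: dup_def take_map drop_map)

lemma map_fold_dup: "map f (fold dup \<nu> xs) = fold dup \<nu> (map f xs)"
  by (induction \<nu> arbitrary: xs) (auto simp: map_dup)

lemma shuffle_inv_eq:
  "shuffle_inv \<mu> \<nu> = sum_list (map (\<lambda>m. length (filter (\<lambda>n. n < m) \<nu>)) \<mu>)"
proof -
  have "{(i, j). i < length \<mu> \<and> j < length \<nu> \<and> \<nu> ! j < \<mu> ! i} =
      Sigma {..<length \<mu>} (\<lambda>i. {j. j < length \<nu> \<and> \<nu> ! j < \<mu> ! i})" by auto
  then have "shuffle_inv \<mu> \<nu> = (\<Sum>i<length \<mu>. card {j. j < length \<nu> \<and> \<nu> ! j < \<mu> ! i})"
    unfolding shuffle_inv_def by (simp only:) (subst card_SigmaI, auto)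
  also have "\<dots> = (\<Sum>i<length \<mu>. length (filter (\<lambda>n. n < \<mu> ! i) \<nu>))"
    by (simp add: length_filter_conv_card)
  finally show ?thesis by (simp add: sum_list_sum_nth lessThan_atLeast0)
qed

lemma shuffle_inv_Cons_0: "shuffle_inv (0 # map Suc \<mu>) (map Suc \<nu>) = shuffle_inv \<mu> \<nu>"
  by (simp add: shuffle_inv_eq comp_def filter_map)

text \<open>The new position 0 precedes every entry of the other list and adds one inversion for
  each of them.\<close>

lemma shuffle_inv_Cons_0': "shuffle_inv (map Suc \<mu>) (0 # map Suc \<nu>) = length \<mu> + shuffle_inv \<mu> \<nu>"
  by (simp add: shuffle_inv_eq comp_def filter_map sum_list_Suc)

lemma finite_shuffles_pq: "finite (shuffles_pq p q)"
proof (rule finite_subset)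
  show "shuffles_pq p q \<subseteq> {xs. set xs \<subseteq> {..<p + q} \<and> length xs = p} \<times> {xs. set xs \<subseteq> {..<p + q} \<and> length xs = q}"
    by (auto simp: shuffles_pq_def)
qed (intro finite_cartesian_product finite_lists_length_eq finite_lessThan)

lemma shuffles_pq_0: "shuffles_pq 0 0 = {([], [])}"
  by (auto simp: shuffles_pq_def)

lemma map_Suc_pred: "0 \<notin> set xs \<Longrightarrow> map Suc (map (\<lambda>t. t - 1) xs) = xs"
  by (induction xs) auto

lemma shuffles_pq_shift:
  "(0 # map Suc \<mu>, map Suc \<nu>) \<in> shuffles_pq (Suc p) q \<longleftrightarrow> (\<mu>, \<nu>) \<in> shuffles_pq p q"
  "(map Suc \<mu>, 0 # map Suc \<nu>) \<in> shuffles_pq p (Suc q) \<longleftrightarrow> (\<mu>, \<nu>) \<in> shuffles_pq p q"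
proof -
  have A: "insert 0 (Suc ` X) = {..<Suc n} \<longleftrightarrow> X = {..<n}" for X n
  proof -
    have "insert 0 (Suc ` X) = {..<Suc n} \<longleftrightarrow> insert 0 (Suc ` X) = insert 0 (Suc ` {..<n})"
      by (simp add: lessThan_Suc_eq_insert_0)
    also have "\<dots> \<longleftrightarrow> Suc ` X = Suc ` {..<n}"
      by (rule insert_ident) auto
    finally show ?thesis by (simp add: inj_image_eq_iff)
  qed
  show "(0 # map Suc \<mu>, map Suc \<nu>) \<in> shuffles_pq (Suc p) q \<longleftrightarrow> (\<mu>, \<nu>) \<in> shuffles_pq p q"
    unfolding shuffles_pq_def
    using A[of "set \<mu> \<union> set \<nu>" "p + q"] by (auto simp: sorted_wrt_map image_Un image_iff)
  show "(map Suc \<mu>, 0 # map Suc \<nu>) \<in> shuffles_pq p (Suc q) \<longleftrightarrow> (\<mu>, \<nu>) \<in> shuffles_pq p q"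
    unfolding shuffles_pq_def
    using A[of "set \<mu> \<union> set \<nu>" "p + q"] by (auto simp: sorted_wrt_map image_Un image_iff)
qed

text \<open>Position 0 lies in exactly one of the two disjoint increasing lists and is the head of
  it; this decides the first step of the path.\<close>

lemma shuffles_pq_cases:
  assumes s: "(\<mu>, \<nu>) \<in> shuffles_pq p q" and pq: "0 < p + q"
  obtains (left) p' \<mu>' \<nu>' where "p = Suc p'" "\<mu> = 0 # map Suc \<mu>'" "\<nu> = map Suc \<nu>'" "(\<mu>', \<nu>') \<in> shuffles_pq p' q"
  | (right) q' \<mu>' \<nu>' where "q = Suc q'" "\<mu> = map Suc \<mu>'" "\<nu> = 0 # map Suc \<nu>'" "(\<mu>', \<nu>') \<in> shuffles_pq p q'"
proof -
  have zero: "0 \<in> set \<mu> \<union> set \<nu>" using s pq by (auto simp: shuffles_pq_def)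
  have hd0: "\<exists>ys. xs = 0 # ys \<and> 0 \<notin> set ys" if "0 \<in> set xs" "sorted_wrt (<) xs" for xs :: "nat list"
    using that by (cases xs) auto
  show ?thesis
  proof (cases "0 \<in> set \<mu>")
    case True
    moreover have "sorted_wrt (<) \<mu>" using s by (simp add: shuffles_pq_def)
    ultimately obtain ys where ys: "\<mu> = 0 # ys" "0 \<notin> set ys"
      using hd0 by blast
    have n: "0 \<notin> set \<nu>" using s True by (auto simp: shuffles_pq_def)
    obtain p' where p': "p = Suc p'" using s ys by (auto simp: shuffles_pq_def)
    have e: "\<mu> = 0 # map Suc (map (\<lambda>t. t - 1) ys)" "\<nu> = map Suc (map (\<lambda>t. t - 1) \<nu>)"
      using map_Suc_pred[OF ys(2)] map_Suc_pred[OF n] ys(1) by simp_all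
    then have "(map (\<lambda>t. t - 1) ys, map (\<lambda>t. t - 1) \<nu>) \<in> shuffles_pq p' q"
      using s p' shuffles_pq_shift(1) by metis
    with p' e show ?thesis by (rule left)
  next
    case False
    then have "0 \<in> set \<nu>" using zero by simp
    moreover have "sorted_wrt (<) \<nu>" using s by (simp add: shuffles_pq_def)
    ultimately obtain ys where ys: "\<nu> = 0 # ys" "0 \<notin> set ys"
      using hd0 by blast
    obtain q' where q': "q = Suc q'" using s ys by (auto simp: shuffles_pq_def)
    have e: "\<mu> = map Suc (map (\<lambda>t. t - 1) \<mu>)" "\<nu> = 0 # map Suc (map (\<lambda>t. t - 1) ys)"
      using map_Suc_pred[OF ys(2)] map_Suc_pred[OF False] ys(1) by simp_all
    then have "(map (\<lambda>t. t - 1) \<mu>, map (\<lambda>t. t - 1) ys) \<in> shuffles_pq p q'"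
      using s q' shuffles_pq_shift(2) by metis
    with q' e show ?thesis by (rule right)
  qed
qed

lemma sum_shuffles_pq:
  assumes "0 < p + q"
  shows "sum F (shuffles_pq p q) =
    (if p = 0 then 0 else \<Sum>(\<mu>, \<nu>)\<in>shuffles_pq (p - 1) q. F (0 # map Suc \<mu>, map Suc \<nu>)) +
    (if q = 0 then 0 else \<Sum>(\<mu>, \<nu>)\<in>shuffles_pq p (q - 1). F (map Suc \<mu>, 0 # map Suc \<nu>))"
proof -
  define l :: "nat list \<times> nat list \<Rightarrow> nat list \<times> nat list" where "l = (\<lambda>(\<mu>, \<nu>). (0 # map Suc \<mu>, map Suc \<nu>))"
  define r :: "nat list \<times> nat list \<Rightarrow> nat list \<times> nat list" where "r = (\<lambda>(\<mu>, \<nu>). (map Suc \<mu>, 0 # map Suc \<nu>))"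
  define L where "L = (if p = 0 then {} else shuffles_pq (p - 1) q)"
  define R where "R = (if q = 0 then {} else shuffles_pq p (q - 1))"
  have eq: "shuffles_pq p q = l ` L \<union> r ` R"
  proof (intro equalityI subsetI)
    fix x assume x: "x \<in> shuffles_pq p q"
    obtain \<mu> \<nu> where [simp]: "x = (\<mu>, \<nu>)" by (cases x)
    from x have "(\<mu>, \<nu>) \<in> shuffles_pq p q" by simp
    from this assms show "x \<in> l ` L \<union> r ` R"
    proof (cases rule: shuffles_pq_cases[consumes 2, case_names left right])
      case (left p' \<mu>' \<nu>')
      then have "x = l (\<mu>', \<nu>')" "(\<mu>', \<nu>') \<in> L" by (simp_all add: l_def L_def)
      then show ?thesis by blast
    next
      case (right q' \<mu>' \<nu>')
      then have "x = r (\<mu>', \<nu>')" "(\<mu>', \<nu>') \<in> R" by (simp_all add: r_def R_def)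
      then show ?thesis by blast
    qed
  next
    fix x assume "x \<in> l ` L \<union> r ` R"
    then show "x \<in> shuffles_pq p q"
      using shuffles_pq_shift(1)[of _ _ "p - 1" q] shuffles_pq_shift(2)[of _ _ p "q - 1"]
      by (auto simp: l_def L_def r_def R_def split: if_splits)
  qed
  have "sum F (shuffles_pq p q) = sum F (l ` L) + sum F (r ` R)"
    unfolding eq by (rule sum.union_disjoint) (auto simp: L_def R_def finite_shuffles_pq l_def r_def)
  moreover have "sum F (l ` L) = sum (F \<circ> l) L"
    by (rule sum.reindex) (auto simp: inj_on_def l_def)
  moreover have "sum F (r ` R) = sum (F \<circ> r) R"
    by (rule sum.reindex) (auto simp: inj_on_def r_def)
  ultimately show ?thesis
    by (auto simp: L_def R_def l_def r_def case_prod_beta o_def)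
qed

text \<open>A position in \<open>\<mu>\<close> duplicates an entry of \<open>ys\<close>, so the
  first coordinate stays and the second moves; the positions in \<open>\<nu>\<close> move the first
  coordinate. A leading position in \<open>\<mu>\<close> adds no inversion. One in
  \<open>\<nu>\<close> adds \<open>p\<close>, the number of steps in the second coordinate still to
  come.\<close>

lemma sum_shuffles_eq_path_sum:
  assumes "length ys = Suc q" "length xs = Suc p"
  shows "(\<Sum>(\<mu>, \<nu>)\<in>shuffles_pq p q. alt (shuffle_inv \<mu> \<nu>) (f (zip (fold dup \<mu> ys) (fold dup \<nu> xs)))) =
    path_sum f ys xs"
  using assms
proof (induction ys xs arbitrary: f p q rule: path_induct)
  case (Cons y ys x xs)
  define g where "g w = f ((y, x) # w)" for w
  have len: "length ys = q" "length xs = p" using Cons.prems by auto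
  show ?case
  proof (cases "p + q = 0")
    case True
    then have "ys = []" "xs = []" using len by auto
    then show ?thesis using True by (simp add: shuffles_pq_0 shuffle_inv_def)
  next
    case False
    have A: "(\<Sum>(\<mu>, \<nu>)\<in>shuffles_pq (p - 1) q. alt (shuffle_inv (0 # map Suc \<mu>) (map Suc \<nu>))
        (f (zip (fold dup (0 # map Suc \<mu>) (y # ys)) (fold dup (map Suc \<nu>) (x # xs))))) = path_sum g (y # ys) xs"
      if "p \<noteq> 0"
      using Cons.IH(2)[of q "p - 1" g] that len
      by (simp add: shuffle_inv_Cons_0 fold_dup_map_Suc g_def[symmetric])
    have B: "(\<Sum>(\<mu>, \<nu>)\<in>shuffles_pq p (q - 1). alt (shuffle_inv (map Suc \<mu>) (0 # map Suc \<nu>))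
        (f (zip (fold dup (map Suc \<mu>) (y # ys)) (fold dup (0 # map Suc \<nu>) (x # xs))))) =
        alt p (path_sum g ys (x # xs))"
      if "q \<noteq> 0"
    proof -
      have "alt (shuffle_inv (map Suc \<mu>) (0 # map Suc \<nu>))
        (f (zip (fold dup (map Suc \<mu>) (y # ys)) (fold dup (0 # map Suc \<nu>) (x # xs)))) =
        alt p (alt (shuffle_inv \<mu> \<nu>) (g (zip (fold dup \<mu> ys) (fold dup \<nu> (x # xs)))))"
        if "(\<mu>, \<nu>) \<in> shuffles_pq p (q - 1)" for \<mu> \<nu>
        using that by (simp add: shuffle_inv_Cons_0' fold_dup_map_Suc g_def alt_alt shuffles_pq_def)
      then have "(\<Sum>(\<mu>, \<nu>)\<in>shuffles_pq p (q - 1). alt (shuffle_inv (map Suc \<mu>) (0 # map Suc \<nu>))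
          (f (zip (fold dup (map Suc \<mu>) (y # ys)) (fold dup (0 # map Suc \<nu>) (x # xs))))) =
          (\<Sum>(\<mu>, \<nu>)\<in>shuffles_pq p (q - 1). alt p (alt (shuffle_inv \<mu> \<nu>) (g (zip (fold dup \<mu> ys) (fold dup \<nu> (x # xs))))))"
        by (intro sum.cong) auto
      also have "\<dots> = alt p (path_sum g ys (x # xs))"
        using Cons.IH(1)[of "q - 1" p g] that len by (simp add: alt_sum[symmetric] case_prod_beta)
      finally show ?thesis .
    qed
    have "0 < p + q" using False by simp
    note S = sum_shuffles_pq[OF this]
    show ?thesis
      unfolding S using A B len False by (auto simp: g_def[symmetric] add.commute)
  qed
qed auto

text \<open>Beyond the end of a list \<open>dup\<close> changes nothing, so the lengths come out
  right only because the positions of a shuffle always fall inside the list built so far.\<close>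

lemma fold_dup_shuffle:
  assumes "(\<mu>, \<nu>) \<in> shuffles_pq p q" "length ys = Suc q" "length xs = Suc p"
  shows "length (fold dup \<mu> ys) = Suc (p + q) \<and> length (fold dup \<nu> xs) = Suc (p + q) \<and>
    set (fold dup \<mu> ys) = set ys \<and> set (fold dup \<nu> xs) = set xs \<and>
    (sorted ys \<longrightarrow> sorted (fold dup \<mu> ys)) \<and> (sorted xs \<longrightarrow> sorted (fold dup \<nu> xs))"
  using assms
proof (induction ys xs arbitrary: \<mu> \<nu> p q rule: path_induct)
  case (Cons y ys x xs)
  show ?case
  proof (cases "p + q = 0")
    case True
    then show ?thesis using Cons.prems by (auto simp: shuffles_pq_0)
  next
    case False
    then have "0 < p + q" by simp
    with Cons.prems(1) show ?thesis
    proof (cases rule: shuffles_pq_cases[consumes 2, case_names left right])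
      case (left p' \<mu>' \<nu>')
      have "xs \<noteq> []" using Cons.prems left by auto
      then show ?thesis using Cons.IH(2)[OF left(4)] Cons.prems left by (auto simp: fold_dup_map_Suc)
    next
      case (right q' \<mu>' \<nu>')
      have "ys \<noteq> []" using Cons.prems right by auto
      then show ?thesis using Cons.IH(1)[OF right(4)] Cons.prems right by (auto simp: fold_dup_map_Suc)
    qed
  qed
qed auto

section \<open>Products of matrix-valued forms\<close>

type_synonym cmat = "nat \<Rightarrow> nat \<Rightarrow> complex"

text \<open>Matrices are bare functions of two indices, of which only the range below
  \<open>r\<close> is summed; associativity then holds without any condition on carriers.\<close>

definition mm :: "nat \<Rightarrow> cmat \<Rightarrow> cmat \<Rightarrow> cmat" where
  "mm r A B = (\<lambda>i j. \<Sum>k<r. A i k * B k j)"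

text \<open>The value at a point of the product of a word of matrix-valued \<open>0\<close>-forms (\<open>Inl\<close>) and \<open>1\<close>-forms (\<open>Inr\<close>).\<close>

fun wprod :: "nat \<Rightarrow> (cmat + ('v \<Rightarrow> cmat)) list \<Rightarrow> 'v list \<Rightarrow> cmat" where
  "wprod r [] vs = (\<lambda>i j. if vs = [] \<and> i = j then 1 else 0)"
| "wprod r (Inl B # gs) vs = mm r B (wprod r gs vs)"
| "wprod r (Inr g # gs) vs =
    (\<lambda>i j. \<Sum>t<length vs. (- 1) ^ t * mm r (g (vs ! t)) (wprod r gs (del t vs)) i j)"

definition trw :: "nat \<Rightarrow> (cmat + ('v \<Rightarrow> cmat)) list \<Rightarrow> 'v list \<Rightarrow> complex" where
  "trw r gs vs = (\<Sum>i<r. wprod r gs vs i i)"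

lemma letter_induct [case_names Nil Inl Inr]:
  assumes "P []" "\<And>B gs. P gs \<Longrightarrow> P (Inl B # gs)" "\<And>g gs. P gs \<Longrightarrow> P (Inr g # gs)"
  shows "P gs"
proof (induction gs)
  case (Cons x gs)
  then show ?case using assms by (cases x) auto
qed (rule assms)

lemma mm_assoc: "mm r (mm r A B) C = mm r A (mm r B C)"
proof (intro ext)
  fix i j
  have "mm r (mm r A B) C i j = (\<Sum>k<r. \<Sum>l<r. A i l * B l k * C k j)"
    by (simp add: mm_def sum_distrib_right)
  also have "\<dots> = (\<Sum>l<r. \<Sum>k<r. A i l * B l k * C k j)" by (rule sum.swap)
  finally show "mm r (mm r A B) C i j = mm r A (mm r B C) i j"
    by (simp add: mm_def sum_distrib_left mult.assoc)
qed

lemma mm_cong: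
  assumes "\<And>k. k < r \<Longrightarrow> A i k = A' i k" "\<And>k. k < r \<Longrightarrow> B k j = B' k j"
  shows "mm r A B i j = mm r A' B' i j"
  using assms by (simp add: mm_def)

lemma mm_add_right: "mm r A (\<lambda>i j. B i j + C i j) i j = mm r A B i j + mm r A C i j"
  by (simp add: mm_def distrib_left sum.distrib)

lemma mm_add_left: "mm r (\<lambda>i j. A i j + B i j) C i j = mm r A C i j + mm r B C i j"
  by (simp add: mm_def distrib_right sum.distrib)

lemma mm_scale_right: "mm r A (\<lambda>i j. c * B i j) i j = c * mm r A B i j"
  by (simp add: mm_def sum_distrib_left mult_ac)

lemma mm_scale_left: "mm r (\<lambda>i j. c * A i j) B i j = c * mm r A B i j"
  by (simp add: mm_def sum_distrib_left mult_ac)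

lemma mm_sum_right: "mm r A (\<lambda>i j. \<Sum>t\<in>T. c t * B t i j) i j = (\<Sum>t\<in>T. c t * mm r A (B t) i j)"
proof -
  have "mm r A (\<lambda>i j. \<Sum>t\<in>T. c t * B t i j) i j = (\<Sum>k<r. \<Sum>t\<in>T. c t * (A i k * B t k j))"
    by (simp add: mm_def sum_distrib_left mult_ac)
  also have "\<dots> = (\<Sum>t\<in>T. \<Sum>k<r. c t * (A i k * B t k j))" by (rule sum.swap)
  finally show ?thesis by (simp add: mm_def sum_distrib_left)
qed

lemma mm_sum_left: "mm r (\<lambda>i j. \<Sum>t\<in>T. c t * B t i j) A i j = (\<Sum>t\<in>T. c t * mm r (B t) A i j)"
proof -
  have "mm r (\<lambda>i j. \<Sum>t\<in>T. c t * B t i j) A i j = (\<Sum>k<r. \<Sum>t\<in>T. c t * (B t i k * A k j))"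
    by (simp add: mm_def sum_distrib_right sum_distrib_left mult_ac)
  also have "\<dots> = (\<Sum>t\<in>T. \<Sum>k<r. c t * (B t i k * A k j))" by (rule sum.swap)
  finally show ?thesis by (simp add: mm_def sum_distrib_left)
qed

lemma mm_zero_left [simp]: "mm r (\<lambda>_ _. 0) B = (\<lambda>_ _. 0)"
  by (simp add: mm_def fun_eq_iff)

lemma mm_zero_right [simp]: "mm r A (\<lambda>_ _. 0) = (\<lambda>_ _. 0)"
  by (simp add: mm_def fun_eq_iff)

lemma wprod_append_cong':
  assumes "\<And>vs. wprod r gs vs = wprod r gs' vs"
  shows "wprod r (xs @ gs) vs = wprod r (xs @ gs') vs"
  using assms by (induction xs arbitrary: vs rule: letter_induct) auto

lemma wprod_Inl_Inl: "wprod r (Inl A # Inl B # gs) vs = wprod r (Inl (mm r A B) # gs) vs"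
  by (simp add: mm_assoc)

lemma wprod_Inr_mm_right:
  "wprod r (Inr (\<lambda>v. mm r (g v) B) # gs) vs = wprod r (Inr g # Inl B # gs) vs"
  by (simp add: mm_assoc)

text \<open>The 0-form does not see the vectors, so it factors out of the sum over the
  slots.\<close>

lemma wprod_Inr_mm_left:
  "wprod r (Inr (\<lambda>v. mm r B (g v)) # gs) vs = wprod r (Inl B # Inr g # gs) vs"
  by (intro ext) (simp add: mm_assoc mm_sum_right)

lemma wprod_append_add:
  "wprod r (xs @ Inr (\<lambda>v i j. g v i j + h v i j) # ys) vs i j =
   wprod r (xs @ Inr g # ys) vs i j + wprod r (xs @ Inr h # ys) vs i j"
proof (induction xs arbitrary: vs i j rule: letter_induct)
  case Nil
  show ?case by (simp add: mm_add_left distrib_left sum.distrib)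
next
  case (Inl B xs)
  show ?case by (simp add: Inl[abs_def] mm_add_right)
next
  case (Inr g xs)
  show ?case by (simp add: Inr[abs_def] mm_add_right distrib_left sum.distrib)
qed

text \<open>The indices must be below \<open>r\<close>: the empty word is the identity on all
  indices, whereas \<open>mm\<close> sums only below \<open>r\<close>.\<close>

lemma wprod_snoc_Inl:
  assumes "i < r" "j < r"
  shows "wprod r (gs @ [Inl B]) vs i j = mm r (wprod r gs vs) B i j"
  using assms(1)
proof (induction gs arbitrary: vs i rule: letter_induct)
  case Nil
  show ?case
  proof (cases "vs = []")
    case True
    have "(\<Sum>k<r. B i k * (if k = j then 1 else 0)) = B i j"
      using assms(2) by (simp add: if_distrib cong: if_cong)
    moreover have "(\<Sum>k<r. (if i = k then 1 else 0) * B k j) = B i j"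
      using Nil by (subst sum.cong[OF refl, of _ _ "\<lambda>k. if i = k then B k j else 0"]) auto
    ultimately show ?thesis using True by (simp add: mm_def)
  qed (simp add: mm_def)
next
  case (Inl A gs)
  have "wprod r ((Inl A # gs) @ [Inl B]) vs i j = mm r A (mm r (wprod r gs vs) B) i j"
    by (simp, rule mm_cong) (auto intro: Inl.IH)
  then show ?case by (simp add: mm_assoc)
next
  case (Inr g gs)
  have "wprod r ((Inr g # gs) @ [Inl B]) vs i j =
      (\<Sum>t<length vs. (- 1) ^ t * mm r (g (vs ! t)) (mm r (wprod r gs (del t vs)) B) i j)"
    by (simp, intro sum.cong refl arg_cong2[of _ _ _ _ "(*)"] mm_cong) (auto intro: Inr.IH)
  then show ?case by (simp add: mm_assoc[symmetric] mm_sum_left)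
qed

text \<open>The letter that moves around has form degree 0, hence there is no sign; exchanging the
  two index sums is all that happens.\<close>

lemma trw_cyclic: "trw r (gs @ [Inl B]) vs = trw r (Inl B # gs) vs"
proof -
  have "trw r (gs @ [Inl B]) vs = (\<Sum>i<r. \<Sum>k<r. wprod r gs vs i k * B k i)"
    unfolding trw_def by (rule sum.cong) (simp_all add: wprod_snoc_Inl, simp add: mm_def)
  also have "\<dots> = (\<Sum>k<r. \<Sum>i<r. wprod r gs vs i k * B k i)" by (rule sum.swap)
  finally show ?thesis by (simp add: trw_def mm_def mult.commute)
qed

lemma wprod_wrong_length:
  assumes "length vs \<noteq> length (filter (\<lambda>x. \<not> isl x) gs)"
  shows "wprod r gs vs = (\<lambda>_ _. 0)"
  using assms
proof (induction gs arbitrary: vs rule: letter_induct)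
  case (Inr g gs)
  then show ?case by (intro ext) (simp, intro sum.neutral, simp add: length_del)
qed auto

lemma wprod_zero_letter:
  assumes "Inr g \<in> set gs" "\<And>v. v \<in> set vs \<Longrightarrow> g v = (\<lambda>_ _. 0)"
  shows "wprod r gs vs = (\<lambda>_ _. 0)"
  using assms
proof (induction gs arbitrary: vs rule: letter_induct)
  case (Inl B gs)
  then show ?case by simp
next
  case (Inr h gs)
  show ?case
  proof (cases "h = g")
    case True
    have "mm r (g (vs ! t)) X = (\<lambda>_ _. 0)" if "t < length vs" for t X
      using Inr.prems(2) that by simp
    then show ?thesis by (intro ext) (simp add: True)
  next
    case False
    then have "wprod r gs (del t vs) = (\<lambda>_ _. 0)" for t
      using Inr.prems set_del_subset[of t vs] by (intro Inr.IH) auto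
    then show ?thesis by simp
  qed
qed auto

text \<open>Meant for vectors outside the tangent space, on which every 1-form letter has the
  default value 0. Each vector is consumed by some letter, so one such vector kills the
  product.\<close>

lemma wprod_zero_vector:
  assumes "v \<in> set vs" "\<And>g. Inr g \<in> set gs \<Longrightarrow> g v = (\<lambda>_ _. 0)"
  shows "wprod r gs vs = (\<lambda>_ _. 0)"
  using assms
proof (induction gs arbitrary: vs rule: letter_induct)
  case (Inr h gs)
  have "mm r (h (vs ! t)) (wprod r gs (del t vs)) = (\<lambda>_ _. 0)" if t: "t < length vs" for t
  proof (cases "vs ! t = v")
    case True
    then show ?thesis using Inr.prems by simp
  next
    case False
    obtain s where s: "s < length vs" "vs ! s = v" using Inr.prems(1) by (metis in_set_conv_nth)
    have "vs = take t vs @ vs ! t # drop (Suc t) vs" using t by (rule id_take_nth_drop)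
    then have "v \<in> set (take t vs) \<union> set (drop (Suc t) vs)"
      using Inr.prems(1) False by (metis Un_iff set_ConsD set_append)
    then have "v \<in> set (del t vs)" by (simp add: del_def)
    then show ?thesis using Inr by simp
  qed
  then show ?case by (intro ext) simp
next
  case Nil
  then have "vs \<noteq> []" by auto
  then show ?case by simp
qed auto

lemma del_update_neq:
  assumes "t < length vs" "s < length vs" "t \<noteq> s"
  shows "del t (vs[s := u]) = (del t vs)[(if s < t then s else s - 1) := u]"
  using assms
proof (induction vs arbitrary: t s)
  case (Cons a vs)
  then show ?case by (cases t; cases s) (auto simp: nth_Cons' split: nat.splits)
qed simp

lemma del_update_eq: "del t (vs[t := u]) = del t vs"
  by (simp add: del_def)

lemma wprod_linear:
  assumes lin: "\<And>g i j. Inr g \<in> set gs \<Longrightarrow> g u i j = a * g v i j + g w i j"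
    and s: "s < length vs"
  shows "wprod r gs (vs[s := u]) i j = a * wprod r gs (vs[s := v]) i j + wprod r gs (vs[s := w]) i j"
  using assms
proof (induction gs arbitrary: vs s i j rule: letter_induct)
  case Nil
  then have "vs \<noteq> []" by auto
  then show ?case by simp
next
  case (Inl B gs)
  have "wprod r gs (vs[s := u]) = (\<lambda>i j. a * wprod r gs (vs[s := v]) i j + wprod r gs (vs[s := w]) i j)"
    by (intro ext, rule Inl.IH) (use Inl.prems in auto)
  then show ?case by (simp add: mm_add_right mm_scale_right)
next
  case (Inr g gs)
  have "mm r (g (vs[s := u] ! t)) (wprod r gs (del t (vs[s := u]))) i j =
      a * mm r (g (vs[s := v] ! t)) (wprod r gs (del t (vs[s := v]))) i j +
      mm r (g (vs[s := w] ! t)) (wprod r gs (del t (vs[s := w]))) i j" if t: "t < length vs" for t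
  proof (cases "t = s")
    case True
    have "g u = (\<lambda>i j. a * g v i j + g w i j)" using Inr.prems(1)[of g] by (simp add: fun_eq_iff)
    then show ?thesis using True t by (simp add: del_update_eq mm_add_left mm_scale_left)
  next
    case False
    \<comment> \<open>Deleting an earlier slot moves the updated vector down by one
      position.\<close>
    let ?s = "if s < t then s else s - 1"
    have s: "?s < length (del t vs)" using t False Inr.prems(2) by (auto simp: length_del)
    have "wprod r gs (del t (vs[s := u])) = (\<lambda>i j. a * wprod r gs (del t (vs[s := v])) i j + wprod r gs (del t (vs[s := w])) i j)"
      unfolding del_update_neq[OF t Inr.prems(2) False]
      by (intro ext, rule Inr.IH) (use s Inr.prems in auto)
    then show ?thesis using False by (simp add: mm_add_right mm_scale_right)
  qed
  then show ?case by (simp add: sum_distrib_left distrib_left sum.distrib mult_ac)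
qed

definition swap_adj :: "nat \<Rightarrow> 'b list \<Rightarrow> 'b list" where
  "swap_adj s vs = vs[s := vs ! Suc s, Suc s := vs ! s]"

lemma length_swap_adj [simp]: "length (swap_adj s vs) = length vs"
  by (simp add: swap_adj_def)

lemma swap_adj_Cons: "swap_adj (Suc s) (v # vs) = v # swap_adj s vs"
  by (simp add: swap_adj_def)

lemma swap_adj_0: "swap_adj 0 (v # w # vs) = w # v # vs"
  by (simp add: swap_adj_def)

lemma del_swap_adj:
  assumes "Suc s < length vs" "t < length vs"
  shows "t < s \<Longrightarrow> del t (swap_adj s vs) = swap_adj (s - 1) (del t vs)"
    "t > Suc s \<Longrightarrow> del t (swap_adj s vs) = swap_adj s (del t vs)"
    "del s (swap_adj s vs) = del (Suc s) vs"
    "del (Suc s) (swap_adj s vs) = del s vs"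
proof -
  have "(t < s \<longrightarrow> del t (swap_adj s vs) = swap_adj (s - 1) (del t vs)) \<and>
    (t > Suc s \<longrightarrow> del t (swap_adj s vs) = swap_adj s (del t vs)) \<and>
    del s (swap_adj s vs) = del (Suc s) vs \<and> del (Suc s) (swap_adj s vs) = del s vs"
    using assms
  proof (induction vs arbitrary: s t)
    case (Cons v vs)
    show ?case
    proof (cases s)
      case 0
      have "vs \<noteq> []" using Cons.prems(1) by auto
      then obtain w ws where vs: "vs = w # ws" by (meson list.exhaust)
      have sw: "swap_adj s (v # vs) = w # v # ws" by (simp add: 0 vs swap_adj_0)
      have "del t (w # v # ws) = swap_adj s (del t (v # w # ws))" if "Suc s < t"
      proof -
        have "t = Suc (Suc (t - 2))" using that by linarith
        then obtain t' where "t = Suc (Suc t')" ..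
        then show ?thesis by (simp add: 0 swap_adj_0)
      qed
      then show ?thesis unfolding sw by (simp add: 0 vs)
    next
      case (Suc s')
      have IH: "(t' < s' \<longrightarrow> del t' (swap_adj s' vs) = swap_adj (s' - 1) (del t' vs)) \<and>
          (Suc s' < t' \<longrightarrow> del t' (swap_adj s' vs) = swap_adj s' (del t' vs)) \<and>
          del s' (swap_adj s' vs) = del (Suc s') vs \<and> del (Suc s') (swap_adj s' vs) = del s' vs"
        if "t' < length vs" for t'
        by (rule Cons.IH) (use Cons.prems Suc that in auto)
      have "0 < length vs" using Cons.prems(1) Suc by (cases vs) auto
      note IH0 = IH[OF this]
      show ?thesis
      proof (cases t)
        case 0
        then show ?thesis using Suc IH0 by (simp add: swap_adj_Cons)
      next
        case (Suc t')
        then have "t' < length vs" using Cons.prems by simp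
        then show ?thesis using Suc \<open>s = Suc s'\<close> IH[of t']
          by (cases s') (simp_all add: swap_adj_Cons)
      qed
    qed
  qed simp
  then show "t < s \<Longrightarrow> del t (swap_adj s vs) = swap_adj (s - 1) (del t vs)"
    "t > Suc s \<Longrightarrow> del t (swap_adj s vs) = swap_adj s (del t vs)"
    "del s (swap_adj s vs) = del (Suc s) vs"
    "del (Suc s) (swap_adj s vs) = del s vs" by blast+
qed

text \<open>The sum over the slot taken by the first 1-form is reindexed by the transposition of
  \<open>s\<close> and \<open>Suc s\<close>. If that slot is one of the two, the remaining list is
  unchanged and the sign comes from \<open>(- 1) ^ t\<close>; otherwise the remaining list is
  swapped and the sign comes from the induction.\<close>

lemma wprod_swap_adj:
  assumes "Suc s < length vs"
  shows "wprod r gs (swap_adj s vs) i j = - wprod r gs vs i j"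
  using assms
proof (induction gs arbitrary: vs s i j rule: letter_induct)
  case Nil
  then have "vs \<noteq> []" "swap_adj s vs \<noteq> []" by (auto simp: swap_adj_def)
  then show ?case by simp
next
  case (Inl B gs)
  show ?case using Inl.IH[OF Inl.prems] by (simp add: mm_def sum_negf)
next
  case (Inr g gs)
  define F where "F vs t = (- 1) ^ t * mm r (g (vs ! t)) (wprod r gs (del t vs)) i j" for vs t
  define p where "p t = (if t = s then Suc s else if t = Suc s then s else t)" for t
  have inv: "p (p t) = t" for t by (simp add: p_def)
  have bij: "bij_betw p {..<length vs} {..<length vs}"
    by (rule bij_betwI[of _ _ _ p]) (use Inr.prems inv in \<open>auto simp: p_def\<close>)
  have "F (swap_adj s vs) (p t) = - F vs t" if t: "t < length vs" for t
  proof -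
    consider "t = s" | "t = Suc s" | "t < s" | "t > Suc s" by linarith
    then show ?thesis
    proof cases
      case 1
      have "swap_adj s vs ! Suc s = vs ! s" using Inr.prems by (simp add: swap_adj_def)
      then show ?thesis using 1 by (simp add: p_def F_def del_swap_adj(4)[OF Inr.prems t])
    next
      case 2
      have "swap_adj s vs ! s = vs ! Suc s" using Inr.prems by (simp add: swap_adj_def)
      then show ?thesis using 2 by (simp add: p_def F_def del_swap_adj(3)[OF Inr.prems t])
    next
      case 3
      have "swap_adj s vs ! t = vs ! t" using 3 by (simp add: swap_adj_def)
      moreover have "wprod r gs (swap_adj (s - 1) (del t vs)) i j = - wprod r gs (del t vs) i j" for i j
        by (rule Inr.IH) (use 3 t Inr.prems in \<open>simp add: length_del\<close>)
      ultimately show ?thesis using 3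
        by (simp add: p_def F_def del_swap_adj(1)[OF Inr.prems t] mm_def sum_negf)
    next
      case 4
      have "swap_adj s vs ! t = vs ! t" using 4 by (simp add: swap_adj_def)
      moreover have "wprod r gs (swap_adj s (del t vs)) i j = - wprod r gs (del t vs) i j" for i j
        by (rule Inr.IH) (use 4 t Inr.prems in \<open>simp add: length_del\<close>)
      ultimately show ?thesis using 4
        by (simp add: p_def F_def del_swap_adj(2)[OF Inr.prems t] mm_def sum_negf)
    qed
  qed
  then have "(\<Sum>t<length vs. F (swap_adj s vs) (p t)) = (\<Sum>t<length vs. - F vs t)" by simp
  moreover have "(\<Sum>t<length vs. F (swap_adj s vs) (p t)) = (\<Sum>t<length vs. F (swap_adj s vs) t)"
    using bij by (rule sum.reindex_bij_betw)
  ultimately show ?case by (simp add: F_def sum_negf)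
qed

text \<open>The later of the two equal vectors is moved down by adjacent swaps until they are
  neighbours; then the swap fixes the list, and the value equals its own negative.\<close>

lemma wprod_alternating:
  assumes "s < t" "t < length vs" "vs ! s = vs ! t"
  shows "wprod r gs vs i j = 0"
  using assms
proof (induction t arbitrary: vs)
  case (Suc t)
  show ?case
  proof (cases "t = s")
    case True
    then have "vs ! Suc s = vs ! s" using Suc.prems by simp
    then have "swap_adj s vs = vs" unfolding swap_adj_def by (metis list_update_id)
    then have "wprod r gs vs i j = - wprod r gs vs i j"
      using wprod_swap_adj[of s vs r gs i j] Suc.prems True by simp
    then show ?thesis by simp
  next
    case False
    have "wprod r gs (swap_adj t vs) i j = 0"
      by (rule Suc.IH) (use False Suc.prems in \<open>auto simp: swap_adj_def\<close>)
    then show ?thesis using wprod_swap_adj[of t vs r gs i j] Suc.prems by simp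
  qed
qed simp

section \<open>Closedness of the trace form: telescoping of the faces\<close>

fun steps :: "('b \<Rightarrow> 'b \<Rightarrow> 'v \<Rightarrow> cmat) \<Rightarrow> 'b list \<Rightarrow> (cmat + ('v \<Rightarrow> cmat)) list" where
  "steps G (a # b # w) = steps G (b # w) @ [Inr (G b a)]"
| "steps G _ = []"

lemma steps_Cons: "w \<noteq> [] \<Longrightarrow> steps G (a # w) = steps G w @ [Inr (G (hd w) a)]"
  by (cases w) auto

lemma face_sum_snoc: "face_sum f (u @ [z]) = face_sum (\<lambda>u. f (u @ [z])) u + alt (length u) (f u)"
proof -
  have "del t (u @ [z]) = del t u @ [z]" if "t < length u" for t
    using that by (simp add: del_def)
  moreover have "del (length u) (u @ [z]) = u" by (simp add: del_def)
  ultimately show ?thesis by (simp add: face_sum_def)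
qed

lemma face_sum_sum: "face_sum (\<lambda>w. \<Sum>x\<in>A. f x w) w = (\<Sum>x\<in>A. face_sum (f x) w)"
  unfolding face_sum_def alt_sum by (rule sum.swap)

text \<open>The Leibniz rule makes the inner faces telescope, with one factor \<open>\<partial>H\<close> replaced by \<open>H\<close>.\<close>

lemma face_sum_inner_steps:
  assumes leib: "\<And>a b c v. {a, b, c} \<subseteq> X \<Longrightarrow>
      G c a v = (\<lambda>i j. mm r (G c b v) (H b a) i j + mm r (H c b) (G b a v) i j)"
    and X: "set (a # u @ [z]) \<subseteq> X"
  shows "face_sum (\<lambda>u. wprod r (pre @ steps G (a # u @ [z]) @ post) vs i j) u =
    wprod r (pre @ steps G (u @ [z]) @ Inl (H (hd (u @ [z])) a) # post) vs i j -
    alt (length u) (wprod r (pre @ Inl (H z (last (a # u))) # steps G (a # u) @ post) vs i j)"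
  using X
proof (induction u arbitrary: a post)
  case (Cons b u)
  define c where "c = hd (u @ [z])"
  have c: "c \<in> X" using Cons.prems by (cases u) (auto simp: c_def)
  have "Inr (G c a) = Inr (\<lambda>v i j. mm r (G c b v) (H b a) i j + mm r (H c b) (G b a v) i j)"
    using leib[of a b c] c Cons.prems by auto
  then have "wprod r (pre @ steps G (a # u @ [z]) @ post) vs i j =
      wprod r ((pre @ steps G (u @ [z])) @ Inr (\<lambda>v i j. mm r (G c b v) (H b a) i j + mm r (H c b) (G b a v) i j) # post) vs i j"
    by (simp add: steps_Cons c_def)
  also have "\<dots> = wprod r ((pre @ steps G (u @ [z])) @ Inr (\<lambda>v. mm r (G c b v) (H b a)) # post) vs i j +
      wprod r ((pre @ steps G (u @ [z])) @ Inr (\<lambda>v. mm r (H c b) (G b a v)) # post) vs i j"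
    by (rule wprod_append_add)
  also have "wprod r ((pre @ steps G (u @ [z])) @ Inr (\<lambda>v. mm r (G c b v) (H b a)) # post) vs =
      wprod r ((pre @ steps G (u @ [z])) @ Inr (G c b) # Inl (H b a) # post) vs"
    by (rule wprod_append_cong'[OF wprod_Inr_mm_right])
  also have "wprod r ((pre @ steps G (u @ [z])) @ Inr (\<lambda>v. mm r (H c b) (G b a v)) # post) vs =
      wprod r ((pre @ steps G (u @ [z])) @ Inl (H c b) # Inr (G b a) # post) vs"
    by (rule wprod_append_cong'[OF wprod_Inr_mm_left])
  finally have 1: "wprod r (pre @ steps G (a # u @ [z]) @ post) vs i j =
      wprod r (pre @ steps G (b # u @ [z]) @ Inl (H b a) # post) vs i j +
      wprod r (pre @ steps G (u @ [z]) @ Inl (H c b) # Inr (G b a) # post) vs i j"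
    by (simp add: steps_Cons c_def)
  \<comment> \<open>The remaining faces keep \<open>G b a\<close> as a letter, so the induction
    hypothesis is used with this letter moved into \<open>post\<close>. Its first term cancels
    against the second summand of \<open>1\<close>.\<close>
  have 2: "face_sum (\<lambda>w. wprod r (pre @ steps G (a # (b # w) @ [z]) @ post) vs i j) u =
      wprod r (pre @ steps G (u @ [z]) @ Inl (H c b) # Inr (G b a) # post) vs i j -
      alt (length u) (wprod r (pre @ Inl (H z (last (b # u))) # steps G (b # u) @ Inr (G b a) # post) vs i j)"
    using Cons.IH[of b "Inr (G b a) # post"] Cons.prems by (simp add: c_def)
  show ?case unfolding face_sum_Cons 1 2 by simp
qed simp

text \<open>Telescoping leaves two words, one with \<open>H y a\<close> at the right end and one
  with \<open>H z l\<close> next to \<open>H a z\<close>. After rotating the first of these factors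
  to the front, the cocycle identity merges each with \<open>H a z\<close>, and the words become the
  faces that omit the first and the last vertex.\<close>

theorem face_sum_trw_steps:
  assumes leib: "\<And>a b c v. {a, b, c} \<subseteq> X \<Longrightarrow>
      G c a v = (\<lambda>i j. mm r (G c b v) (H b a) i j + mm r (H c b) (G b a v) i j)"
    and coc: "\<And>a b c. {a, b, c} \<subseteq> X \<Longrightarrow> mm r (H c b) (H b a) = H c a"
    and X: "set w \<subseteq> X" and w: "2 \<le> length w"
  shows "face_sum (\<lambda>w. trw r (Inl (H (hd w) (last w)) # steps G w) vs) w = 0"
proof -
  obtain a w' where "w = a # w'" using w by (cases w) auto
  moreover from this have "w' \<noteq> []" using w by auto
  ultimately obtain u z where weq: "w = a # u @ [z]" by (metis rev_exhaust)
  let ?T = "\<lambda>w. trw r (Inl (H (hd w) (last w)) # steps G w) vs"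
  define y where "y = hd (u @ [z])"
  define l where "l = last (a # u)"
  have y: "y \<in> X" "l \<in> X" using X weq by (auto simp: y_def l_def hd_append)
  have az: "a \<in> X" "z \<in> X" using X weq by auto
  have "face_sum (\<lambda>u. ?T (a # u @ [z])) u =
      (\<Sum>i<r. face_sum (\<lambda>u. wprod r ([Inl (H a z)] @ steps G (a # u @ [z]) @ []) vs i i) u)"
    by (simp add: trw_def face_sum_sum)
  also have "\<dots> = (\<Sum>i<r. wprod r ([Inl (H a z)] @ steps G (u @ [z]) @ Inl (H y a) # []) vs i i -
      alt (length u) (wprod r ([Inl (H a z)] @ Inl (H z l) # steps G (a # u) @ []) vs i i))"
    unfolding y_def l_def
    by (rule sum.cong[OF refl], rule face_sum_inner_steps[where X = X]) (use leib X weq in auto)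
  also have "\<dots> = trw r ((Inl (H a z) # steps G (u @ [z])) @ [Inl (H y a)]) vs -
      alt (length u) (trw r (Inl (H a z) # Inl (H z l) # steps G (a # u)) vs)"
    by (simp add: trw_def sum_subtractf alt_sum)
  also have "trw r ((Inl (H a z) # steps G (u @ [z])) @ [Inl (H y a)]) vs = ?T (u @ [z])"
    unfolding trw_cyclic unfolding trw_def wprod_Inl_Inl using coc[of z a y] y az
    by (simp add: y_def)
  also have "trw r (Inl (H a z) # Inl (H z l) # steps G (a # u)) vs = ?T (a # u)"
    unfolding trw_def wprod_Inl_Inl using coc[of l z a] y az by (simp add: l_def)
  finally show ?thesis
    unfolding weq face_sum_Cons face_sum_snoc by simp
qed

section \<open>Words of letters and matrix wedge products\<close>

lemma nths_compl_empty: "nths vs (- {}) = vs"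
  by (simp add: nths_all)

lemma nths_singleton: "t < length vs \<Longrightarrow> nths vs {t} = [vs ! t]"
proof (induction vs arbitrary: t)
  case (Cons v vs)
  show ?case
  proof (cases t)
    case 0
    then have "{j. Suc j \<in> {t}} = {}" by auto
    then show ?thesis using 0 by (simp add: nths_Cons)
  next
    case (Suc t')
    then have "{j. Suc j \<in> {t}} = {t'}" by auto
    then show ?thesis using Suc Cons by (simp add: nths_Cons)
  qed
qed simp

lemma nths_compl_singleton: "nths vs (- {t}) = del t vs"
proof (induction vs arbitrary: t)
  case (Cons v vs)
  show ?case
  proof (cases t)
    case 0
    then have "{j. Suc j \<in> - {t}} = UNIV" by auto
    then show ?thesis using 0 by (simp add: nths_Cons nths_all)
  next
    case (Suc t')
    then have "{j. Suc j \<in> - {t}} = - {t'}" by auto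
    then show ?thesis using Suc Cons by (simp add: nths_Cons)
  qed
qed (simp add: del_def)

lemma wedge_inv_singleton: "t < k \<Longrightarrow> wedge_inv k {t} = t"
proof -
  assume "t < k"
  then have "{(i, j). i \<in> {t} \<and> j \<in> {..<k} - {t} \<and> j < i} = {t} \<times> {..<t}" by auto
  then show ?thesis by (simp add: wedge_inv_def card_cartesian_product)
qed

definition represents :: "nat \<Rightarrow> ('v list \<Rightarrow> complex mat) \<Rightarrow> cmat + ('v \<Rightarrow> cmat) \<Rightarrow> bool" where
  "represents r \<eta> L \<longleftrightarrow> (\<forall>vs. \<eta> vs \<in> carrier_mat r r \<and> (\<forall>i<r. \<forall>j<r. \<eta> vs $$ (i, j) = wprod r [L] vs i j))"

lemma wprod_single_Inl: "j < r \<Longrightarrow> wprod r [Inl B] vs i j = (if vs = [] then B i j else 0)"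
  by (simp add: mm_def if_distrib cong: if_cong)

lemma wprod_single_Inr:
  assumes "j < r" shows "wprod r [Inr g] vs i j = (if length vs = 1 then g (hd vs) i j else 0)"
proof -
  have "wprod r [Inr g] vs i j = (\<Sum>t<length vs. (- 1) ^ t * (if del t vs = [] then g (vs ! t) i j else 0))"
    unfolding wprod.simps mm_def
  proof (intro sum.cong refl arg_cong2[of _ _ _ _ "(*)"])
    fix t
    show "(\<Sum>k<r. g (vs ! t) i k * (if del t vs = [] \<and> k = j then 1 else 0)) =
        (if del t vs = [] then g (vs ! t) i j else 0)"
      using assms by (cases "del t vs = []") (simp_all add: if_distrib cong: if_cong)
  qed
  also have "\<dots> = (if length vs = 1 then g (hd vs) i j else 0)"
  proof (cases "length vs = 1")
    case True
    then obtain v where "vs = [v]" by (metis length_0_conv length_Suc_conv One_nat_def)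
    then show ?thesis by simp
  next
    case False
    have "del t vs \<noteq> []" if "t < length vs" for t
      using that False length_del[OF that] by auto
    then show ?thesis using False by simp
  qed
  finally show ?thesis .
qed

text \<open>In the sum over subsets defining the wedge product, a leading 0-form leaves only the
  empty set, and a leading 1-form leaves only the singletons, whose sign for \<open>{t}\<close> is
  \<open>(- 1) ^ t\<close>. These are the two clauses of \<open>wprod\<close>.\<close>

lemma mwedges_eq_wprod:
  assumes "n p = r" "list_all2 (\<lambda>\<eta> L. represents r (\<eta> p) L) \<eta>s Ls" "\<eta>s \<noteq> []"
  shows "mwedges n \<eta>s p vs \<in> carrier_mat r r \<and> (\<forall>i<r. \<forall>j<r. mwedges n \<eta>s p vs $$ (i, j) = wprod r Ls vs i j)"
  using assms
proof (induction n \<eta>s arbitrary: vs Ls rule: mwedges.induct)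
  case (2 n \<eta>)
  then obtain L where "Ls = [L]" by (auto simp: list_all2_Cons1)
  then show ?case using 2 by (auto simp: represents_def)
next
  case (3 n \<eta> \<theta> \<theta>s)
  obtain L Ls' where Ls: "Ls = L # Ls'" "represents r (\<eta> p) L" "list_all2 (\<lambda>\<eta> L. represents r (\<eta> p) L) (\<theta> # \<theta>s) Ls'"
    using 3(3) by (auto simp: list_all2_Cons1)
  define \<Theta> where "\<Theta> vs = mwedges n (\<theta> # \<theta>s) p vs" for vs
  have \<Theta>: "\<Theta> vs \<in> carrier_mat r r" "\<And>i j. i < r \<Longrightarrow> j < r \<Longrightarrow> \<Theta> vs $$ (i, j) = wprod r Ls' vs i j" for vs
    using 3(1)[OF 3(2) Ls(3)] by (auto simp: \<Theta>_def)
  have \<eta>: "\<eta> p vs \<in> carrier_mat r r" "\<And>i j. i < r \<Longrightarrow> j < r \<Longrightarrow> \<eta> p vs $$ (i, j) = wprod r [L] vs i j" for vs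
    using Ls(2) by (auto simp: represents_def)
  have prod: "(\<eta> p us * \<Theta> ws) $$ (i, j) = mm r (wprod r [L] us) (wprod r Ls' ws) i j"
    if ij: "i < r" "j < r" for us ws i j
  proof -
    have "(\<eta> p us * \<Theta> ws) $$ (i, j) = (\<Sum>k = 0..<r. \<eta> p us $$ (i, k) * \<Theta> ws $$ (k, j))"
      using \<eta>(1)[of us] \<Theta>(1)[of ws] ij by (auto simp: scalar_prod_def intro!: sum.cong)
    also have "\<dots> = mm r (wprod r [L] us) (wprod r Ls' ws) i j"
      using ij by (simp add: mm_def lessThan_atLeast0 \<eta>(2) \<Theta>(2))
    finally show ?thesis .
  qed
  have val: "mwedges n (\<eta> # \<theta> # \<theta>s) p vs $$ (i, j) =
      (\<Sum>S\<in>Pow {..<length vs}. (- 1) ^ wedge_inv (length vs) S * mm r (wprod r [L] (nths vs S)) (wprod r Ls' (nths vs (- S))) i j)"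
    if ij: "i < r" "j < r" for i j
    using ij 3(2) by (simp add: mwedge_def \<Theta>_def[symmetric] prod)
  have "mwedges n (\<eta> # \<theta> # \<theta>s) p vs $$ (i, j) = wprod r Ls vs i j" if ij: "i < r" "j < r" for i j
  proof (cases L)
    case (Inl B)
    have 0: "mm r (wprod r [L] (nths vs S)) (wprod r Ls' (nths vs (- S))) i j = 0"
      if S: "S \<in> Pow {..<length vs} - {{}}" for S
    proof -
      have "finite S" using S finite_subset by auto
      then have "card {i. i < length vs \<and> i \<in> S} \<noteq> 0" using S by (auto simp: card_eq_0_iff)
      then have "nths vs S \<noteq> []" by (metis length_nths list.size(3))
      then have "wprod r [L] (nths vs S) i k = 0" if "k < r" for k
        using that by (simp add: Inl wprod_single_Inl del: wprod.simps)
      then show ?thesis by (simp add: mm_def)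
    qed
    have "mwedges n (\<eta> # \<theta> # \<theta>s) p vs $$ (i, j) =
        (\<Sum>S\<in>{{}}. (- 1) ^ wedge_inv (length vs) S * mm r (wprod r [L] (nths vs S)) (wprod r Ls' (nths vs (- S))) i j)"
      unfolding val[OF ij] by (rule sum.mono_neutral_right) (use 0 in auto)
    also have "\<dots> = mm r (wprod r [L] []) (wprod r Ls' vs) i j"
      by (simp add: wedge_inv_def nths_compl_empty[simplified] del: wprod.simps)
    also have "\<dots> = mm r B (wprod r Ls' vs) i j"
      by (rule mm_cong) (simp_all add: Inl wprod_single_Inl del: wprod.simps)
    finally show ?thesis by (simp add: Ls(1) Inl)
  next
    case (Inr g)
    have 0: "mm r (wprod r [L] (nths vs S)) (wprod r Ls' (nths vs (- S))) i j = 0"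
      if S: "S \<in> Pow {..<length vs} - (\<lambda>t. {t}) ` {..<length vs}" for S
    proof -
      have eq: "{i. i < length vs \<and> i \<in> S} = S" using S by auto
      have "card S \<noteq> 1" using S by (auto simp: card_1_singleton_iff)
      then have "length (nths vs S) \<noteq> 1" unfolding length_nths eq .
      then have "wprod r [L] (nths vs S) i k = 0" if "k < r" for k
        using that by (simp add: Inr wprod_single_Inr del: wprod.simps)
      then show ?thesis by (simp add: mm_def)
    qed
    have "mwedges n (\<eta> # \<theta> # \<theta>s) p vs $$ (i, j) =
        (\<Sum>S\<in>(\<lambda>t. {t}) ` {..<length vs}. (- 1) ^ wedge_inv (length vs) S * mm r (wprod r [L] (nths vs S)) (wprod r Ls' (nths vs (- S))) i j)"
      unfolding val[OF ij] by (rule sum.mono_neutral_right) (use 0 in auto)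
    also have "\<dots> = (\<Sum>t<length vs. (- 1) ^ t * mm r (wprod r [L] [vs ! t]) (wprod r Ls' (del t vs)) i j)"
      by (subst sum.reindex) (auto simp: wedge_inv_singleton nths_singleton nths_compl_singleton simp del: wprod.simps)
    also have "\<dots> = (\<Sum>t<length vs. (- 1) ^ t * mm r (g (vs ! t)) (wprod r Ls' (del t vs)) i j)"
      by (intro sum.cong refl arg_cong2[of _ _ _ _ "(*)"] mm_cong) (simp_all add: Inr wprod_single_Inr del: wprod.simps)
    finally show ?thesis by (simp add: Ls(1) Inr)
  qed
  moreover have "mwedges n (\<eta> # \<theta> # \<theta>s) p vs \<in> carrier_mat r r"
    using 3(2) by (simp add: mwedge_def)
  ultimately show ?case by blast
qed simp

section \<open>Holomorphic forms\<close>

lemma cidx_all_iff: "js \<in> cidx_all J \<longleftrightarrow> js \<noteq> [] \<and> set js \<subseteq> J"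
  by (cases js) (auto simp: cidx_all_def cidx_def)

lemma cidxD: "js \<in> cidx J q \<Longrightarrow> js \<in> cidx_all J"
  by (auto simp: cidx_all_def)

lemma res_form_res_form: "V \<subseteq> V' \<Longrightarrow> res_form V (res_form V' \<omega>) = res_form V \<omega>"
  by (auto simp: res_form_def fun_eq_iff)

context cmanifold
begin

lemma hol_formI:
  assumes "\<And>p vs. \<omega> p vs \<noteq> 0 \<Longrightarrow> p \<in> V \<and> length vs = k \<and> set vs \<subseteq> tangent M p"
    "\<And>p vs i v w a. p \<in> V \<Longrightarrow> length vs = k \<Longrightarrow> set vs \<subseteq> tangent M p \<Longrightarrow> i < k \<Longrightarrow> v \<in> tangent M p \<Longrightarrow>
      w \<in> tangent M p \<Longrightarrow> \<omega> p (vs[i := (\<lambda>f. a * v f + w f)]) = a * \<omega> p (vs[i := v]) + \<omega> p (vs[i := w])"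
    "\<And>p vs i j. p \<in> V \<Longrightarrow> length vs = k \<Longrightarrow> set vs \<subseteq> tangent M p \<Longrightarrow> i < j \<Longrightarrow> j < k \<Longrightarrow> vs ! i = vs ! j \<Longrightarrow>
      \<omega> p vs = 0"
    "\<And>D \<phi> ns. (D, \<phi>) \<in> matlas M \<Longrightarrow> length ns = k \<Longrightarrow> set ns \<subseteq> {..<mdim M} \<Longrightarrow>
      holfun M (V \<inter> D) (\<lambda>p. \<omega> p (map (\<lambda>i. coord_vec M (D, \<phi>) i p) ns))"
  shows "\<omega> \<in> hol_form M k V"
proof -
  have alt: "\<omega> p vs = 0" if "p \<in> V" "length vs = k \<and> set vs \<subseteq> tangent M p" "i < k" "j < k" "i \<noteq> j \<and> vs ! i = vs ! j" for p vs i j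
    using assms(3)[of p vs i j] assms(3)[of p vs j i] that by (metis nat_neq_iff)
  show ?thesis unfolding hol_form_def
  proof (intro CollectI conjI allI impI ballI)
    fix p vs assume "\<omega> p vs \<noteq> 0"
    from assms(1)[OF this] show "p \<in> V" "length vs = k" "set vs \<subseteq> tangent M p" by auto
  next
    fix x assume "x \<in> matlas M"
    then show "case x of (D, \<phi>) \<Rightarrow> \<forall>ns. length ns = k \<and> set ns \<subseteq> {..<mdim M} \<longrightarrow>
        holfun M (V \<inter> D) (\<lambda>p. \<omega> p (map (\<lambda>i. coord_vec M (D, \<phi>) i p) ns))"
      using assms(4) by (cases x) auto
  qed (use assms(2) alt in \<open>auto\<close>)
qed

lemma
  assumes "\<omega> \<in> hol_form M k V"
  shows hol_form_support: "\<omega> p vs \<noteq> 0 \<Longrightarrow> p \<in> V \<and> length vs = k \<and> set vs \<subseteq> tangent M p"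
    and hol_form_linear: "p \<in> V \<Longrightarrow> length vs = k \<Longrightarrow> set vs \<subseteq> tangent M p \<Longrightarrow> i < k \<Longrightarrow> v \<in> tangent M p \<Longrightarrow>
      w \<in> tangent M p \<Longrightarrow> \<omega> p (vs[i := (\<lambda>f. a * v f + w f)]) = a * \<omega> p (vs[i := v]) + \<omega> p (vs[i := w])"
    and hol_form_alternating: "p \<in> V \<Longrightarrow> length vs = k \<Longrightarrow> set vs \<subseteq> tangent M p \<Longrightarrow> i < j \<Longrightarrow> j < k \<Longrightarrow> vs ! i = vs ! j \<Longrightarrow>
      \<omega> p vs = 0"
    and hol_form_holfun: "(D, \<phi>) \<in> matlas M \<Longrightarrow> length ns = k \<Longrightarrow> set ns \<subseteq> {..<mdim M} \<Longrightarrow>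
      holfun M (V \<inter> D) (\<lambda>p. \<omega> p (map (\<lambda>i. coord_vec M (D, \<phi>) i p) ns))"
proof -
  note S = assms[unfolded hol_form_def mem_Collect_eq]
  show "p \<in> V \<and> length vs = k \<and> set vs \<subseteq> tangent M p" if "\<omega> p vs \<noteq> 0"
    by (rule S[THEN conjunct1, rule_format, OF that])
  note S2 = S[THEN conjunct2, THEN conjunct1, THEN bspec, THEN spec, THEN mp, OF _ conjI]
  show "\<omega> p (vs[i := (\<lambda>f. a * v f + w f)]) = a * \<omega> p (vs[i := v]) + \<omega> p (vs[i := w])"
    if "p \<in> V" "length vs = k" "set vs \<subseteq> tangent M p" "i < k" "v \<in> tangent M p" "w \<in> tangent M p"
    by (rule S2[OF that(1,2,3), THEN conjunct1, rule_format, OF that(4,5,6)])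
  show "\<omega> p vs = 0"
    if "p \<in> V" "length vs = k" "set vs \<subseteq> tangent M p" "i < j" "j < k" "vs ! i = vs ! j"
    using S2[OF that(1,2,3), THEN conjunct2, rule_format, of i j] that by simp
  show "holfun M (V \<inter> D) (\<lambda>p. \<omega> p (map (\<lambda>i. coord_vec M (D, \<phi>) i p) ns))"
    if "(D, \<phi>) \<in> matlas M" "length ns = k" "set ns \<subseteq> {..<mdim M}"
    using S[THEN conjunct2, THEN conjunct2, rule_format, OF that(1)] that by simp
qed

lemma hol_form_0: "0 \<in> hol_form M k V"
  by (rule hol_formI) (auto intro: holfun_const)

lemma hol_form_add:
  assumes "\<omega> \<in> hol_form M k V" "\<eta> \<in> hol_form M k V"
  shows "\<omega> + \<eta> \<in> hol_form M k V"
proof (rule hol_formI)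
  fix p vs assume "(\<omega> + \<eta>) p vs \<noteq> 0"
  then have "\<omega> p vs \<noteq> 0 \<or> \<eta> p vs \<noteq> 0" by auto
  then show "p \<in> V \<and> length vs = k \<and> set vs \<subseteq> tangent M p"
    using assms hol_form_support by metis
next
  fix p vs i v w a
  assume "p \<in> V" "length vs = k" "set vs \<subseteq> tangent M p" "i < k" "v \<in> tangent M p" "w \<in> tangent M p"
  then show "(\<omega> + \<eta>) p (vs[i := \<lambda>f. a * v f + w f]) = a * (\<omega> + \<eta>) p (vs[i := v]) + (\<omega> + \<eta>) p (vs[i := w])"
    using hol_form_linear[OF assms(1), of p vs i v w a] hol_form_linear[OF assms(2), of p vs i v w a]
    by (simp add: algebra_simps)
next
  fix p vs i j
  assume "p \<in> V" "length vs = k" "set vs \<subseteq> tangent M p" "i < j" "j < k" "vs ! i = vs ! j"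
  then show "(\<omega> + \<eta>) p vs = 0"
    using hol_form_alternating[OF assms(1), of p vs i j] hol_form_alternating[OF assms(2), of p vs i j] by simp
next
  fix D \<phi> ns assume "(D, \<phi>) \<in> matlas M" "length ns = k" "set ns \<subseteq> {..<mdim M}"
  then show "holfun M (V \<inter> D) (\<lambda>p. (\<omega> + \<eta>) p (map (\<lambda>i. coord_vec M (D, \<phi>) i p) ns))"
    using hol_form_holfun[OF assms(1)] hol_form_holfun[OF assms(2)] by (simp add: holfun_add)
qed

lemma hol_form_uminus:
  assumes "\<omega> \<in> hol_form M k V"
  shows "- \<omega> \<in> hol_form M k V"
proof (rule hol_formI)
  fix p vs assume "(- \<omega>) p vs \<noteq> 0"
  then show "p \<in> V \<and> length vs = k \<and> set vs \<subseteq> tangent M p"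
    using hol_form_support[OF assms] by simp
next
  fix p vs i v w a
  assume "p \<in> V" "length vs = k" "set vs \<subseteq> tangent M p" "i < k" "v \<in> tangent M p" "w \<in> tangent M p"
  then show "(- \<omega>) p (vs[i := \<lambda>f. a * v f + w f]) = a * (- \<omega>) p (vs[i := v]) + (- \<omega>) p (vs[i := w])"
    using hol_form_linear[OF assms(1), of p vs i v w a] by simp
next
  fix p vs i j
  assume "p \<in> V" "length vs = k" "set vs \<subseteq> tangent M p" "i < j" "j < k" "vs ! i = vs ! j"
  then show "(- \<omega>) p vs = 0"
    using hol_form_alternating[OF assms(1), of p vs i j] by simp
next
  fix D \<phi> ns assume "(D, \<phi>) \<in> matlas M" "length ns = k" "set ns \<subseteq> {..<mdim M}"
  then show "holfun M (V \<inter> D) (\<lambda>p. (- \<omega>) p (map (\<lambda>i. coord_vec M (D, \<phi>) i p) ns))"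
    using hol_form_holfun[OF assms(1)] by (simp add: holfun_uminus)
qed

lemma hol_form_alt: "\<omega> \<in> hol_form M k V \<Longrightarrow> alt j \<omega> \<in> hol_form M k V"
  by (simp add: alt_def hol_form_uminus)

lemma hol_form_res:
  assumes \<omega>: "\<omega> \<in> hol_form M k V" and sub: "V' \<subseteq> V"
  shows "res_form V' \<omega> \<in> hol_form M k V'"
proof (rule hol_formI)
  fix p vs assume "res_form V' \<omega> p vs \<noteq> 0"
  then show "p \<in> V' \<and> length vs = k \<and> set vs \<subseteq> tangent M p"
    using hol_form_support[OF \<omega>] by (auto simp: res_form_def split: if_splits)
next
  fix p vs i v w a
  assume "p \<in> V'" "length vs = k" "set vs \<subseteq> tangent M p" "i < k" "v \<in> tangent M p" "w \<in> tangent M p"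
  then show "res_form V' \<omega> p (vs[i := \<lambda>f. a * v f + w f]) = a * res_form V' \<omega> p (vs[i := v]) + res_form V' \<omega> p (vs[i := w])"
    using hol_form_linear[OF \<omega>, of p vs i v w a] sub by (auto simp: res_form_def)
next
  fix p vs i j
  assume "p \<in> V'" "length vs = k" "set vs \<subseteq> tangent M p" "i < j" "j < k" "vs ! i = vs ! j"
  then show "res_form V' \<omega> p vs = 0"
    using hol_form_alternating[OF \<omega>, of p vs i j] sub by (auto simp: res_form_def)
next
  fix D \<phi> ns assume c: "(D, \<phi>) \<in> matlas M" "length ns = k" "set ns \<subseteq> {..<mdim M}"
  have "holfun M (V' \<inter> D) (\<lambda>p. \<omega> p (map (\<lambda>i. coord_vec M (D, \<phi>) i p) ns))"
    by (rule holfun_subset[OF hol_form_holfun[OF \<omega> c]]) (use sub in auto)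
  then show "holfun M (V' \<inter> D) (\<lambda>p. res_form V' \<omega> p (map (\<lambda>i. coord_vec M (D, \<phi>) i p) ns))"
    by (rule holfun_cong) (simp add: res_form_def)
qed

lemma res_form_hol_form: "\<omega> \<in> hol_form M k V \<Longrightarrow> res_form V \<omega> = \<omega>"
  using hol_form_support[of \<omega> k V] by (auto simp: res_form_def fun_eq_iff)

lemma hol_form_lincomb:
  fixes m :: nat
  assumes \<omega>: "\<omega> \<in> hol_form M k V" and p: "p \<in> V" and vs: "length vs = k" "set vs \<subseteq> tangent M p" "j < k"
    and e: "\<And>i. i < m \<Longrightarrow> e i \<in> tangent M p"
  shows "(\<lambda>f. \<Sum>i<m. c i * e i f) \<in> tangent M p \<and>
    \<omega> p (vs[j := (\<lambda>f. \<Sum>i<m. c i * e i f)]) = (\<Sum>i<m. c i * \<omega> p (vs[j := e i]))"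
  using e
proof (induction m)
  case 0
  have v: "vs ! j \<in> tangent M p" using vs by auto
  \<comment> \<open>Linearity is available only for combinations \<open>a * v + w\<close>, so the
    zero vector is written as \<open>-v + v\<close>.\<close>
  have "(\<lambda>f. (-1) * (vs ! j) f + (vs ! j) f) \<in> tangent M p" by (rule tangent_combine[OF v v])
  moreover have "\<omega> p (vs[j := (\<lambda>f. (-1) * (vs ! j) f + (vs ! j) f)]) = 0"
    using hol_form_linear[OF \<omega> p vs(1,2,3) v v, of "-1"] by simp
  ultimately show ?case by simp
next
  case (Suc m)
  let ?s = "\<lambda>f. \<Sum>i<m. c i * e i f"
  have IH: "?s \<in> tangent M p" "\<omega> p (vs[j := ?s]) = (\<Sum>i<m. c i * \<omega> p (vs[j := e i]))"
    using Suc by auto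
  have eq: "(\<lambda>f. \<Sum>i<Suc m. c i * e i f) = (\<lambda>f. c m * e m f + ?s f)"
    by (simp add: add.commute)
  have em: "e m \<in> tangent M p" using Suc.prems by simp
  show ?case unfolding eq
    using tangent_combine[OF em IH(1)] hol_form_linear[OF \<omega> p vs em IH(1), of "c m"] IH(2) by simp
qed

text \<open>Expanding all arguments in the coordinate vectors of one chart leaves more arguments
  than coordinate vectors, so two of them coincide. It is used to cut off the sum of the homogeneous
  components of \<open>gamma\<close>.\<close>

lemma hol_form_dim:
  assumes \<omega>: "\<omega> \<in> hol_form M k V" and k: "mdim M < k"
  shows "\<omega> = 0"
proof (rule ccontr)
  assume "\<omega> \<noteq> 0"
  then obtain p vs where nz: "\<omega> p vs \<noteq> 0" by (auto simp: fun_eq_iff)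
  then have p: "p \<in> V" and vs: "length vs = k" "set vs \<subseteq> tangent M p"
    using hol_form_support[OF \<omega>] by auto
  have "vs ! 0 \<in> set vs" by (rule nth_mem) (use k vs in linarith)
  then have "vs ! 0 \<in> tangent M p" using vs by blast
  then obtain D \<phi> where c: "(D, \<phi>) \<in> matlas M" "p \<in> D" unfolding tangent_def by blast
  define e where "e i = coord_vec M (D, \<phi>) i p" for i
  have et: "e i \<in> tangent M p" if "i < mdim M" for i
    using coord_vec_tangent[OF c that] by (simp add: e_def)
  \<comment> \<open>The arguments in \<open>bs\<close> are already coordinate vectors; the induction
    takes the last one of \<open>us\<close>, expands it and moves it over to
    \<open>bs\<close>.\<close>
  have "\<omega> p (us @ bs) = 0"
    if "set us \<subseteq> tangent M p" "set bs \<subseteq> e ` {..<mdim M}" "length us + length bs = k" for us bs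
    using that
  proof (induction us arbitrary: bs rule: rev_induct)
    case Nil
    have "card (set bs) \<le> mdim M"
      using card_mono[OF _ Nil(2)] card_image_le[of "{..<mdim M}" e] by simp
    then have "\<not> distinct bs" using Nil k distinct_card by fastforce
    then obtain i j where "i < j" "j < length bs" "bs ! i = bs ! j"
      unfolding distinct_conv_nth by (metis nat_neq_iff)
    then show ?case
      using hol_form_alternating[OF \<omega> p, of bs i j] Nil et by auto
  next
    case (snoc v us)
    have v: "v \<in> tangent M p" using snoc.prems by simp
    from tangent_chart[OF v c] obtain b where b: "v = (\<lambda>f. \<Sum>i<mdim M. b i * e i f)"
      unfolding e_def by blast
    let ?ws = "us @ v # bs"
    have ws: "length ?ws = k" "set ?ws \<subseteq> tangent M p" "length us < k"
      using snoc.prems et by auto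
    have "\<omega> p (?ws[length us := (\<lambda>f. \<Sum>i<mdim M. b i * e i f)]) = (\<Sum>i<mdim M. b i * \<omega> p (?ws[length us := e i]))"
      using hol_form_lincomb[OF \<omega> p ws, of "mdim M" e b] et by blast
    also have "\<dots> = 0"
    proof (intro sum.neutral ballI)
      fix i assume i: "i \<in> {..<mdim M}"
      have "\<omega> p (us @ e i # bs) = 0"
        by (rule snoc.IH) (use snoc.prems i in auto)
      then show "b i * \<omega> p (?ws[length us := e i]) = 0" by (simp add: list_update_append)
    qed
    finally show ?case by (simp add: b[symmetric] list_update_append)
  qed
  from this[of vs "[]"] vs nz show False by simp
qed

text \<open>Codes of letters: entrywise a matrix of functions, taken as a \<open>0\<close>-form or differentiated.\<close>

definition letter :: "'a \<Rightarrow> (nat \<Rightarrow> nat \<Rightarrow> 'a \<Rightarrow> complex) + (nat \<Rightarrow> nat \<Rightarrow> 'a \<Rightarrow> complex) \<Rightarrow> cmat + ('a tvec \<Rightarrow> cmat)" where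
  "letter p x = (case x of Inl B \<Rightarrow> Inl (\<lambda>i j. B i j p)
     | Inr g \<Rightarrow> Inr (\<lambda>v i j. if v \<in> tangent M p then v (g i j) else 0))"

lemma letter_simps:
  "letter p (Inl B) = Inl (\<lambda>i j. B i j p)"
  "letter p (Inr g) = Inr (\<lambda>v i j. if v \<in> tangent M p then v (g i j) else 0)"
  by (simp_all add: letter_def)

lemma letter_Inr: "Inr G \<in> set (map (letter p) xs) \<Longrightarrow> \<exists>g. G = (\<lambda>v i j. if v \<in> tangent M p then v (g i j) else 0)"
  by (auto simp: letter_def split: sum.splits)

text \<open>On coordinate vectors of one chart each letter contributes holomorphic functions: a
  0-form its entries, a 1-form the partial derivatives of its entries.\<close>

lemma holfun_wprod:
  assumes V: "openin (mtop M) V" and c: "(D, \<phi>) \<in> matlas M" and ns: "set ns \<subseteq> {..<mdim M}"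
    and hol: "\<And>x i j. x \<in> set xs \<Longrightarrow> holfun M V (case x of Inl B \<Rightarrow> B i j | Inr g \<Rightarrow> g i j)"
  shows "holfun M (V \<inter> D) (\<lambda>p. wprod r (map (letter p) xs) (map (\<lambda>i. coord_vec M (D, \<phi>) i p) ns) i j)"
  using ns hol
proof (induction xs arbitrary: ns i j)
  case Nil
  then show ?case by (auto intro: holfun_const)
next
  case (Cons x xs)
  have IH: "holfun M (V \<inter> D) (\<lambda>p. wprod r (map (letter p) xs) (map (\<lambda>i. coord_vec M (D, \<phi>) i p) ns) i j)"
    if "set ns \<subseteq> {..<mdim M}" for ns i j
    by (rule Cons.IH[OF that Cons.prems(2)]) simp
  show ?case
  proof (cases x)
    case (Inl B)
    have B: "holfun M (V \<inter> D) (B i k)" for k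
      using holfun_subset[of V "B i k" "V \<inter> D"] Cons.prems(2)[of x i k] Inl by auto
    show ?thesis unfolding Inl list.map letter_simps wprod.simps mm_def
      by (intro holfun_sum holfun_mult IH Cons.prems B)
  next
    case (Inr g)
    have g: "holfun M (V \<inter> D) (\<lambda>p. coord_vec M (D, \<phi>) l p (g i k))" if "l < mdim M" for k l
      using holfun_coord_vec[OF V _ c that] Cons.prems(2)[of x i k] Inr by auto
    have "holfun M (V \<inter> D) (\<lambda>p. \<Sum>t<length ns. (- 1) ^ t * (\<Sum>k<r. coord_vec M (D, \<phi>) (ns ! t) p (g i k) *
        wprod r (map (letter p) xs) (map (\<lambda>i. coord_vec M (D, \<phi>) i p) (del t ns)) k j))"
    proof (intro holfun_sum holfun_mult holfun_const g IH)
      fix t assume "t \<in> {..<length ns}"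
      then show "ns ! t < mdim M" using Cons.prems(1) by (auto dest: nth_mem)
      show "set (del t ns) \<subseteq> {..<mdim M}" using Cons.prems(1) set_del_subset by fast
    qed
    then show ?thesis
    proof (rule holfun_cong)
      fix p assume p: "p \<in> V \<inter> D"
      have "coord_vec M (D, \<phi>) (ns ! t) p \<in> tangent M p" if "t < length ns" for t
        using coord_vec_tangent[OF c, of p "ns ! t"] p Cons.prems(1) nth_mem[OF that] by auto
      then show "(\<Sum>t<length ns. (- 1) ^ t * (\<Sum>k<r. coord_vec M (D, \<phi>) (ns ! t) p (g i k) *
        wprod r (map (letter p) xs) (map (\<lambda>i. coord_vec M (D, \<phi>) i p) (del t ns)) k j)) =
        wprod r (map (letter p) (x # xs)) (map (\<lambda>i. coord_vec M (D, \<phi>) i p) ns) i j"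
        by (simp add: Inr letter_simps mm_def map_del)
    qed
  qed
qed

lemma trw_hol_form:
  assumes V: "openin (mtop M) V"
    and hol: "\<And>x i j. x \<in> set xs \<Longrightarrow> holfun M V (case x of Inl B \<Rightarrow> B i j | Inr g \<Rightarrow> g i j)"
    and k: "k = length (filter (\<lambda>x. \<not> isl x) xs)"
  shows "(\<lambda>p vs. if p \<in> V then trw r (map (letter p) xs) vs else 0) \<in> hol_form M k V"
proof (rule hol_formI)
  fix p and vs :: "'a tvec list" assume nz: "(if p \<in> V then trw r (map (letter p) xs) vs else 0) \<noteq> 0"
  have isl: "isl (letter p x) = isl x" for x by (cases x) (auto simp: letter_def)
  have "length vs = k"
  proof (rule ccontr)
    assume "length vs \<noteq> k"
    then have "wprod r (map (letter p) xs) vs = (\<lambda>_ _. 0)"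
      by (intro wprod_wrong_length) (simp add: k filter_map isl o_def)
    then show False using nz by (simp add: trw_def split: if_splits)
  qed
  moreover have "v \<in> tangent M p" if v: "v \<in> set vs" for v
  proof (rule ccontr)
    assume "v \<notin> tangent M p"
    then have "wprod r (map (letter p) xs) vs = (\<lambda>_ _. 0)"
    proof (intro wprod_zero_vector[OF v])
      fix G assume "Inr G \<in> set (map (letter p) xs)"
      then obtain g where "G = (\<lambda>v i j. if v \<in> tangent M p then v (g i j) else 0)"
        using letter_Inr by blast
      with \<open>v \<notin> tangent M p\<close> show "G v = (\<lambda>_ _. 0)" by simp
    qed
    then show False using nz by (simp add: trw_def split: if_splits)
  qed
  ultimately show "p \<in> V \<and> length vs = k \<and> set vs \<subseteq> tangent M p"
    using nz by (auto split: if_splits)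
next
  fix p v w a i and vs :: "'a tvec list"
  assume p: "p \<in> V" and vs: "length vs = k" "i < k" and vw: "v \<in> tangent M p" "w \<in> tangent M p"
  have "wprod r (map (letter p) xs) (vs[i := \<lambda>f. a * v f + w f]) l m =
      a * wprod r (map (letter p) xs) (vs[i := v]) l m + wprod r (map (letter p) xs) (vs[i := w]) l m" for l m
  proof (rule wprod_linear)
    fix G l m assume "Inr G \<in> set (map (letter p) xs)"
    then obtain g where "G = (\<lambda>v i j. if v \<in> tangent M p then v (g i j) else 0)"
      using letter_Inr by blast
    then show "G (\<lambda>f. a * v f + w f) l m = a * G v l m + G w l m"
      using vw tangent_combine[OF vw, of a] by simp
  qed (use vs in simp)
  then show "(if p \<in> V then trw r (map (letter p) xs) (vs[i := \<lambda>f. a * v f + w f]) else 0) =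
      a * (if p \<in> V then trw r (map (letter p) xs) (vs[i := v]) else 0) +
      (if p \<in> V then trw r (map (letter p) xs) (vs[i := w]) else 0)"
    by (simp add: trw_def sum.distrib sum_distrib_left)
next
  fix p i j and vs :: "'a tvec list"
  assume "length vs = k" "i < j" "j < k" "vs ! i = vs ! j"
  then show "(if p \<in> V then trw r (map (letter p) xs) vs else 0) = 0"
    using wprod_alternating[of i j vs r] by (simp add: trw_def)
next
  fix D \<phi> ns assume c: "(D, \<phi>) \<in> matlas M" "set ns \<subseteq> {..<mdim M}"
  have "holfun M (V \<inter> D) (\<lambda>p. trw r (map (letter p) xs) (map (\<lambda>i. coord_vec M (D, \<phi>) i p) ns))"
    unfolding trw_def by (intro holfun_sum holfun_wprod[OF V c] hol)
  then show "holfun M (V \<inter> D) (\<lambda>p. if p \<in> V then trw r (map (letter p) xs) (map (\<lambda>i. coord_vec M (D, \<phi>) i p) ns) else 0)"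
    by (rule holfun_cong) simp
qed

end

lemma steps_eq: "steps G w = map (\<lambda>t. Inr (G (w ! Suc t) (w ! t))) (rev [0..<length w - 1])"
proof (induction G w rule: steps.induct)
  case (1 G a b w)
  have "[0..<length (a # b # w) - 1] = 0 # map Suc [0..<length (b # w) - 1]"
    by (simp add: map_Suc_upt upt_conv_Cons del: upt_Suc)
  then show ?case using 1 by (simp add: rev_map del: upt_Suc)
qed auto

text \<open>\<open>mat_inverse\<close> returns a result because \<open>A\<close> is a unit of the
  matrix ring, and inverses are unique.\<close>

lemma mat_inv_eq:
  assumes A: "A \<in> carrier_mat r r" and B: "B \<in> carrier_mat r r" and AB: "A * B = 1\<^sub>m r" "B * A = 1\<^sub>m r"
  shows "mat_inv A = B"
proof -
  have "A \<in> Units (ring_mat TYPE(complex) r ())"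
    using assms unfolding Units_def ring_mat_def by auto
  then obtain C where C: "mat_inverse A = Some C" using mat_inverse(1)[OF A, of "()"] by (cases "mat_inverse A") auto
  then have CA: "C * A = 1\<^sub>m r" "C \<in> carrier_mat r r" using mat_inverse(2)[OF A] by auto
  have "C = C * (A * B)" using CA AB by simp
  also have "\<dots> = (C * A) * B" by (rule assoc_mult_mat[OF CA(2) A B, symmetric])
  also have "\<dots> = B" using CA B by simp
  finally show ?thesis using C by (simp add: mat_inv_def)
qed

section \<open>The map \<open>\<gamma>\<close>\<close>

lemma openin_cap:
  assumes "\<And>i. i \<in> set js \<Longrightarrow> openin X (V i)" "js \<noteq> []"
  shows "openin X (cap V js)"
  unfolding cap_def using assms by (intro openin_Inter) auto

lemma cap_anti: "set js \<subseteq> set js' \<Longrightarrow> cap V js' \<subseteq> cap V js"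
  by (auto simp: cap_def)

lemma cap_brcov: "cap (brcov U) w = cap U (map fst w)"
  by (simp add: cap_def brcov_def case_prod_beta)

text \<open>A repetition contributes the letter \<open>G a a\<close>, which for \<open>gamma\<close>
  is the derivative of a constant.\<close>

lemma not_distinct_adj_steps:
  "\<not> distinct_adj w \<Longrightarrow> \<exists>a\<in>set w. Inr (G a a) \<in> set (steps G w)"
  by (induction G w rule: steps.induct) (auto simp: distinct_adj_Cons)

lemma del_cidx_all: "js \<in> cidx_all J \<Longrightarrow> 2 \<le> length js \<Longrightarrow> t < length js \<Longrightarrow> del t js \<in> cidx_all J"
  using set_del_subset[of t js] length_del[of t js] by (auto simp: cidx_all_iff)

lemma sum_fun_apply: "(\<Sum>t\<in>A. f t) x = (\<Sum>t\<in>A. f t x)"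
  by (induction A rule: infinite_finite_induct) auto

locale cman_cover = cmanifold M for M :: "'a cmfd" +
  fixes I :: "'i set" and U :: "'i \<Rightarrow> 'a set" and r :: nat
  assumes cover_open: "\<And>i. i \<in> I \<Longrightarrow> openin (mtop M) (U i)"
begin

lemma cap_open: "js \<in> cidx_all I \<Longrightarrow> openin (mtop M) (cap U js)"
  using cover_open by (intro openin_cap) (auto simp: cidx_all_iff)

lemma cap_br_open: "w \<in> cidx_all (bridx I n) \<Longrightarrow> openin (mtop M) (cap (brcov U) w)"
  unfolding cap_brcov by (rule cap_open) (auto simp: cidx_all_iff bridx_def)

end

locale cman_map = cman_cover M I U r for M :: "'a cmfd" and I :: "'i set" and U r +
  fixes n :: nat and h :: "('i \<times> nat) list \<Rightarrow> 'a \<Rightarrow> complex mat list"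
  assumes h: "h \<in> simp (CMan M r I U) n"
begin

abbreviation X where "X \<equiv> bridx I n"
abbreviation capb where "capb \<equiv> cap (brcov U)"

lemma h_val:
  assumes "js \<in> cidx_all X" "x \<in> capb js"
  shows "length (h js x) = length js - 1" "set (h js x) \<subseteq> GL r"
proof -
  have "h \<in> (\<Pi>\<^sub>E js\<in>cidx_all X. \<Pi>\<^sub>E x\<in>capb js. {gs. length gs = length js - 1 \<and> set gs \<subseteq> GL r})"
    using h by (simp add: CMan_def)
  from PiE_mem[OF PiE_mem[OF this assms(1)] assms(2)]
  show "length (h js x) = length js - 1" "set (h js x) \<subseteq> GL r" by auto
qed

lemma h_rules:
  assumes "js \<in> cidx X k"
  shows "t < k \<Longrightarrow> a < r \<Longrightarrow> b < r \<Longrightarrow> holfun M (capb js) (\<lambda>x. (h js x ! t) $$ (a, b))"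
    and "x \<in> capb js \<Longrightarrow> j \<le> k \<Longrightarrow> 0 < k \<Longrightarrow> h (del j js) x = bg_face j (h js x)"
    and "x \<in> capb js \<Longrightarrow> j \<le> k \<Longrightarrow> h (dup j js) x = bg_degen r j (h js x)"
proof -
  have "\<forall>k. \<forall>js\<in>cidx X k.
          (\<forall>t<k. \<forall>a<r. \<forall>b<r. holfun M (capb js) (\<lambda>x. (h js x ! t) $$ (a, b))) \<and>
          (\<forall>x\<in>capb js. \<forall>j\<le>k. (k > 0 \<longrightarrow> h (del j js) x = bg_face j (h js x)) \<and>
             h (dup j js) x = bg_degen r j (h js x))"
    using h unfolding CMan_def by simp
  then have R: "(\<forall>t<k. \<forall>a<r. \<forall>b<r. holfun M (capb js) (\<lambda>x. (h js x ! t) $$ (a, b))) \<and>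
          (\<forall>x\<in>capb js. \<forall>j\<le>k. (k > 0 \<longrightarrow> h (del j js) x = bg_face j (h js x)) \<and>
             h (dup j js) x = bg_degen r j (h js x))"
    using assms by blast
  show "t < k \<Longrightarrow> a < r \<Longrightarrow> b < r \<Longrightarrow> holfun M (capb js) (\<lambda>x. (h js x ! t) $$ (a, b))"
    using R by blast
  show "x \<in> capb js \<Longrightarrow> j \<le> k \<Longrightarrow> 0 < k \<Longrightarrow> h (del j js) x = bg_face j (h js x)"
    using R by blast
  show "x \<in> capb js \<Longrightarrow> j \<le> k \<Longrightarrow> h (dup j js) x = bg_degen r j (h js x)"
    using R by blast
qed

lemma h_pair:
  assumes "a \<in> X" "b \<in> X" "x \<in> capb [a, b]"
  shows "h [a, b] x = [comp1 h a b x]" "comp1 h a b x \<in> GL r" "comp1 h a b x \<in> carrier_mat r r"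
proof -
  have "[a, b] \<in> cidx_all X" using assms by (simp add: cidx_all_iff)
  note v = h_val[OF this assms(3)]
  then have "length (h [a, b] x) = 1" by simp
  then obtain g where g: "h [a, b] x = [g]" by (metis length_0_conv length_Suc_conv One_nat_def)
  then show "h [a, b] x = [comp1 h a b x]" "comp1 h a b x \<in> GL r" using v by (auto simp: comp1_def)
  then show "comp1 h a b x \<in> carrier_mat r r" by (simp add: GL_def)
qed

text \<open>The 2-simplex over \<open>[a, b, c]\<close> has the three pairs as its faces, and the
  middle face in \<open>BG\<close> multiplies.\<close>

lemma comp1_cocycle:
  assumes "a \<in> X" "b \<in> X" "c \<in> X" and x: "x \<in> capb [a, b, c]"
  shows "comp1 h a b x * comp1 h b c x = comp1 h a c x"
proof -
  have js: "[a, b, c] \<in> cidx X 2" using assms by (simp add: cidx_def)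
  obtain g1 g2 where g: "h [a, b, c] x = [g1, g2]"
    using h_val(1)[OF cidxD[OF js] x] by (auto simp: length_Suc_conv numeral_2_eq_2)
  have "h [b, c] x = [g2]" using h_rules(2)[OF js x, of 0] g by (simp add: bg_face_def)
  moreover have "h [a, c] x = [g1 * g2]" using h_rules(2)[OF js x, of 1] g by (simp add: bg_face_def)
  moreover have "h [a, b] x = [g1]" using h_rules(2)[OF js x, of 2] g by (simp add: bg_face_def numeral_2_eq_2)
  ultimately show ?thesis by (simp add: comp1_def)
qed

lemma comp1_id:
  assumes "a \<in> X" "x \<in> brcov U a"
  shows "comp1 h a a x = 1\<^sub>m r"
proof -
  have js: "[a] \<in> cidx X 0" using assms by (simp add: cidx_def)
  have x: "x \<in> capb [a]" using assms by (simp add: cap_def)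
  have "h [a] x = []" using h_val(1)[OF cidxD[OF js] x] by simp
  then have "h [a, a] x = [1\<^sub>m r]" using h_rules(3)[OF js x, of 0] by (simp add: bg_degen_def)
  then show ?thesis by (simp add: comp1_def)
qed

lemma comp1_inv:
  assumes "a \<in> X" "b \<in> X" "x \<in> capb [a, b]"
  shows "mat_inv (comp1 h a b x) = comp1 h b a x"
proof (rule mat_inv_eq)
  have x: "x \<in> capb [b, a]" "x \<in> capb [a, b, a]" "x \<in> capb [b, a, b]" "x \<in> brcov U a" "x \<in> brcov U b"
    using assms by (auto simp: cap_def)
  show "comp1 h a b x \<in> carrier_mat r r" "comp1 h b a x \<in> carrier_mat r r"
    using h_pair(3) assms x by blast+
  show "comp1 h a b x * comp1 h b a x = 1\<^sub>m r" "comp1 h b a x * comp1 h a b x = 1\<^sub>m r"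
    using comp1_cocycle[OF assms(1,2,1) x(2)] comp1_cocycle[OF assms(2,1,2) x(3)] comp1_id assms x by simp_all
qed

lemma comp1_hol:
  assumes "a \<in> X" "b \<in> X" "i < r" "j < r"
  shows "holfun M (capb [a, b]) (\<lambda>x. comp1 h a b x $$ (i, j))"
proof -
  have js: "[a, b] \<in> cidx X 1" using assms by (simp add: cidx_def)
  have "holfun M (capb [a, b]) (\<lambda>x. (h [a, b] x ! 0) $$ (i, j))"
    using h_rules(1)[OF js, of 0 i j] assms by simp
  then show ?thesis by (rule holfun_cong) (simp add: h_pair(1)[OF assms(1,2)])
qed

text \<open>The value 0 beyond the size \<open>r\<close> makes holomorphy and the cocycle identity
  hold for all indices \<open>i\<close> and \<open>j\<close>.\<close>

definition E :: "'i \<times> nat \<Rightarrow> 'i \<times> nat \<Rightarrow> nat \<Rightarrow> nat \<Rightarrow> 'a \<Rightarrow> complex" where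
  "E a b i j x = (if i < r \<and> j < r then comp1 h a b x $$ (i, j) else 0)"

definition Hm :: "'a \<Rightarrow> 'i \<times> nat \<Rightarrow> 'i \<times> nat \<Rightarrow> cmat" where
  "Hm p a b = (\<lambda>i j. E a b i j p)"

definition Gm :: "'a \<Rightarrow> 'i \<times> nat \<Rightarrow> 'i \<times> nat \<Rightarrow> 'a tvec \<Rightarrow> cmat" where
  "Gm p a b = (\<lambda>v i j. if v \<in> tangent M p then v (E a b i j) else 0)"

lemma E_hol:
  assumes "a \<in> X" "b \<in> X" shows "holfun M (capb [a, b]) (E a b i j)"
proof (cases "i < r \<and> j < r")
  case True
  then have "E a b i j = (\<lambda>x. comp1 h a b x $$ (i, j))" by (simp add: E_def fun_eq_iff)
  then show ?thesis using comp1_hol[OF assms] True by simp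
next
  case False
  then have "E a b i j = (\<lambda>x. 0)" by (auto simp: E_def fun_eq_iff)
  then show ?thesis by (simp add: holfun_const)
qed

lemma E_cocycle:
  assumes "a \<in> X" "b \<in> X" "c \<in> X" and x: "x \<in> capb [a, b, c]"
  shows "E a c i j x = (\<Sum>k<r. E a b i k x * E b c k j x)"
proof (cases "i < r \<and> j < r")
  case True
  have "comp1 h a b x \<in> carrier_mat r r" "comp1 h b c x \<in> carrier_mat r r"
    using h_pair(3) assms by (auto simp: cap_def)
  then have "(comp1 h a b x * comp1 h b c x) $$ (i, j) = (\<Sum>k<r. comp1 h a b x $$ (i, k) * comp1 h b c x $$ (k, j))"
    using True by (auto simp: scalar_prod_def lessThan_atLeast0 intro!: sum.cong)
  then show ?thesis using True comp1_cocycle[OF assms] by (simp add: E_def)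
qed (auto simp: E_def)

lemma Hm_cocycle:
  assumes "a \<in> X" "b \<in> X" "c \<in> X" "x \<in> capb [a, b, c]"
  shows "mm r (Hm x a b) (Hm x b c) = Hm x a c"
  by (intro ext) (simp add: mm_def Hm_def E_cocycle[OF assms])

text \<open>The cocycle identity differentiated on the triple intersection, which is open, so that a
  tangent vector may replace one side by the other. For other vectors both sides are 0 by
  default.\<close>

lemma Gm_leibniz:
  assumes abc: "a \<in> X" "b \<in> X" "c \<in> X" and p: "p \<in> capb [a, b, c]"
  shows "Gm p a c v = (\<lambda>i j. mm r (Gm p a b v) (Hm p b c) i j + mm r (Hm p a b) (Gm p b c v) i j)"
proof (cases "v \<in> tangent M p")
  case True
  let ?V = "capb [a, b, c]"
  have V: "openin (mtop M) ?V" by (rule cap_br_open[of _ n]) (use abc in \<open>simp add: cidx_all_iff\<close>)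
  have ab: "holfun M ?V (E a b i k)" and bc: "holfun M ?V (E b c i k)" for i k
    using holfun_subset[OF E_hol[OF abc(1,2)]] holfun_subset[OF E_hol[OF abc(2,3)]] cap_anti[of "[a, b]" "[a, b, c]" "brcov U"]
      cap_anti[of "[b, c]" "[a, b, c]" "brcov U"] by auto
  show ?thesis
  proof (intro ext)
    fix i j
    have "v (E a c i j) = v (\<lambda>x. \<Sum>k<r. E a b i k x * E b c k j x)"
      by (rule tangent_cong[OF True V p, symmetric])
        (auto intro!: holfun_sum holfun_mult ab bc simp: E_cocycle[OF abc])
    also have "\<dots> = (\<Sum>k<r. v (\<lambda>x. E a b i k x * E b c k j x))"
      by (rule tangent_sum[OF True V p]) (intro holfun_mult ab bc)
    also have "\<dots> = (\<Sum>k<r. v (E a b i k) * E b c k j p + E a b i k p * v (E b c k j))"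
      by (intro sum.cong refl tangent_mult[OF True V p] ab bc)
    finally show "Gm p a c v i j = mm r (Gm p a b v) (Hm p b c) i j + mm r (Hm p a b) (Gm p b c v) i j"
      using True by (simp add: Gm_def Hm_def mm_def sum.distrib)
  qed
qed (simp add: Gm_def mm_def)

text \<open>On \<open>U_a\<close> the component of \<open>h\<close> at \<open>(a, a)\<close> is
  constantly the identity matrix. Normalization of \<open>gamma\<close> rests on this.\<close>

lemma Gm_self:
  assumes a: "a \<in> X" and p: "p \<in> brcov U a"
  shows "Gm p a a v = (\<lambda>_ _. 0)"
proof (intro ext)
  fix i j
  have V: "openin (mtop M) (capb [a])" "p \<in> capb [a]"
    using cap_br_open[of "[a]" n] a p by (auto simp: cidx_all_iff cap_def)
  have "v (E a a i j) = 0" if v: "v \<in> tangent M p"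
  proof -
    have "v (E a a i j) = v (\<lambda>_. if i < r \<and> j < r \<and> i = j then 1 else 0)"
      by (rule tangent_cong[OF v V, symmetric])
        (use comp1_id[OF a] in \<open>auto simp: E_def cap_def intro: holfun_const\<close>)
    then show ?thesis using tangent_const[OF v V] by simp
  qed
  then show "Gm p a a v i j = 0" by (simp add: Gm_def)
qed

text \<open>The value of \<open>gamma\<close> at a point, with the inverse matrix replaced by the
  component of \<open>h\<close> for the reversed pair, so that it is a word in components of
  \<open>h\<close>.\<close>

definition gtr :: "'a \<Rightarrow> ('i \<times> nat) list \<Rightarrow> 'a tvec list \<Rightarrow> complex" where
  "gtr p w vs = trw r (Inl (Hm p (hd w) (last w)) # steps (Gm p) w) vs"

lemma face_sum_gtr:
  assumes w: "w \<in> cidx_all X" "2 \<le> length w" and p: "p \<in> capb w"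
  shows "face_sum (\<lambda>w. gtr p w vs) w = 0"
  unfolding gtr_def
proof (rule face_sum_trw_steps[where X = "set w"])
  fix a b c v assume "{a, b, c} \<subseteq> set w"
  then have "c \<in> X" "b \<in> X" "a \<in> X" "p \<in> capb [c, b, a]"
    using w p by (auto simp: cidx_all_iff cap_def)
  note * = this
  show "Gm p c a v = (\<lambda>i j. mm r (Gm p c b v) (Hm p b a) i j + mm r (Hm p c b) (Gm p b a v) i j)"
    by (rule Gm_leibniz[OF *])
  show "mm r (Hm p c b) (Hm p b a) = Hm p c a"
    by (rule Hm_cocycle[OF *])
qed (use w in auto)

lemma gtr_not_distinct_adj:
  assumes w: "w \<in> cidx_all X" "\<not> distinct_adj w" and p: "p \<in> capb w"
  shows "gtr p w vs = 0"
proof -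
  obtain a where a: "a \<in> set w" "Inr (Gm p a a) \<in> set (steps (Gm p) w)"
    using not_distinct_adj_steps[OF w(2)] by blast
  have "a \<in> X" "p \<in> brcov U a" using a w p by (auto simp: cidx_all_iff cap_def)
  then have "wprod r (Inl (Hm p (hd w) (last w)) # steps (Gm p) w) vs = (\<lambda>_ _. 0)"
    using a Gm_self by (intro wprod_zero_letter[of "Gm p a a"]) auto
  then show ?thesis by (simp add: gtr_def trw_def)
qed

text \<open>\<open>W\<close> is general because the form attached to a simplex of the nerve lives on a smaller intersection
  than the value of \<open>\<gamma>\<close>.\<close>

lemma mwedges_eq_gtr:
  assumes w: "w \<in> cidx_all X" and p: "p \<in> W" "W \<subseteq> capb w" and N: "N p = r"
    and A: "A p = comp1 h (hd w) (last w) p"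
    and B: "\<And>t v. t < length w - 1 \<Longrightarrow> v \<in> tangent M p \<Longrightarrow> B t p v = dmat r (comp1 h (w ! Suc t) (w ! t)) p v"
  shows "mtrace (mwedges N (mform0 W N A # map (\<lambda>t. mform1 M W N (B t)) (rev [0..<length w - 1])) p vs) = gtr p w vs"
proof -
  let ?Ls = "Inl (Hm p (hd w) (last w)) # steps (Gm p) w"
  let ?\<eta>s = "mform0 W N A # map (\<lambda>t. mform1 M W N (B t)) (rev [0..<length w - 1])"
  have ne: "w \<noteq> []" using w by (simp add: cidx_all_iff)
  have X: "w ! t \<in> X" if "t < length w" for t using w that by (auto simp: cidx_all_iff)
  have carr: "comp1 h (hd w) (last w) p \<in> carrier_mat r r"
    using w p ne by (intro h_pair(3)) (auto simp: cidx_all_iff cap_def)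
  have "represents r (mform0 W N A p) (Inl (Hm p (hd w) (last w)))"
    unfolding represents_def wprod_single_Inl
    using p N A carr by (auto simp: mform0_def wprod_single_Inl Hm_def E_def simp del: wprod.simps)
  moreover have "represents r (mform1 M W N (B t) p) (Inr (Gm p (w ! Suc t) (w ! t)))" if t: "t < length w - 1" for t
    unfolding represents_def
  proof (intro allI conjI impI)
    fix vs
    show "mform1 M W N (B t) p vs \<in> carrier_mat r r"
      using B[OF t] N by (auto simp: mform1_def dmat_def)
    fix i j assume ij: "i < r" "j < r"
    have "E (w ! Suc t) (w ! t) i j = (\<lambda>x. comp1 h (w ! Suc t) (w ! t) x $$ (i, j))"
      using ij by (simp add: E_def fun_eq_iff)
    then show "mform1 M W N (B t) p vs $$ (i, j) = wprod r [Inr (Gm p (w ! Suc t) (w ! t))] vs i j"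
      unfolding wprod_single_Inr[OF ij(2)]
      using B[OF t, of "hd vs"] N ij p by (auto simp: mform1_def dmat_def Gm_def)
  qed
  ultimately have rep: "list_all2 (\<lambda>\<eta> L. represents r (\<eta> p) L) ?\<eta>s ?Ls"
    by (auto simp: steps_eq list.rel_map list_all2_same)
  have "mwedges N ?\<eta>s p vs \<in> carrier_mat r r \<and>
      (\<forall>i<r. \<forall>j<r. mwedges N ?\<eta>s p vs $$ (i, j) = wprod r ?Ls vs i j)"
    by (rule mwedges_eq_wprod[where n = N and p = p and r = r and \<eta>s = "?\<eta>s" and Ls = "?Ls", OF N rep]) simp
  then show ?thesis by (auto simp: mtrace_def gtr_def trw_def intro!: sum.cong)
qed

lemma gtr_single:
  assumes "a \<in> X" "p \<in> brcov U a"
  shows "gtr p [a] vs = (if vs = [] then of_nat r else 0)"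
proof -
  have "E a a i i p = 1" if "i < r" for i using that comp1_id[OF assms] by (simp add: E_def)
  then show ?thesis by (simp add: gtr_def trw_def wprod_single_Inl Hm_def del: wprod.simps)
qed

lemma gamma_apply:
  assumes w: "w \<in> cidx_all X"
  shows "gamma M r I U n h w p vs = (if p \<in> capb w then gtr p w vs else 0)"
proof (cases "length w = 1")
  case True
  then obtain a where a: "w = [a]" by (metis length_0_conv length_Suc_conv One_nat_def)
  then have "a \<in> X" using w by (simp add: cidx_all_iff)
  then show ?thesis using w gtr_single[of a p] by (auto simp: a gamma_def Let_def res_form_def cap_def)
next
  case False
  then have len: "length w - 1 \<noteq> 0" using w by (cases w) (auto simp: cidx_all_iff)
  have ne: "w \<noteq> []" using w by (simp add: cidx_all_iff)
  have "mtrace (mwedges (\<lambda>_. r) (mform0 (capb w) (\<lambda>_. r) (\<lambda>x. mat_inv (comp1 h (w ! (length w - 1)) (w ! 0) x)) #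
      map (\<lambda>t. mform1 M (capb w) (\<lambda>_. r) (dmat r (comp1 h (w ! Suc t) (w ! t)))) (rev [0..<length w - 1])) p vs) = gtr p w vs"
    if p: "p \<in> capb w"
  proof (rule mwedges_eq_gtr[OF w p])
    have "hd w \<in> X" "last w \<in> X" "p \<in> capb [last w, hd w]"
      using w p ne by (auto simp: cidx_all_iff cap_def)
    then show "mat_inv (comp1 h (w ! (length w - 1)) (w ! 0) p) = comp1 h (hd w) (last w) p"
      using comp1_inv ne by (simp add: hd_conv_nth last_conv_nth)
  qed auto
  then show ?thesis using w len by (simp add: gamma_def Let_def tr_form_def res_form_def)
qed

lemma gamma_outside: "w \<notin> cidx_all X \<Longrightarrow> gamma M r I U n h w = 0"
  by (simp add: gamma_def Let_def)

lemma gamma_hol_form: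
  assumes w: "w \<in> cidx_all X"
  shows "gamma M r I U n h w \<in> hol_form M (length w - 1) (capb w)"
proof -
  have ne: "w \<noteq> []" using w by (simp add: cidx_all_iff)
  let ?xs = "Inl (E (hd w) (last w)) # map (\<lambda>t. Inr (E (w ! Suc t) (w ! t))) (rev [0..<length w - 1])"
  have eq: "map (letter p) ?xs = Inl (Hm p (hd w) (last w)) # steps (Gm p) w" for p
    by (simp add: letter_simps steps_eq Hm_def Gm_def)
  have sub: "holfun M (capb w) (E a b i j)" if "a \<in> set w" "b \<in> set w" for a b i j
  proof (rule holfun_subset[OF E_hol])
    show "a \<in> X" "b \<in> X" using w that by (auto simp: cidx_all_iff)
    show "capb w \<subseteq> capb [a, b]" using that by (intro cap_anti) auto
  qed
  have "(\<lambda>p vs. if p \<in> capb w then trw r (map (letter p) ?xs) vs else 0) \<in> hol_form M (length w - 1) (capb w)"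
  proof (rule trw_hol_form[OF cap_br_open[OF w]])
    show "holfun M (capb w) (case x of Inl B \<Rightarrow> B i j | Inr g \<Rightarrow> g i j)" if "x \<in> set ?xs" for x i j
      using that ne by (auto intro!: sub)
  qed (simp add: filter_map o_def)
  moreover have "gamma M r I U n h w = (\<lambda>p vs. if p \<in> capb w then trw r (map (letter p) ?xs) vs else 0)"
    by (intro ext) (simp only: gamma_apply[OF w] gtr_def eq)
  ultimately show ?thesis by simp
qed

lemma gamma_not_distinct_adj:
  assumes "\<not> distinct_adj w" shows "gamma M r I U n h w = 0"
proof (cases "w \<in> cidx_all X")
  case True
  then show ?thesis
    using gtr_not_distinct_adj[OF True assms] by (auto simp: fun_eq_iff gamma_apply[OF True])
qed (rule gamma_outside)

lemma face_sum_gamma: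
  assumes w: "w \<in> cidx_all X" "2 \<le> length w" and p: "p \<in> capb w"
  shows "face_sum (\<lambda>w. gamma M r I U n h w p vs) w = 0"
proof -
  have "face_sum (\<lambda>w. gamma M r I U n h w p vs) w = face_sum (\<lambda>w. gtr p w vs) w"
  proof (rule face_sum_cong)
    fix t assume t: "t < length w"
    have "p \<in> capb (del t w)" using p cap_anti[OF set_del_subset[of t w], of "brcov U"] by (rule subsetD[rotated])
    then show "gamma M r I U n h (del t w) p vs = gtr p (del t w) vs"
      using gamma_apply[OF del_cidx_all[OF w t]] by simp
  qed
  then show ?thesis using face_sum_gtr[OF w p] by simp
qed

lemma gamma_closed: "cech_diff X (brcov U) (gamma M r I U n h) = 0"
proof (intro ext)
  fix js p vs
  show "cech_diff X (brcov U) (gamma M r I U n h) js p vs = 0 js p vs"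
  proof (cases "js \<in> cidx_all X \<and> 2 \<le> length js \<and> p \<in> capb js")
    case True
    then show ?thesis using face_sum_gamma[of js p vs]
      by (simp add: cech_diff_def sum_fun_apply alt_apply res_form_def face_sum_def)
  next
    case False
    then show ?thesis by (auto simp: cech_diff_def sum_fun_apply alt_apply res_form_def)
  qed
qed

lemma gamma_simp: "gamma M r I U n h \<in> simp (cech_even_closed M I U) n"
proof -
  \<comment> \<open>On lists of length \<open>m + 1\<close> the form degree is \<open>m\<close> as
    well, so this piece has total degree \<open>2 * m\<close>.\<close>
  define cs where "cs m = (\<lambda>js. if js \<in> cidx_all X \<and> length js - 1 = m then gamma M r I U n h js else 0)" for m
  have "cs m \<in> gr (cech M X (brcov U)) (2 * m)" for m
  proof -
    have "cs m js \<in> (if q \<le> 2 * m then hol_form M (2 * m - q) (capb js) else {0})" if js: "js \<in> cidx X q" for q js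
    proof (cases "q = m")
      case True
      have "length js - 1 = m" using js True by (simp add: cidx_def)
      then show ?thesis using gamma_hol_form[OF cidxD[OF js]] True cidxD[OF js] by (simp add: cs_def mult_2)
    next
      case False
      then have "cs m js = 0" using js by (auto simp: cs_def cidx_def)
      then show ?thesis by (simp add: hol_form_0)
    qed
    then show ?thesis by (simp add: cech_def cs_def)
  qed
  \<comment> \<open>The sum stops at the dimension of \<open>M\<close>: on longer lists the form
    degree exceeds it and the form is 0.\<close>
  moreover have "gamma M r I U n h = (\<Sum>m<Suc (mdim M). cs m)"
  proof
    fix js
    have "(\<Sum>m<Suc (mdim M). cs m) js = (\<Sum>m<Suc (mdim M). cs m js)"
      by (rule sum_fun_apply)
    also have "\<dots> = (\<Sum>m<Suc (mdim M). if m = length js - 1 then (if js \<in> cidx_all X then gamma M r I U n h js else 0) else 0)"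
      by (rule sum.cong) (auto simp: cs_def)
    also have "\<dots> = (if length js - 1 < Suc (mdim M) \<and> js \<in> cidx_all X then gamma M r I U n h js else 0)"
      by (subst sum.delta) auto
    also have "\<dots> = gamma M r I U n h js"
      using hol_form_dim[OF gamma_hol_form[of js]] gamma_outside[of js] by (cases "js \<in> cidx_all X") auto
    finally show "gamma M r I U n h js = (\<Sum>m<Suc (mdim M). cs m) js" by simp
  qed
  ultimately have "\<exists>K cs. (\<forall>m<K. cs m \<in> gr (cech M X (brcov U)) (2 * m)) \<and> gamma M r I U n h = (\<Sum>m<K. cs m)"
    by (intro exI[of _ "Suc (mdim M)"] exI[of _ cs]) blast
  then show ?thesis using gamma_closed unfolding cech_even_closed_def by simp
qed

end

lemma relabel_cidx_all:
  assumes "js \<in> cidx_all (bridx I k)" "\<rho> \<in> ord_maps k n"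
  shows "relabel \<rho> js \<in> cidx_all (bridx I n)"
proof -
  have "\<rho> ! j \<le> n" if "j \<le> k" for j
  proof -
    have "\<rho> ! j \<in> set \<rho>" by (rule nth_mem) (use assms(2) that in \<open>simp add: ord_maps_def\<close>)
    then show ?thesis using assms(2) by (auto simp: ord_maps_def)
  qed
  then show ?thesis using assms(1) by (auto simp: cidx_all_iff relabel_def bridx_def)
qed

lemma cap_relabel: "cap (brcov U) (relabel \<rho> js) = cap (brcov U) js"
  by (simp add: cap_def brcov_def relabel_def case_prod_beta)

lemma comp1_act:
  assumes "a \<in> bridx I k" "b \<in> bridx I k" "length \<rho> = Suc k"
  shows "comp1 (act (CMan M r I U) \<rho> h) a b = comp1 h (fst a, \<rho> ! snd a) (fst b, \<rho> ! snd b)"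
proof -
  have "[a, b] \<in> cidx_all (bridx I k)" using assms by (simp add: cidx_all_iff)
  then show ?thesis using assms(3) by (simp add: comp1_def CMan_def relabel_def case_prod_beta fun_eq_iff)
qed

lemma gamma_act:
  assumes \<rho>: "\<rho> \<in> ord_maps k n"
  shows "gamma M r I U k (act (CMan M r I U) \<rho> h) = act (cech_even_closed M I U) \<rho> (gamma M r I U n h)"
proof
  fix js
  have len: "length \<rho> = Suc k" using \<rho> by (simp add: ord_maps_def)
  show "gamma M r I U k (act (CMan M r I U) \<rho> h) js = act (cech_even_closed M I U) \<rho> (gamma M r I U n h) js"
  proof (cases "js \<in> cidx_all (bridx I k)")
    case True
    have rl: "relabel \<rho> js \<in> cidx_all (bridx I n)" by (rule relabel_cidx_all[OF True \<rho>])
    have nth: "relabel \<rho> js ! t = (fst (js ! t), \<rho> ! snd (js ! t))" if "t < length js" for t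
      using that by (simp add: relabel_def case_prod_beta)
    have c: "comp1 (act (CMan M r I U) \<rho> h) (js ! s) (js ! t) = comp1 h (relabel \<rho> js ! s) (relabel \<rho> js ! t)"
      if "s < length js" "t < length js" for s t
      using that True len by (subst comp1_act[where k = k and I = I]) (auto simp: nth cidx_all_iff)
    have ll: "length (relabel \<rho> js) = length js" by (simp add: relabel_def)
    have ne: "0 < length js" using True by (simp add: cidx_all_iff)
    have m: "map (\<lambda>t. mform1 M V (\<lambda>_. r) (dmat r (comp1 (act (CMan M r I U) \<rho> h) (js ! Suc t) (js ! t)))) (rev [0..<length js - 1]) =
        map (\<lambda>t. mform1 M V (\<lambda>_. r) (dmat r (comp1 h (relabel \<rho> js ! Suc t) (relabel \<rho> js ! t)))) (rev [0..<length js - 1])" for V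
      by (rule map_cong) (auto simp: c)
    have "gamma M r I U k (act (CMan M r I U) \<rho> h) js = gamma M r I U n h (relabel \<rho> js)"
      using True rl ne unfolding gamma_def Let_def ll cap_relabel m by (simp add: c)
    then show ?thesis using True len by (simp add: cech_even_closed_def cech_act_def)
  next
    case False
    then show ?thesis using len by (simp add: gamma_def Let_def cech_even_closed_def cech_act_def)
  qed
qed

lemma (in cman_cover) gamma_simplicial:
  "simplicial_map (CMan M r I U) (cech_even_closed M I U) (gamma M r I U)"
  unfolding simplicial_map_def
proof (intro allI ballI conjI)
  fix n h assume "h \<in> simp (CMan M r I U) n"
  then interpret cman_map M I U r n h by unfold_locales
  show "gamma M r I U n h \<in> simp (cech_even_closed M I U) n" by (rule gamma_simp)
qed (rule gamma_act)

section \<open>The map \<open>\<iota>\<close>\<close>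

lemma path_sum_in:
  assumes zero: "0 \<in> S" and add: "\<And>a b. a \<in> S \<Longrightarrow> b \<in> S \<Longrightarrow> a + b \<in> S" and minus: "\<And>a. a \<in> S \<Longrightarrow> - a \<in> S"
    and f: "\<And>w. w \<noteq> [] \<Longrightarrow> fst ` set w = set js \<Longrightarrow> snd ` set w = set Ls \<Longrightarrow>
      length w + 1 = length js + length Ls \<Longrightarrow> f w \<in> S"
  shows "path_sum f js Ls \<in> S"
  using f
proof (induction js Ls arbitrary: f rule: path_induct)
  case (Cons x xs a as)
  have alt: "alt j c \<in> S" if "c \<in> S" for j c using that minus by (simp add: alt_def)
  show ?case
  proof (cases "xs = [] \<and> as = []")
    case True
    then show ?thesis using Cons.prems[of "[(x, a)]"] by simp
  next
    case False
    have "path_sum (\<lambda>w. f ((x, a) # w)) xs (a # as) \<in> S"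
      by (rule Cons.IH(1), rule Cons.prems) auto
    moreover have "path_sum (\<lambda>w. f ((x, a) # w)) (x # xs) as \<in> S"
      by (rule Cons.IH(2), rule Cons.prems) auto
    ultimately show ?thesis using False add alt by auto
  qed
qed (simp_all add: zero)

lemma path_sum_0 [simp]: "path_sum 0 js Ls = 0"
proof -
  have "path_sum 0 js Ls = path_sum (\<lambda>_. 0) js Ls" by (rule path_sum_cong) simp
  then show ?thesis by simp
qed

lemma res_form_0 [simp]: "res_form V 0 = 0"
  by (simp add: res_form_def fun_eq_iff)

lemma res_form_add: "res_form V (\<omega> + \<eta>) = res_form V \<omega> + res_form V \<eta>"
  by (simp add: res_form_def fun_eq_iff)

lemma res_form_alt: "res_form V (alt j \<omega>) = alt j (res_form V \<omega>)"
  by (simp add: res_form_def fun_eq_iff alt_apply)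

lemma res_form_path_sum: "res_form V (path_sum f js Ls) = path_sum (\<lambda>w. res_form V (f w)) js Ls"
proof (induction js Ls arbitrary: f rule: path_induct)
  case (Cons x xs a as)
  show ?case by (simp add: Cons res_form_add res_form_alt)
qed auto

text \<open>The exponents \<open>l * (l - 1) div 2\<close> for \<open>l = k + 1\<close> and
  \<open>l = k\<close> differ by \<open>k\<close>. This is the sign by which column faces and row
  faces differ in the boundary formula for closed cochains.\<close>

lemma simplex_sign: "Suc k * k div 2 = k * (k - 1) div 2 + k"
proof -
  have "Suc k * k = k * (k - 1) + 2 * k" by (cases k) (auto simp: algebra_simps)
  then show ?thesis by simp
qed

lemma iota_outside: "js \<notin> cidx_all I \<Longrightarrow> iota I n c J m js = 0"
  by (simp add: iota_def Let_def alt_apply simplex_int_def)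

text \<open>Pulling the cochain back along \<open>J\<close> and summing over rows 0, ..., l is the
  same as summing over rows labelled by the entries of \<open>J\<close>; the pullback thus
  disappears from the formula.\<close>

lemma iota_apply:
  assumes J: "J \<in> nondeg n" and js: "js \<in> cidx_all I"
  shows "iota I n c J m js = alt ((length J - 1) * (length J - 1 - 1) div 2) (path_sum (homog (2 * m) c) js J)"
proof -
  obtain l where l: "length J = Suc l" using J by (cases J) (auto simp: nondeg_def)
  have "path_sum (cech_act I J (homog (2 * m) c)) js [0..<Suc l] =
      path_sum (\<lambda>w. homog (2 * m) c (map (\<lambda>(i, j). (i, J ! j)) w)) js [0..<Suc l]"
  proof (rule path_sum_cong)
    fix w :: "('a \<times> nat) list" assume w: "w \<noteq> []" "fst ` set w = set js" "snd ` set w = set [0..<Suc l]"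
    have "set w \<subseteq> (fst ` set w) \<times> (snd ` set w)" by force
    also have "\<dots> \<subseteq> I \<times> {..l}" unfolding w using js by (auto simp: cidx_all_iff)
    finally have "w \<in> cidx_all (bridx I l)" using w(1) by (simp add: cidx_all_iff bridx_def)
    then show "cech_act I J (homog (2 * m) c) w = homog (2 * m) c (map (\<lambda>(i, j). (i, J ! j)) w)"
      by (simp add: cech_act_def l relabel_def)
  qed
  also have "\<dots> = path_sum (homog (2 * m) c) js (map ((!) J) [0..<Suc l])"
    by (rule path_sum_map)
  also have "map ((!) J) [0..<Suc l] = J" using map_nth[of J] l by simp
  finally show ?thesis
    using J js by (simp add: iota_def Let_def alt_apply simplex_int_eq_path_sum[OF js] l del: upt_Suc)
qed

lemma sum_fun_apply3: "(\<Sum>t\<in>A. f t) x y z = (\<Sum>t\<in>A. f t x y z)"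
  by (induction A rule: infinite_finite_induct) auto

lemma cech_gr_D:
  "c \<in> gr (cech M J V) N \<Longrightarrow> js \<in> cidx J q \<Longrightarrow> c js \<in> (if q \<le> N then hol_form M (N - q) (cap V js) else {0})"
  by (simp add: cech_def split del: if_split)

lemma cech_gr_outside: "c \<in> gr (cech M J V) N \<Longrightarrow> js \<notin> cidx_all J \<Longrightarrow> c js = 0"
  by (simp add: cech_def)

lemma nondeg_del:
  assumes J: "J \<in> nondeg n" and j: "j < length J" and len: "2 \<le> length J"
  shows "del j J \<in> nondeg n"
proof -
  have "sorted_wrt (<) (take j J @ J ! j # drop (Suc j) J)"
    using J unfolding id_take_nth_drop[OF j, symmetric] by (simp add: nondeg_def)
  then have "sorted_wrt (<) (del j J)" by (auto simp: del_def sorted_wrt_append)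
  moreover have "set (del j J) \<subseteq> {..n}" using J set_del_subset[of j J] by (auto simp: nondeg_def)
  moreover have "del j J \<noteq> []" using length_del[OF j] len by auto
  ultimately show ?thesis by (simp add: nondeg_def)
qed

lemma distinct_imp_distinct_adj: "distinct xs \<Longrightarrow> distinct_adj xs"
  by (induction xs) (auto simp: distinct_adj_Cons)

text \<open>The Cech coboundary keeps the form degree and raises the Cech degree by one, so it does
  not mix components of different total degree.\<close>

lemma homog_closed:
  assumes "cech_diff X V c = 0"
  shows "cech_diff X V (homog N c) = 0"
proof (intro ext)
  fix js p vs
  show "cech_diff X V (homog N c) js p vs = 0 js p vs"
  proof (cases "js \<in> cidx_all X \<and> 2 \<le> length js")
    case True
    have "cech_diff X V c js p vs = 0" by (simp add: assms)
    then have 0: "(\<Sum>t<length js. alt t (res_form (cap V js) (c (del t js)) p vs)) = 0"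
      using True by (simp add: cech_diff_def sum_fun_apply alt_apply)
    have "cech_diff X V (homog N c) js p vs = (\<Sum>t<length js. alt t (res_form (cap V js) (homog N c (del t js)) p vs))"
      using True by (simp add: cech_diff_def sum_fun_apply alt_apply)
    also have "\<dots> = (\<Sum>t<length js. if length js - 2 + length vs = N then alt t (res_form (cap V js) (c (del t js)) p vs) else 0)"
      by (rule sum.cong) (auto simp: homog_def res_form_def length_del)
    also have "\<dots> = 0" by (cases "length js - 2 + length vs = N") (simp_all add: 0)
    finally show ?thesis by simp
  qed (auto simp: cech_diff_def)
qed

context cman_cover
begin

text \<open>The pieces of a given decomposition are supported in different total degrees, so
  \<open>homog\<close> recovers them. A decomposition known only to exist is thereby identified with
  the canonical one used in \<open>iota\<close>.\<close>

lemma homog_eq: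
  assumes "c \<in> simp (cech_even_closed M I U) n"
  shows "\<exists>K cs. (\<forall>m<K. cs m \<in> gr (cech M (bridx I n) (brcov U)) (2 * m)) \<and>
    (\<forall>m. homog (2 * m) c = (if m < K then cs m else 0))"
proof -
  obtain K cs where cs: "\<forall>m<K. cs m \<in> gr (cech M (bridx I n) (brcov U)) (2 * m)" and c: "c = (\<Sum>m<(K::nat). cs m)"
    using assms unfolding cech_even_closed_def by auto
  have key: "length js - 1 + length vs = 2 * m" if m: "m < K" and nz: "cs m js p vs \<noteq> 0" for m js p vs
  proof -
    have "cs m js \<noteq> 0" using nz by auto
    have g: "cs m \<in> gr (cech M (bridx I n) (brcov U)) (2 * m)" using cs m by blast
    have "js \<in> cidx_all (bridx I n)" using cech_gr_outside[OF g] \<open>cs m js \<noteq> 0\<close> by blast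
    then have "js \<in> cidx (bridx I n) (length js - 1)" by (cases js) (auto simp: cidx_all_iff cidx_def)
    then have "cs m js \<in> (if length js - 1 \<le> 2 * m then hol_form M (2 * m - (length js - 1)) (cap (brcov U) js) else {0})"
      by (rule cech_gr_D[OF g])
    then have "length js - 1 \<le> 2 * m \<and> cs m js \<in> hol_form M (2 * m - (length js - 1)) (cap (brcov U) js)"
      using \<open>cs m js \<noteq> 0\<close> by (auto split: if_splits)
    moreover from this have "length vs = 2 * m - (length js - 1)"
      using hol_form_support[where \<omega> = "cs m js" and p = p and vs = vs] nz by blast
    ultimately show ?thesis by simp
  qed
  have "homog (2 * m) c = (if m < K then cs m else 0)" for m
  proof (intro ext)
    fix js p vs
    have cv: "c js p vs = (\<Sum>m'<K. cs m' js p vs)" unfolding c by (rule sum_fun_apply3)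
    show "homog (2 * m) c js p vs = (if m < K then cs m else 0) js p vs"
    proof (cases "length js - 1 + length vs = 2 * m")
      case True
      have "(\<Sum>m'<K. cs m' js p vs) = (\<Sum>m'<K. if m' = m then cs m js p vs else 0)"
      proof (intro sum.cong refl)
        fix m' assume "m' \<in> {..<K}"
        then show "cs m' js p vs = (if m' = m then cs m js p vs else 0)"
          using key[of m' js p vs] True by (cases "m' = m") auto
      qed
      then show ?thesis using True by (simp add: homog_def cv)
    next
      case False
      then show ?thesis using key[of m js p vs] by (auto simp: homog_def)
    qed
  qed
  then show ?thesis using cs by blast
qed

context
  fixes n c
  assumes c: "c \<in> simp (cech_even_closed M I U) n"
begin

lemma homog_form:
  assumes w: "w \<in> cidx_all (bridx I n)"
  shows "homog (2 * m) c w \<in> (if length w - 1 \<le> 2 * m then hol_form M (2 * m - (length w - 1)) (cap (brcov U) w) else {0})"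
proof -
  obtain K cs where cs: "\<forall>m<K. cs m \<in> gr (cech M (bridx I n) (brcov U)) (2 * m)"
    "\<forall>m. homog (2 * m) c = (if m < K then cs m else 0)" using homog_eq[OF c] by blast
  have wq: "w \<in> cidx (bridx I n) (length w - 1)" using w by (cases w) (auto simp: cidx_all_iff cidx_def)
  show ?thesis
  proof (cases "m < K")
    case True
    then have "cs m \<in> gr (cech M (bridx I n) (brcov U)) (2 * m)" using cs by blast
    from cech_gr_D[OF this wq] show ?thesis using True cs(2) by (simp split del: if_split)
  next
    case False
    then have "homog (2 * m) c w = 0" using cs(2) by simp
    then show ?thesis by (simp add: hol_form_0)
  qed
qed

lemma homog_finite: "finite {m. homog (2 * m) c \<noteq> 0}"
proof -
  obtain K cs where "\<forall>m. homog (2 * m) c = (if m < K then cs m else 0)" using homog_eq[OF c] by blast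
  then have "{m. homog (2 * m) c \<noteq> 0} \<subseteq> {..<K}" by (auto split: if_splits)
  then show ?thesis by (rule finite_subset) simp
qed

lemma path_cidx:
  assumes "w \<noteq> []" "fst ` set w = set js" "snd ` set w = set J" "js \<in> cidx_all I" "J \<in> nondeg n"
  shows "w \<in> cidx_all (bridx I n)" "cap (brcov U) w = cap U js"
proof -
  have "set w \<subseteq> (fst ` set w) \<times> (snd ` set w)" by force
  also have "\<dots> \<subseteq> I \<times> {..n}" unfolding assms(2,3) using assms(4,5) by (auto simp: cidx_all_iff nondeg_def)
  finally show "w \<in> cidx_all (bridx I n)" using assms(1) by (simp add: cidx_all_iff bridx_def)
  show "cap (brcov U) w = cap U js"
  proof -
    have "cap (brcov U) w = (\<Inter>i\<in>fst ` set w. U i)" by (auto simp: cap_def brcov_def case_prod_beta)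
    then show ?thesis unfolding assms(2) cap_def .
  qed
qed

text \<open>A path through \<open>q + 1\<close> columns and \<open>l + 1\<close> rows has
  \<open>q + l + 1\<close> vertices, so the form on it has degree \<open>2 * m - (l + q)\<close>. At
  \<open>js\<close> the total degree is therefore \<open>2 * m - l\<close>, as required of the
  coefficient of \<open>u^m\<close> in degree \<open>-l\<close>.\<close>

lemma iota_gr:
  assumes J: "J \<in> nondeg n"
  shows "iota I n c J \<in> gr (Qu (cech M I U)) (length J - 1)"
proof -
  define l where "l = length J - 1"
  have lJ: "length J = Suc l" using J by (cases J) (auto simp: l_def nondeg_def)
  have "{m. iota I n c J m \<noteq> 0} \<subseteq> {m. homog (2 * m) c \<noteq> 0}"
  proof safe
    fix m assume nz: "iota I n c J m \<noteq> 0" and 0: "homog (2 * m) c = 0"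
    have "iota I n c J m js = 0" for js
      using iota_outside iota_apply[OF J, of js I c m] 0 by (cases "js \<in> cidx_all I") auto
    then show False using nz by (simp add: fun_eq_iff)
  qed
  then have fin: "finite {m. iota I n c J m \<noteq> 0}" using homog_finite by (rule finite_subset)
  have val: "iota I n c J m js \<in> (if l + q \<le> 2 * m then hol_form M (2 * m - (l + q)) (cap U js) else {0})"
    if js: "js \<in> cidx I q" for m js q
  proof -
    let ?S = "if l + q \<le> 2 * m then hol_form M (2 * m - (l + q)) (cap U js) else {0}"
    have "path_sum (homog (2 * m) c) js J \<in> ?S"
    proof (rule path_sum_in)
      fix w :: "('i \<times> nat) list"
      assume w: "w \<noteq> []" "fst ` set w = set js" "snd ` set w = set J" "length w + 1 = length js + length J"
      have *: "length w - 1 = l + q" using w js lJ by (simp add: cidx_def)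
      show "homog (2 * m) c w \<in> ?S"
        using homog_form[OF path_cidx(1)[OF w(1-3) cidxD[OF js] J], of m, unfolded *]
        unfolding path_cidx(2)[OF w(1-3) cidxD[OF js] J] .
    qed (auto intro: hol_form_0 hol_form_add hol_form_uminus)
    moreover have "alt j x \<in> ?S" if "x \<in> ?S" for j x using that by (auto intro: hol_form_alt)
    ultimately show ?thesis unfolding iota_apply[OF J cidxD[OF js]] by blast
  qed
  have "iota I n c J m \<in> (if l \<le> 2 * m then gr (cech M I U) (2 * m - l) else {0})" for m
  proof (cases "l \<le> 2 * m")
    case True
    have "iota I n c J m js \<in> (if q \<le> 2 * m - l then hol_form M (2 * m - l - q) (cap U js) else {0})"
      if js: "js \<in> cidx I q" for js q
    proof -
      have *: "(q \<le> 2 * m - l) = (l + q \<le> 2 * m)" "2 * m - l - q = 2 * m - (l + q)" using True by auto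
      show ?thesis using val[OF js, of m] unfolding * .
    qed
    then show ?thesis using True iota_outside[where I = I and n = n and c = c and J = J and m = m] by (simp add: cech_def)
  next
    case False
    have "iota I n c J m js = 0" for js
    proof (cases "js \<in> cidx_all I")
      case True
      then have "js \<in> cidx I (length js - 1)" by (cases js) (auto simp: cidx_all_iff cidx_def)
      from val[OF this, of m] show ?thesis using False by simp
    qed (rule iota_outside)
    then show ?thesis using False by (simp add: fun_eq_iff)
  qed
  then have "\<forall>m. iota I n c J m \<in> (if length J - 1 \<le> 2 * m then gr (cech M I U) (2 * m - (length J - 1)) else {0})"
    unfolding l_def by blast
  then show ?thesis using fin unfolding Qu_def cplx.select_convs mem_Collect_eq by blast
qed

text \<open>The boundary formula is applied to a homogeneous component restricted to
  \<open>cap U js\<close>. Every path visits all of \<open>js\<close>, so its own intersection is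
  \<open>cap U js\<close> and closedness makes the left side 0. The column faces \<open>A\<close>
  form the Cech differential, the row faces \<open>B\<close> the boundary of the generator, and the
  prefactors absorb the remaining sign.\<close>

lemma iota_diff:
  assumes J: "J \<in> nondeg n" and len: "2 \<le> length J"
  shows "df (Qu (cech M I U)) (length J - 1) (iota I n c J) = (\<Sum>j<length J. alt j (iota I n c (del j J)))"
proof (intro ext)
  fix m js p vs
  obtain k where k: "length J = Suc (Suc k)" using len by (metis Suc_le_D numeral_2_eq_2 Suc_le_mono)
  have dJ: "del j J \<in> nondeg n" "length (del j J) = Suc k" if j: "j < length J" for j
  proof -
    show "length (del j J) = Suc k" using length_del[OF j] k by simp
    show "del j J \<in> nondeg n" by (rule nondeg_del[OF J j len])
  qed
  have L: "df (Qu (cech M I U)) (length J - 1) (iota I n c J) m js = cech_diff I U (iota I n c J m) js"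
    using k by (simp add: Qu_def cech_def)
  have R: "(\<Sum>j<length J. alt j (iota I n c (del j J))) m js = (\<Sum>j<length J. alt j (iota I n c (del j J) m js))"
    by (simp add: sum_fun_apply alt_apply)
  have "cech_diff I U (iota I n c J m) js = (\<Sum>j<length J. alt j (iota I n c (del j J) m js))"
  proof (cases "js \<in> cidx_all I")
    case False
    then show ?thesis by (simp add: cech_diff_def iota_outside)
  next
    case js: True
    define f where "f w = res_form (cap U js) (homog (2 * m) c w)" for w
    define A where "A = face_sum (\<lambda>ys. path_sum f ys J) js"
    define B where "B = face_sum (path_sum f js) J"
    have ne: "js \<noteq> []" using js by (simp add: cidx_all_iff)
    have LA: "cech_diff I U (iota I n c J m) js = alt (Suc k * k div 2) A"
    proof (cases "2 \<le> length js")
      case True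
      have "cech_diff I U (iota I n c J m) js = (\<Sum>t<length js. alt t (alt (Suc k * k div 2) (path_sum f (del t js) J)))"
      proof -
        have "res_form (cap U js) (iota I n c J m (del t js)) = alt (Suc k * k div 2) (path_sum f (del t js) J)"
          if t: "t < length js" for t
        proof -
          have "del t js \<in> cidx_all I"
            using js True length_del[OF t] set_del_subset[of t js] by (auto simp: cidx_all_iff)
          from iota_apply[OF J this, of c m] show ?thesis
            by (simp add: k res_form_alt res_form_path_sum f_def[abs_def])
        qed
        then show ?thesis using js True by (simp add: cech_diff_def)
      qed
      then show ?thesis by (simp add: A_def face_sum_def alt_sum alt_alt add.commute)
    next
      case False
      \<comment> \<open>On a one-element list \<open>cech_diff\<close> is 0 by default; so is
        \<open>A\<close>, a path sum over an empty list.\<close>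
      then obtain x where "js = [x]" using ne by (cases js) (auto simp: not_le)
      then show ?thesis by (simp add: cech_diff_def A_def face_sum_Cons)
    qed
    have RB: "(\<Sum>j<length J. alt j (iota I n c (del j J) m js)) = alt (k * (k - 1) div 2) B"
    proof -
      have "iota I n c (del j J) m js = alt (k * (k - 1) div 2) (path_sum f js (del j J))" if j: "j < length J" for j
      proof -
        have "path_sum (homog (2 * m) c) js (del j J) = path_sum f js (del j J)"
        proof (rule path_sum_cong)
          fix w :: "('i \<times> nat) list" assume w: "w \<noteq> []" "fst ` set w = set js" "snd ` set w = set (del j J)"
          note pc = path_cidx[OF w js dJ(1)[OF j]]
          show "homog (2 * m) c w = f w"
            using homog_form[OF pc(1), of m] res_form_hol_form pc(2) by (auto simp: f_def split: if_splits)
        qed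
        then show ?thesis using iota_apply[OF dJ(1)[OF j] js, of c m] dJ(2)[OF j] by simp
      qed
      then show ?thesis by (simp add: B_def face_sum_def alt_sum alt_alt add.commute)
    qed
    have "path_sum (face_sum f) js J = alt (length J - 1) A + B"
      unfolding A_def B_def by (rule path_sum_face_sum) (use ne k in \<open>auto simp: Suc_le_eq\<close>)
    moreover have "path_sum (face_sum f) js J = path_sum (\<lambda>_. 0) js J"
    proof (rule path_sum_cong)
      fix w :: "('i \<times> nat) list"
      assume w: "w \<noteq> []" "fst ` set w = set js" "snd ` set w = set J" "length w + 1 = length js + length J"
      note pc = path_cidx[OF w(1-3) js J]
      have "cech_diff (bridx I n) (brcov U) c = 0" using c by (simp add: cech_even_closed_def)
      from homog_closed[OF this, of "2 * m"]
      have "cech_diff (bridx I n) (brcov U) (homog (2 * m) c) w = 0" by simp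
      moreover have "2 \<le> length w" using w k ne by (cases js) auto
      ultimately show "face_sum f w = 0"
        using pc by (simp add: cech_diff_def face_sum_def f_def)
    qed
    ultimately have "B = - alt (Suc k) A" using k by (simp add: eq_neg_iff_add_eq_0 add.commute)
    then have B: "B = alt k A" by simp
    show ?thesis unfolding LA RB B alt_alt simplex_sign ..
  qed
  then show "df (Qu (cech M I U)) (length J - 1) (iota I n c J) m js p vs = (\<Sum>j<length J. alt j (iota I n c (del j J))) m js p vs"
    unfolding L R by simp
qed

lemma iota_simp: "iota I n c \<in> simp (DK (Qu (cech M I U))) n"
proof -
  have "iota I n c J = 0" if "J \<notin> nondeg n" for J
    using that by (simp add: iota_def Let_def fun_eq_iff)
  then show ?thesis using iota_gr iota_diff by (simp add: DK_def)
qed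

end

lemma sorted_distinct_adj: "sorted xs \<Longrightarrow> distinct_adj xs \<Longrightarrow> sorted_wrt (<) (xs :: nat list)"
proof (induction xs)
  case (Cons x xs)
  then have IH: "sorted_wrt (<) xs" by (auto simp: distinct_adj_Cons)
  show ?case
  proof (cases xs)
    case (Cons y ys)
    then have "x < y" using Cons.prems by (auto simp: distinct_adj_Cons)
    then show ?thesis using IH Cons by auto
  qed simp
qed simp

lemma pick_sorted:
  assumes "\<rho> \<in> ord_maps k n" "J \<in> nondeg k"
  shows "sorted (pick \<rho> J)" "set (pick \<rho> J) \<subseteq> {..n}" "pick \<rho> J \<noteq> []" "length (pick \<rho> J) = length J"
proof -
  have lt: "j < length \<rho>" if "j \<in> set J" for j
    using assms that by (auto simp: ord_maps_def nondeg_def)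
  show "set (pick \<rho> J) \<subseteq> {..n}"
    using assms(1) nth_mem[OF lt] by (fastforce simp: pick_def ord_maps_def)
  have "sorted \<rho>" using assms by (simp add: ord_maps_def)
  have "sorted_wrt (\<lambda>x y. \<rho> ! x \<le> \<rho> ! y) J"
  proof (rule sorted_wrt_mono_rel[of J "(<)"])
    show "sorted_wrt (<) J" using assms by (simp add: nondeg_def)
    show "\<rho> ! x \<le> \<rho> ! y" if "x \<in> set J" "y \<in> set J" "x < y" for x y
      using sorted_nth_mono[OF \<open>sorted \<rho>\<close>, of x y] lt that by simp
  qed
  then show "sorted (pick \<rho> J)" by (simp add: pick_def sorted_wrt_map)
  show "pick \<rho> J \<noteq> []" using assms by (simp add: pick_def nondeg_def)
qed (simp add: pick_def)

lemma pick_nondeg: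
  assumes "\<rho> \<in> ord_maps k n" "J \<in> nondeg k"
  shows "distinct_adj (pick \<rho> J) \<longleftrightarrow> distinct (pick \<rho> J)" "distinct (pick \<rho> J) \<Longrightarrow> pick \<rho> J \<in> nondeg n"
proof -
  note p = pick_sorted[OF assms]
  show "distinct_adj (pick \<rho> J) \<longleftrightarrow> distinct (pick \<rho> J)"
    using sorted_distinct_adj[OF p(1)] by (auto simp: strict_sorted_iff distinct_imp_distinct_adj)
  show "distinct (pick \<rho> J) \<Longrightarrow> pick \<rho> J \<in> nondeg n"
    using p by (auto simp: nondeg_def strict_sorted_iff)
qed

text \<open>If \<open>\<rho>\<close> identifies vertices of \<open>J\<close>, the right side is 0 by
  definition of the action, and the path sum on the left has to vanish: every path steps between two
  equal rows, where \<open>gamma\<close> is 0.\<close>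

lemma iota_gamma_act:
  assumes h: "h \<in> simp (CMan M r I U) n" and \<rho>: "\<rho> \<in> ord_maps k n"
  shows "iota I k (gamma M r I U k (act (CMan M r I U) \<rho> h)) = act (DK (Qu (cech M I U))) \<rho> (iota I n (gamma M r I U n h))"
proof -
  interpret cman_map M I U r n h using h by unfold_locales
  let ?c = "gamma M r I U n h"
  have len: "length \<rho> = Suc k" using \<rho> by (simp add: ord_maps_def)
  show ?thesis
  proof (intro ext)
    fix J m js p vs
    have "iota I k (act (cech_even_closed M I U) \<rho> ?c) J m js =
        (if J \<in> nondeg k \<and> distinct (pick \<rho> J) then iota I n ?c (pick \<rho> J) else 0) m js"
    proof (cases "J \<in> nondeg k \<and> js \<in> cidx_all I")
      case False
      then show ?thesis by (auto simp: iota_outside) (auto simp: iota_def Let_def)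
    next
      case True
      then have J: "J \<in> nondeg k" and js: "js \<in> cidx_all I" by auto
      have "path_sum (homog (2 * m) (act (cech_even_closed M I U) \<rho> ?c)) js J =
          path_sum (\<lambda>w. homog (2 * m) ?c (map (\<lambda>(i, j). (i, \<rho> ! j)) w)) js J"
      proof (rule path_sum_cong)
        fix w :: "('i \<times> nat) list" assume w: "w \<noteq> []" "fst ` set w = set js" "snd ` set w = set J"
        have "set w \<subseteq> (fst ` set w) \<times> (snd ` set w)" by force
        also have "\<dots> \<subseteq> I \<times> {..k}" unfolding w using js J by (auto simp: cidx_all_iff nondeg_def)
        finally have "w \<in> cidx_all (bridx I k)" using w(1) by (simp add: cidx_all_iff bridx_def)
        then have e: "act (cech_even_closed M I U) \<rho> ?c w = ?c (map (\<lambda>(i, j). (i, \<rho> ! j)) w)"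
          by (simp add: cech_even_closed_def cech_act_def len relabel_def)
        show "homog (2 * m) (act (cech_even_closed M I U) \<rho> ?c) w = homog (2 * m) ?c (map (\<lambda>(i, j). (i, \<rho> ! j)) w)"
          unfolding homog_def e length_map ..
      qed
      also have "\<dots> = path_sum (homog (2 * m) ?c) js (pick \<rho> J)"
        unfolding pick_def by (rule path_sum_map)
      finally have eq: "iota I k (act (cech_even_closed M I U) \<rho> ?c) J m js =
          alt ((length J - 1) * (length J - 1 - 1) div 2) (path_sum (homog (2 * m) ?c) js (pick \<rho> J))"
        using iota_apply[OF J js, of "act (cech_even_closed M I U) \<rho> ?c" m] by simp
      show ?thesis
      proof (cases "distinct (pick \<rho> J)")
        case True
        then show ?thesis
          using eq J iota_apply[OF pick_nondeg(2)[OF \<rho> J True] js, of ?c m] pick_sorted(4)[OF \<rho> J] by simp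
      next
        case False
        have "path_sum (homog (2 * m) ?c) js (pick \<rho> J) = 0"
        proof (rule path_sum_not_distinct_adj)
          show "\<not> distinct_adj (pick \<rho> J)" using False pick_nondeg(1)[OF \<rho> J] by simp
          show "homog (2 * m) ?c w = 0" if "\<not> distinct_adj w" for w
            using gamma_not_distinct_adj[OF that] by (simp add: homog_def fun_eq_iff)
        qed
        then show ?thesis using eq False by simp
      qed
    qed
    then show "iota I k (gamma M r I U k (act (CMan M r I U) \<rho> h)) J m js p vs =
        act (DK (Qu (cech M I U))) \<rho> (iota I n ?c) J m js p vs"
      unfolding gamma_act[OF \<rho>] by (simp add: DK_def len)
  qed
qed

lemma iota_gamma_simplicial:
  "simplicial_map (CMan M r I U) (DK (Qu (cech M I U))) (\<lambda>n. iota I n \<circ> gamma M r I U n)"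
  unfolding simplicial_map_def o_def
proof (intro allI ballI conjI)
  fix n h assume h: "h \<in> simp (CMan M r I U) n"
  have "gamma M r I U n h \<in> simp (cech_even_closed M I U) n"
    using gamma_simplicial h unfolding simplicial_map_def by blast
  then show "iota I n (gamma M r I U n h) \<in> simp (DK (Qu (cech M I U))) n" by (rule iota_simp)
qed (rule iota_gamma_act)

end

section \<open>The map \<open>\<beta>\<close>\<close>

lemma prism_iff: "(a, b) \<in> prism l n \<longleftrightarrow> (\<exists>k. a \<in> ord_maps k l \<and> b \<in> ord_maps k n)"
  by (auto simp: prism_def prod_sset_def std_simplex_def)

lemma pick_ord_maps:
  assumes a: "a \<in> ord_maps k l" and \<rho>: "\<rho> \<in> ord_maps m k"
  shows "pick a \<rho> \<in> ord_maps m l"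
proof -
  have lt: "t < length a" if "t \<in> set \<rho>" for t using a \<rho> that by (auto simp: ord_maps_def)
  have "sorted a" using a by (simp add: ord_maps_def)
  have "sorted_wrt (\<lambda>x y. a ! x \<le> a ! y) \<rho>"
  proof (rule sorted_wrt_mono_rel[of \<rho> "(\<le>)"])
    show "sorted \<rho>" using \<rho> by (simp add: ord_maps_def)
    show "a ! x \<le> a ! y" if "x \<in> set \<rho>" "y \<in> set \<rho>" "x \<le> y" for x y
      using sorted_nth_mono[OF \<open>sorted a\<close> that(3)] lt that by simp
  qed
  moreover have "a ! t \<in> {..l}" if "t \<in> set \<rho>" for t
    using nth_mem[OF lt[OF that]] a by (auto simp: ord_maps_def)
  ultimately show ?thesis using \<rho> by (auto simp: ord_maps_def pick_def sorted_wrt_map)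
qed

lemma pick_nth: "t < length \<rho> \<Longrightarrow> pick a \<rho> ! t = a ! (\<rho> ! t)"
  by (simp add: pick_def)

lemma length_pick [simp]: "length (pick a \<rho>) = length \<rho>"
  by (simp add: pick_def)

lemma ord_maps_nth: "\<rho> \<in> ord_maps k m \<Longrightarrow> t \<le> k \<Longrightarrow> \<rho> ! t \<le> m"
  using nth_mem[of t \<rho>] by (auto simp: ord_maps_def simp del: nth_mem)

lemma pick_cidx: "js \<in> cidx I m \<Longrightarrow> \<rho> \<in> ord_maps k m \<Longrightarrow> pick js \<rho> \<in> cidx I k"
  by (auto simp: cidx_def pick_def ord_maps_def subset_iff less_Suc_eq_le)

lemma cap_pick: "js \<in> cidx I m \<Longrightarrow> \<rho> \<in> ord_maps k m \<Longrightarrow> cap U js \<subseteq> cap U (pick js \<rho>)"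
  by (rule cap_anti) (auto simp: cidx_def pick_def ord_maps_def subset_iff less_Suc_eq_le)

lemma mult_mat_vec_index:
  fixes A :: "complex mat"
  assumes "A \<in> carrier_mat r r" "v \<in> carrier_vec r" "i < r"
  shows "vec_index (A *\<^sub>v v) i = (\<Sum>j<r. A $$ (i, j) * vec_index v j)"
  using assms by (auto simp: scalar_prod_def lessThan_atLeast0 intro!: sum.cong)

section \<open>The product bundle with its standard connection\<close>

lemma product_rank: "vb_rank (product_vbc M r W) = (\<lambda>x\<in>W. r)"
  by (simp add: product_vbc_def Let_def)

lemma product_sec: "vb_sec (product_vbc M r W) V = (if V \<in> opens_in M W
    then {s \<in> (\<Pi>\<^sub>E x\<in>V. carrier_vec r). \<forall>i<r. holfun M V (\<lambda>x. vec_index (s x) i)} else {})"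
  by (simp add: product_vbc_def Let_def)

lemma product_conn: "vb_conn (product_vbc M r W) V s = (if s \<in> vb_sec (product_vbc M r W) V
    then (\<lambda>p\<in>V. \<lambda>v\<in>tangent M p. vec r (\<lambda>i. v (\<lambda>x. vec_index (s x) i))) else undefined)"
  by (simp add: product_vbc_def Let_def)

text \<open>Compatibility with the cosimplicial maps in \<open>Tot\<close> is literal equality of
  records, so restriction must return the very same product bundle, default values included.\<close>

lemma res_product:
  assumes "W \<subseteq> W'"
  shows "res_vbc W (product_vbc M r W') = product_vbc M r W"
proof -
  have sec: "vb_sec (res_vbc W (product_vbc M r W')) = vb_sec (product_vbc M r W)"
    using assms by (intro ext) (auto simp: res_vbc_def product_sec opens_in_def)
  have "vb_conn (res_vbc W (product_vbc M r W')) V s = vb_conn (product_vbc M r W) V s" for V s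
  proof (cases "V \<subseteq> W")
    case True
    then have "vb_sec (product_vbc M r W') V = vb_sec (product_vbc M r W) V"
      using assms by (auto simp: product_sec opens_in_def)
    then show ?thesis using True by (simp add: res_vbc_def product_conn)
  next
    case False
    then show ?thesis by (simp add: res_vbc_def product_conn product_sec opens_in_def)
  qed
  moreover have "vb_rank (res_vbc W (product_vbc M r W')) = vb_rank (product_vbc M r W)"
    using assms by (auto simp: res_vbc_def product_rank fun_eq_iff)
  ultimately show ?thesis using sec by (intro vbc.equality ext) auto
qed

context cmanifold
begin

lemma opens_inD: "V \<in> opens_in M W \<Longrightarrow> openin (mtop M) V \<and> V \<subseteq> W"
  by (simp add: opens_in_def)

lemma product_secI:
  assumes "V \<in> opens_in M W" "s \<in> (\<Pi>\<^sub>E x\<in>V. carrier_vec r)" "\<And>i. i < r \<Longrightarrow> holfun M V (\<lambda>x. vec_index (s x) i)"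
  shows "s \<in> vb_sec (product_vbc M r W) V"
  using assms by (simp add: product_sec)

lemma product_secD:
  assumes "s \<in> vb_sec (product_vbc M r W) V"
  shows "V \<in> opens_in M W" "s \<in> (\<Pi>\<^sub>E x\<in>V. carrier_vec r)" "i < r \<Longrightarrow> holfun M V (\<lambda>x. vec_index (s x) i)"
    "x \<in> V \<Longrightarrow> s x \<in> carrier_vec r"
  using assms by (auto simp: product_sec split: if_splits)

lemma product_sec_dim: "s \<in> vb_sec (product_vbc M r W) V \<Longrightarrow> x \<in> V \<Longrightarrow> dim_vec (s x) = r"
  using product_secD(4) carrier_vecD by blast

lemma set_sections_product:
  assumes "V \<subseteq> W" shows "set_sections (product_vbc M r W) V = (\<Pi>\<^sub>E x\<in>V. carrier_vec r)"
  using assms unfolding set_sections_def product_rank by (intro PiE_cong) auto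

lemma GL_one: "1\<^sub>m r \<in> GL r"
  unfolding GL_def invertible_mat_def inverts_mat_def by (auto intro!: exI[of _ "1\<^sub>m r"])

text \<open>The constant identity matrix is a frame over all of \<open>W\<close>; the gluing
  condition for sections is the locality of holomorphy.\<close>

lemma product_is_vb:
  assumes W: "openin (mtop M) W"
  shows "is_vb M W (product_vbc M r W)"
  unfolding is_vb_def
proof (intro conjI allI impI ballI)
  show "vb_rank (product_vbc M r W) \<in> extensional W" by (simp add: product_rank)
  show "vb_sec (product_vbc M r W) V = {}" if "V \<notin> opens_in M W" for V
    using that by (simp add: product_sec)
next
  fix V s assume V: "V \<in> opens_in M W" and s: "s \<in> set_sections (product_vbc M r W) V"
  have VW: "openin (mtop M) V" "V \<subseteq> W" using opens_inD[OF V] by auto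
  have s': "s \<in> (\<Pi>\<^sub>E x\<in>V. carrier_vec r)" using s set_sections_product[OF VW(2)] by simp
  show "s \<in> vb_sec (product_vbc M r W) V \<longleftrightarrow>
      (\<forall>p\<in>V. \<exists>V'\<in>opens_in M V. p \<in> V' \<and> restrict s V' \<in> vb_sec (product_vbc M r W) V')"
  proof
    assume a: "s \<in> vb_sec (product_vbc M r W) V"
    have "restrict s V = s" using s' by (simp add: PiE_def extensional_restrict)
    moreover have "V \<in> opens_in M V" using VW by (simp add: opens_in_def)
    ultimately show "\<forall>p\<in>V. \<exists>V'\<in>opens_in M V. p \<in> V' \<and> restrict s V' \<in> vb_sec (product_vbc M r W) V'"
      using a by (intro ballI bexI[of _ V]) auto
  next
    assume a: "\<forall>p\<in>V. \<exists>V'\<in>opens_in M V. p \<in> V' \<and> restrict s V' \<in> vb_sec (product_vbc M r W) V'"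
    show "s \<in> vb_sec (product_vbc M r W) V"
    proof (rule product_secI[OF V s'])
      fix i assume i: "i < r"
      show "holfun M V (\<lambda>x. vec_index (s x) i)"
      proof (rule holfun_local)
        fix p assume "p \<in> V"
        then obtain V' where V': "V' \<in> opens_in M V" "p \<in> V'" "restrict s V' \<in> vb_sec (product_vbc M r W) V'"
          using a by blast
        have "holfun M V' (\<lambda>x. vec_index (s x) i)"
          by (rule holfun_cong[OF product_secD(3)[OF V'(3) i]]) simp
        then show "\<exists>V'. openin (mtop M) V' \<and> p \<in> V' \<and> V' \<subseteq> V \<and> holfun M V' (\<lambda>x. vec_index (s x) i)"
          using opens_inD[OF V'(1)] V'(2) by (intro exI[of _ V']) simp
      qed
    qed
  qed
next
  fix p assume p: "p \<in> W"
  have one: "mat_inv (1\<^sub>m r :: complex mat) = 1\<^sub>m r" by (rule mat_inv_eq) auto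
  have "vb_sec (product_vbc M r W) V' =
      {s \<in> set_sections (product_vbc M r W) V'. \<forall>i<r. holfun M V' (\<lambda>x. vec_index (mat_inv (1\<^sub>m r) *\<^sub>v s x) i)}"
    if V': "V' \<in> opens_in M W" for V'
  proof -
    have V'W: "V' \<subseteq> W" using opens_inD[OF V'] by simp
    have "holfun M V' (\<lambda>x. vec_index (s x) i) \<longleftrightarrow> holfun M V' (\<lambda>x. vec_index (mat_inv (1\<^sub>m r) *\<^sub>v s x) i)"
      if "s \<in> (\<Pi>\<^sub>E x\<in>V'. carrier_vec r)" for s i
    proof -
      have e: "1\<^sub>m r *\<^sub>v s x = s x" if "x \<in> V'" for x
        using PiE_mem[OF \<open>s \<in> (\<Pi>\<^sub>E x\<in>V'. carrier_vec r)\<close> that] by simp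
      show ?thesis unfolding one using holfun_cong[of V' "\<lambda>x. vec_index (s x) i" "\<lambda>x. vec_index (1\<^sub>m r *\<^sub>v s x) i"]
        holfun_cong[of V' "\<lambda>x. vec_index (1\<^sub>m r *\<^sub>v s x) i" "\<lambda>x. vec_index (s x) i"] e by auto
    qed
    then show ?thesis unfolding set_sections_product[OF V'W] product_sec using V' by auto
  qed
  moreover have "W \<in> opens_in M W" using W by (simp add: opens_in_def)
  ultimately show "\<exists>V\<in>opens_in M W. \<exists>n e. p \<in> V \<and> (\<forall>x\<in>V. vb_rank (product_vbc M r W) x = n \<and> e x \<in> GL n) \<and>
      (\<forall>V'\<in>opens_in M V. vb_sec (product_vbc M r W) V' =
         {s \<in> set_sections (product_vbc M r W) V'. \<forall>i<n. holfun M V' (\<lambda>x. vec_index (mat_inv (e x) *\<^sub>v s x) i)})"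
    using p GL_one
    by (intro bexI[of _ W] exI[of _ r] exI[of _ "\<lambda>_. 1\<^sub>m r"] conjI ballI) (auto simp: product_rank)
qed

text \<open>Additivity, the Leibniz rule and compatibility with restriction are properties of
  tangent vectors as derivations. That the derivative of a section along a coordinate field is again
  a section uses \<open>holfun_coord_vec\<close>.\<close>

lemma product_is_conn:
  assumes W: "openin (mtop M) W"
  shows "is_conn M W (product_vbc M r W)"
proof -
  let ?P = "product_vbc M r W"
  have val: "vb_conn ?P V s p v = vec r (\<lambda>i. v (\<lambda>x. vec_index (s x) i))"
    if "s \<in> vb_sec ?P V" "p \<in> V" "v \<in> tangent M p" for V s p v
    using that by (simp add: product_conn)
  have 1: "vb_conn ?P V s = undefined" if "s \<notin> vb_sec ?P V" for V s
    using that by (simp add: product_conn)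
  show ?thesis unfolding is_conn_def
  proof (intro conjI allI impI ballI 1)
    fix V s assume s: "s \<in> vb_sec ?P V"
    have V: "openin (mtop M) V" "V \<subseteq> W" using opens_inD[OF product_secD(1)[OF s]] by auto
    note sh = product_secD(3)[OF s]
    show "vb_conn ?P V s \<in> (\<Pi>\<^sub>E p\<in>V. \<Pi>\<^sub>E v\<in>tangent M p. carrier_vec (vb_rank ?P p))"
      using s V(2) by (auto simp: product_conn product_rank)
    show "vb_conn ?P V s p (\<lambda>f. a * v f + w f) = a \<cdot>\<^sub>v vb_conn ?P V s p v + vb_conn ?P V s p w"
      if "p \<in> V" "v \<in> tangent M p" "w \<in> tangent M p" for p v w a
      unfolding val[OF s that(1,2)] val[OF s that(1,3)] val[OF s that(1) tangent_combine[OF that(2,3)]]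
      by (rule eq_vecI) auto
    show "case x of (D, \<phi>) \<Rightarrow> \<forall>i<mdim M. (\<lambda>p\<in>V \<inter> D. vb_conn ?P V s p (coord_vec M (D, \<phi>) i p)) \<in> vb_sec ?P (V \<inter> D)"
      if "x \<in> matlas M" for x
    proof (clarsimp split: prod.splits)
      fix D \<phi> i assume x: "x = (D, \<phi>)" and i: "i < mdim M"
      have c: "(D, \<phi>) \<in> matlas M" using that x by simp
      have VD: "openin (mtop M) (V \<inter> D)" using V chart(1)[OF c] by blast
      have e: "vb_conn ?P V s p (coord_vec M (D, \<phi>) i p) = vec r (\<lambda>k. coord_vec M (D, \<phi>) i p (\<lambda>x. vec_index (s x) k))"
        if "p \<in> V" "p \<in> D" for p
        by (rule val[OF s that(1) coord_vec_tangent[OF c that(2) i]])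
      show "(\<lambda>p\<in>V \<inter> D. vb_conn ?P V s p (coord_vec M (D, \<phi>) i p)) \<in> vb_sec ?P (V \<inter> D)"
      proof (rule product_secI)
        show "V \<inter> D \<in> opens_in M W" using VD V by (auto simp: opens_in_def)
        show "(\<lambda>p\<in>V \<inter> D. vb_conn ?P V s p (coord_vec M (D, \<phi>) i p)) \<in> (\<Pi>\<^sub>E x\<in>V \<inter> D. carrier_vec r)"
          using e by auto
        fix k assume k: "k < r"
        show "holfun M (V \<inter> D) (\<lambda>x. vec_index ((\<lambda>p\<in>V \<inter> D. vb_conn ?P V s p (coord_vec M (D, \<phi>) i p)) x) k)"
          by (rule holfun_cong[OF holfun_coord_vec[OF V(1) sh[OF k] c i]]) (use e k in auto)
      qed
    qed
    show "vb_conn ?P V' (restrict s V') p = vb_conn ?P V s p" if V': "V' \<in> opens_in M V" "p \<in> V'" for V' p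
    proof -
      have V'o: "openin (mtop M) V'" "V' \<subseteq> V" using opens_inD[OF V'(1)] by auto
      have hs: "holfun M V' (\<lambda>x. vec_index (restrict s V' x) i)" if "i < r" for i
        by (rule holfun_cong[OF holfun_subset[OF sh[OF that] V'o(2)]]) simp
      have rs: "restrict s V' \<in> vb_sec ?P V'"
      proof (rule product_secI)
        show "V' \<in> opens_in M W" using V'o V by (auto simp: opens_in_def)
        show "restrict s V' \<in> (\<Pi>\<^sub>E x\<in>V'. carrier_vec r)" using product_secD(4)[OF s] V'o by auto
      qed (rule hs)
      have "v (\<lambda>x. vec_index (restrict s V' x) i) = v (\<lambda>x. vec_index (s x) i)" if "v \<in> tangent M p" "i < r" for v i
        by (rule tangent_cong[OF that(1) V'o(1) V'(2) hs[OF that(2)]]) simp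
      then have "vec r (\<lambda>i. v (\<lambda>x. vec_index (restrict s V' x) i)) = vec r (\<lambda>i. v (\<lambda>x. vec_index (s x) i))"
        if "v \<in> tangent M p" for v using that by (intro eq_vecI) auto
      moreover have "p \<in> V" using V'o V' by blast
      ultimately show ?thesis using s rs V'(2)
        by (simp add: product_conn cong: restrict_cong)
    qed
    show "vb_conn ?P V (\<lambda>x\<in>V. s x + t x) p v = vb_conn ?P V s p v + vb_conn ?P V t p v"
      if t: "t \<in> vb_sec ?P V" and p: "p \<in> V" and v: "v \<in> tangent M p" for t p v
    proof -
      note th = product_secD(3)[OF t]
      have hst: "holfun M V (\<lambda>x. vec_index ((\<lambda>x\<in>V. s x + t x) x) i)" if "i < r" for i
        by (rule holfun_cong[OF holfun_add[OF sh[OF that] th[OF that]]])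
          (use product_sec_dim[OF t] that in auto)
      have st: "(\<lambda>x\<in>V. s x + t x) \<in> vb_sec ?P V"
        by (rule product_secI[OF product_secD(1)[OF s]]) (use product_secD(4)[OF s] product_secD(4)[OF t] hst in auto)
      have "v (\<lambda>x. vec_index ((\<lambda>x\<in>V. s x + t x) x) i) = v (\<lambda>x. vec_index (s x) i) + v (\<lambda>x. vec_index (t x) i)"
        if i: "i < r" for i
        unfolding tangent_add[OF v V(1) p sh[OF i] th[OF i], symmetric]
        by (rule tangent_cong[OF v V(1) p hst[OF i]]) (use product_sec_dim[OF t] i in auto)
      then show ?thesis unfolding val[OF st p v] val[OF s p v] val[OF t p v]
        by (intro eq_vecI) auto
    qed
    show "vb_conn ?P V (\<lambda>x\<in>V. f x \<cdot>\<^sub>v s x) p v = v f \<cdot>\<^sub>v s p + f p \<cdot>\<^sub>v vb_conn ?P V s p v"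
      if f: "holfun M V f" and p: "p \<in> V" and v: "v \<in> tangent M p" for f p v
    proof -
      have hfs: "holfun M V (\<lambda>x. vec_index ((\<lambda>x\<in>V. f x \<cdot>\<^sub>v s x) x) i)" if "i < r" for i
        by (rule holfun_cong[OF holfun_mult[OF f sh[OF that]]])
          (use product_sec_dim[OF s] that in auto)
      have fs: "(\<lambda>x\<in>V. f x \<cdot>\<^sub>v s x) \<in> vb_sec ?P V"
        by (rule product_secI[OF product_secD(1)[OF s]]) (use product_secD(4)[OF s] hfs in auto)
      have "v (\<lambda>x. vec_index ((\<lambda>x\<in>V. f x \<cdot>\<^sub>v s x) x) i) = v f * vec_index (s p) i + f p * v (\<lambda>x. vec_index (s x) i)"
        if i: "i < r" for i
        unfolding tangent_mult[OF v V(1) p f sh[OF i], symmetric]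
        by (rule tangent_cong[OF v V(1) p hfs[OF i]]) (use product_sec_dim[OF s] i in auto)
      then show ?thesis unfolding val[OF fs p v] val[OF s p v]
        using product_sec_dim[OF s p] by (intro eq_vecI) auto
    qed
  qed
qed

lemma holfun_mult_vec:
  assumes F: "\<And>x. x \<in> V \<Longrightarrow> F x \<in> carrier_mat r r" "\<And>i j. i < r \<Longrightarrow> j < r \<Longrightarrow> holfun M V (\<lambda>x. F x $$ (i, j))"
    and s: "\<And>x. x \<in> V \<Longrightarrow> s x \<in> carrier_vec r" "\<And>i. i < r \<Longrightarrow> holfun M V (\<lambda>x. vec_index (s x) i)" and i: "i < r"
  shows "holfun M V (\<lambda>x. vec_index (F x *\<^sub>v s x) i)"
proof (rule holfun_cong)
  show "holfun M V (\<lambda>x. \<Sum>j<r. F x $$ (i, j) * vec_index (s x) j)"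
    by (intro holfun_sum holfun_mult) (use F s i in auto)
  show "(\<Sum>j<r. F x $$ (i, j) * vec_index (s x) j) = vec_index (F x *\<^sub>v s x) i" if "x \<in> V" for x
    using mult_mat_vec_index[OF F(1)[OF that] s(1)[OF that] i] by simp
qed

lemma product_sec_mult:
  assumes F: "\<And>x. x \<in> W \<Longrightarrow> F x \<in> carrier_mat r r" "\<And>i j. i < r \<Longrightarrow> j < r \<Longrightarrow> holfun M W (\<lambda>x. F x $$ (i, j))"
    and s: "s \<in> vb_sec (product_vbc M r W) V"
  shows "(\<lambda>x\<in>V. F x *\<^sub>v s x) \<in> vb_sec (product_vbc M r W) V"
proof (rule product_secI[OF product_secD(1)[OF s]])
  have VW: "V \<subseteq> W" using opens_inD[OF product_secD(1)[OF s]] by simp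
  note sc = product_secD(4)[OF s]
  show "(\<lambda>x\<in>V. F x *\<^sub>v s x) \<in> (\<Pi>\<^sub>E x\<in>V. carrier_vec r)"
    using F(1) sc VW by (auto intro!: mult_mat_vec_carrier)
  fix i assume i: "i < r"
  have "holfun M V (\<lambda>x. vec_index (F x *\<^sub>v s x) i)"
    by (rule holfun_mult_vec[OF _ holfun_subset[OF F(2) VW] sc product_secD(3)[OF s] i]) (use F VW in auto)
  then show "holfun M V (\<lambda>x. vec_index ((\<lambda>x\<in>V. F x *\<^sub>v s x) x) i)"
    by (rule holfun_cong) simp
qed

text \<open>Multiplication by the holomorphic left inverse \<open>G\<close> carries sections back.
  In the application \<open>G\<close> is the component of \<open>h\<close> for the reversed
  pair.\<close>

lemma product_is_iso:
  assumes F: "\<And>x. x \<in> W \<Longrightarrow> F x \<in> carrier_mat r r" "\<And>i j. i < r \<Longrightarrow> j < r \<Longrightarrow> holfun M W (\<lambda>x. F x $$ (i, j))"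
    and G: "\<And>x. x \<in> W \<Longrightarrow> G x \<in> carrier_mat r r" "\<And>i j. i < r \<Longrightarrow> j < r \<Longrightarrow> holfun M W (\<lambda>x. G x $$ (i, j))"
    and GF: "\<And>x. x \<in> W \<Longrightarrow> G x * F x = 1\<^sub>m r" and inv: "\<And>x. x \<in> W \<Longrightarrow> invertible_mat (F x)"
  shows "is_iso M W (product_vbc M r W) (product_vbc M r W) (\<lambda>x\<in>W. F x)"
  unfolding is_iso_def
proof (intro conjI ballI)
  show "(\<lambda>x\<in>W. F x) \<in> (\<Pi>\<^sub>E x\<in>W. {A \<in> carrier_mat (vb_rank (product_vbc M r W) x) (vb_rank (product_vbc M r W) x). invertible_mat A})"
    using F(1) inv by (auto simp: product_rank)
  fix V s assume V: "V \<in> opens_in M W" and s: "s \<in> set_sections (product_vbc M r W) V"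
  have VW: "V \<subseteq> W" using opens_inD[OF V] by simp
  have s': "s \<in> (\<Pi>\<^sub>E x\<in>V. carrier_vec r)" using s set_sections_product[OF VW] by simp
  have eq: "(\<lambda>x\<in>V. (\<lambda>x\<in>W. F x) x *\<^sub>v s x) = (\<lambda>x\<in>V. F x *\<^sub>v s x)"
    using VW by (intro restrict_ext) auto
  show "s \<in> vb_sec (product_vbc M r W) V \<longleftrightarrow> (\<lambda>x\<in>V. (\<lambda>x\<in>W. F x) x *\<^sub>v s x) \<in> vb_sec (product_vbc M r W) V"
    unfolding eq
  proof
    assume sa: "s \<in> vb_sec (product_vbc M r W) V"
    show "(\<lambda>x\<in>V. F x *\<^sub>v s x) \<in> vb_sec (product_vbc M r W) V"
      by (rule product_sec_mult[where F = F and W = W and s = s]) (use F sa in auto)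
  next
    assume sa: "(\<lambda>x\<in>V. F x *\<^sub>v s x) \<in> vb_sec (product_vbc M r W) V"
    have "(\<lambda>x\<in>V. G x *\<^sub>v (\<lambda>x\<in>V. F x *\<^sub>v s x) x) \<in> vb_sec (product_vbc M r W) V"
      by (rule product_sec_mult[where F = G and W = W and s = "\<lambda>x\<in>V. F x *\<^sub>v s x"]) (use G sa in auto)
    moreover have "(\<lambda>x\<in>V. G x *\<^sub>v (\<lambda>x\<in>V. F x *\<^sub>v s x) x) = s"
    proof
      fix x
      show "(\<lambda>x\<in>V. G x *\<^sub>v (\<lambda>x\<in>V. F x *\<^sub>v s x) x) x = s x"
      proof (cases "x \<in> V")
        case True
        then have "x \<in> W" "s x \<in> carrier_vec r" using VW PiE_mem[OF s'] by auto
        then have "G x *\<^sub>v (F x *\<^sub>v s x) = s x"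
          using assoc_mult_mat_vec[OF G(1) F(1), of x x "s x"] GF by simp
        then show ?thesis using True by simp
      next
        case False
        then show ?thesis using PiE_arb[OF s' False] by simp
      qed
    qed
    ultimately show "s \<in> vb_sec (product_vbc M r W) V" by simp
  qed
qed

end

context cman_map
begin

text \<open>The index of the cover \<open>brcov U\<close> at vertex \<open>t\<close> of the simplex
  \<open>(a, b)\<close>. Through it every simplex of the prism over \<open>js\<close> becomes a list
  of indices on which \<open>gamma\<close> can be evaluated.\<close>

definition vert :: "nat list \<Rightarrow> nat list \<Rightarrow> 'i list \<Rightarrow> nat \<Rightarrow> 'i \<times> nat" where
  "vert a b js t = (js ! (a ! t), b ! t)"

context
  fixes a b l k js
  assumes a: "a \<in> ord_maps k l" and b: "b \<in> ord_maps k n" and js: "js \<in> cidx I l"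
begin

lemma vert_X: "t \<le> k \<Longrightarrow> vert a b js t \<in> X"
proof -
  assume t: "t \<le> k"
  have "js ! (a ! t) \<in> set js" by (rule nth_mem) (use ord_maps_nth[OF a t] js in \<open>simp add: cidx_def\<close>)
  then show ?thesis using js ord_maps_nth[OF b t] by (auto simp: vert_def bridx_def cidx_def)
qed

lemma vert_cap: "t \<le> k \<Longrightarrow> cap U js \<subseteq> brcov U (vert a b js t)"
proof -
  assume t: "t \<le> k"
  have "js ! (a ! t) \<in> set js" by (rule nth_mem) (use ord_maps_nth[OF a t] js in \<open>simp add: cidx_def\<close>)
  then show ?thesis by (auto simp: vert_def brcov_def cap_def)
qed

lemma length_ab: "length a = Suc k" "length b = Suc k"
  using a b by (auto simp: ord_maps_def)

lemma beta_eq: "beta M r I U n h l (a, b) js = (replicate (Suc k) (product_vbc M r (cap U js)),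
    map (\<lambda>t. \<lambda>x\<in>cap U js. comp1 h (vert a b js (Suc t)) (vert a b js t) x) [0..<k])"
proof -
  have "(a, b) \<in> prism l n" using a b by (auto simp: prism_iff)
  moreover have "[1..<Suc k] = map Suc [0..<k]" by (simp add: map_Suc_upt)
  ultimately show ?thesis using js by (simp add: beta_def vert_def length_ab comp_def del: upt_Suc)
qed

lemma vert_comp:
  assumes "s \<le> k" "t \<le> k" "x \<in> cap U js"
  shows "x \<in> capb [vert a b js s, vert a b js t]"
  using vert_cap[OF assms(1)] vert_cap[OF assms(2)] assms(3) by (auto simp: cap_def)

text \<open>The cocycle identity collapses a chain of transition matrices to the one between its end
  vertices; the empty chain is the case of equal indices.\<close>

lemma beta_hvb_comp:
  assumes "p \<le> q" "q \<le> k"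
  shows "hvb_comp (cap U js) (beta M r I U n h l (a, b) js) q p =
    (\<lambda>x\<in>cap U js. comp1 h (vert a b js q) (vert a b js p) x)"
proof -
  have "hvb_comp' (cap U js) (beta M r I U n h l (a, b) js) p j =
      (\<lambda>x\<in>cap U js. comp1 h (vert a b js (p + j)) (vert a b js p) x)" if "p + j \<le> k" for j
    using that
  proof (induction j)
    case 0
    show ?case
    proof (unfold hvb_comp'.simps add_0_right, rule restrict_ext)
      fix x assume x: "x \<in> cap U js"
      have "x \<in> brcov U (vert a b js p)" using vert_cap[of p] x 0 by auto
      then show "1\<^sub>m (vb_rank (fst (beta M r I U n h l (a, b) js) ! p) x) = comp1 h (vert a b js p) (vert a b js p) x"
        using comp1_id[OF vert_X[of p]] 0 x by (simp add: beta_eq product_rank del: replicate.simps)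
    qed
  next
    case (Suc j)
    show ?case
    proof (simp only: hvb_comp'.simps, rule restrict_ext)
      fix x assume x: "x \<in> cap U js"
      have "x \<in> capb [vert a b js (Suc (p + j)), vert a b js (p + j), vert a b js p]"
        using vert_cap[of "Suc (p + j)"] vert_cap[of "p + j"] vert_cap[of p] x Suc.prems by (auto simp: cap_def)
      then show "(snd (beta M r I U n h l (a, b) js) ! (p + j)) x * hvb_comp' (cap U js) (beta M r I U n h l (a, b) js) p j x =
          comp1 h (vert a b js (p + Suc j)) (vert a b js p) x"
        using Suc comp1_cocycle[OF vert_X vert_X vert_X, of "Suc (p + j)" "p + j" p x] x by (simp add: beta_eq)
    qed
  qed
  from this[of "q - p"] show ?thesis using assms by (simp add: hvb_comp_def)
qed

lemma comp1_holfun: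
  assumes "s \<le> k" "t \<le> k" "i < r" "j < r"
  shows "holfun M (cap U js) (\<lambda>x. comp1 h (vert a b js s) (vert a b js t) x $$ (i, j))"
  by (rule holfun_subset[OF comp1_hol[OF vert_X vert_X]]) (use assms vert_comp in auto)

lemma beta_hvb_simp: "beta M r I U n h l (a, b) js \<in> hvb_simp M (cap U js) k"
proof -
  have W: "openin (mtop M) (cap U js)" by (rule cap_open[OF cidxD[OF js]])
  have iso: "is_iso M (cap U js) (product_vbc M r (cap U js)) (product_vbc M r (cap U js))
      (\<lambda>x\<in>cap U js. comp1 h (vert a b js (Suc t)) (vert a b js t) x)" if t: "t < k" for t
  proof (rule product_is_iso[where G = "comp1 h (vert a b js t) (vert a b js (Suc t))"])
    have X: "vert a b js t \<in> X" "vert a b js (Suc t) \<in> X" using vert_X t by auto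
    fix x assume x: "x \<in> cap U js"
    have c: "x \<in> capb [vert a b js (Suc t), vert a b js t]" "x \<in> capb [vert a b js t, vert a b js (Suc t)]"
      using vert_comp t x by auto
    show "comp1 h (vert a b js (Suc t)) (vert a b js t) x \<in> carrier_mat r r"
      "comp1 h (vert a b js t) (vert a b js (Suc t)) x \<in> carrier_mat r r"
      using h_pair(3) X c by auto
    show "invertible_mat (comp1 h (vert a b js (Suc t)) (vert a b js t) x)"
      using h_pair(2)[OF X(2,1) c(1)] by (simp add: GL_def)
    have "x \<in> capb [vert a b js t, vert a b js (Suc t), vert a b js t]" "x \<in> brcov U (vert a b js t)"
      using c(1) by (auto simp: cap_def)
    then show "comp1 h (vert a b js t) (vert a b js (Suc t)) x * comp1 h (vert a b js (Suc t)) (vert a b js t) x = 1\<^sub>m r"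
      using comp1_cocycle[OF X X(1)] comp1_id[OF X(1)] by simp
  qed (use comp1_holfun t in auto)
  show ?thesis
    unfolding hvb_simp_def beta_eq
    using product_is_vb[OF W] product_is_conn[OF W] iso by (auto simp del: replicate.simps)
qed

end

lemma beta_tot: "beta M r I U n h \<in> simp (Tot (HVB_nerve M I U)) n"
proof -
  have ext: "beta M r I U n h l \<in> extensional (prism l n)" for l
    by (simp add: beta_def)
  have smap: "simplicial_map (prod_sset (std_simplex l) (std_simplex n)) (lev (HVB_nerve M I U) l) (\<lambda>_. beta M r I U n h l)" for l
    unfolding simplicial_map_def
  proof (intro allI ballI)
    fix k x assume "x \<in> simp (prod_sset (std_simplex l) (std_simplex n)) k"
    then obtain a b where x: "x = (a, b)" and a: "a \<in> ord_maps k l" and b: "b \<in> ord_maps k n"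
      by (auto simp: prod_sset_def std_simplex_def)
    have pr: "(a, b) \<in> prism l n" using a b by (auto simp: prism_iff)
    show "beta M r I U n h l x \<in> simp (lev (HVB_nerve M I U) l) k \<and>
        (\<forall>k'. \<forall>\<rho>\<in>ord_maps k' k. beta M r I U n h l (act (prod_sset (std_simplex l) (std_simplex n)) \<rho> x) =
           act (lev (HVB_nerve M I U) l) \<rho> (beta M r I U n h l x))"
    proof (intro conjI allI ballI)
      have "beta M r I U n h l (a, b) \<in> extensional (cidx I l)"
        using pr by (simp add: beta_def)
      then show "beta M r I U n h l x \<in> simp (lev (HVB_nerve M I U) l) k"
        using beta_hvb_simp[OF a b] by (auto simp: x HVB_nerve_def PiE_iff)
      fix k' \<rho> assume \<rho>: "\<rho> \<in> ord_maps k' k"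
      note pa = pick_ord_maps[OF a \<rho>] and pb = pick_ord_maps[OF b \<rho>]
      have len: "length \<rho> = Suc k'" using \<rho> by (simp add: ord_maps_def)
      have "beta M r I U n h l (pick a \<rho>, pick b \<rho>) = (\<lambda>js\<in>cidx I l. hvb_act (cap U js) \<rho> (beta M r I U n h l (a, b) js))"
      proof
        fix js
        show "beta M r I U n h l (pick a \<rho>, pick b \<rho>) js = (\<lambda>js\<in>cidx I l. hvb_act (cap U js) \<rho> (beta M r I U n h l (a, b) js)) js"
        proof (cases "js \<in> cidx I l")
          case js: True
          have v: "vert (pick a \<rho>) (pick b \<rho>) js t = vert a b js (\<rho> ! t)" if "t \<le> k'" for t
            using that len by (simp add: vert_def pick_nth)
          have "hvb_comp (cap U js) (beta M r I U n h l (a, b) js) (\<rho> ! Suc t) (\<rho> ! t) =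
              (\<lambda>x\<in>cap U js. comp1 h (vert (pick a \<rho>) (pick b \<rho>) js (Suc t)) (vert (pick a \<rho>) (pick b \<rho>) js t) x)"
            if t: "t < k'" for t
          proof -
            have "\<rho> ! t \<le> \<rho> ! Suc t" using \<rho> t len by (intro sorted_nth_mono) (auto simp: ord_maps_def)
            moreover have "\<rho> ! Suc t \<le> k" using ord_maps_nth[OF \<rho>] t by simp
            ultimately show ?thesis using beta_hvb_comp[OF a b js] v t by simp
          qed
          moreover have "pick (replicate (Suc k) (product_vbc M r (cap U js))) \<rho> = replicate (Suc k') (product_vbc M r (cap U js))"
            using ord_maps_nth[OF \<rho>] len by (intro nth_equalityI) (auto simp: pick_nth less_Suc_eq_le simp del: replicate.simps)
          ultimately show ?thesis
            using js len by (simp add: hvb_act_def beta_eq[OF pa pb js] beta_eq[OF a b js, THEN arg_cong[where f = fst]] del: replicate.simps)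
        next
          case False
          then show ?thesis using pa pb by (auto simp: beta_def prism_iff)
        qed
      qed
      then show "beta M r I U n h l (act (prod_sset (std_simplex l) (std_simplex n)) \<rho> x) =
           act (lev (HVB_nerve M I U) l) \<rho> (beta M r I U n h l x)"
        by (simp add: x prod_sset_def std_simplex_def HVB_nerve_def)
    qed
  qed
  have co: "beta M r I U n h m (pick \<rho> a, b) = coact (HVB_nerve M I U) m \<rho> (beta M r I U n h k (a, b))"
    if \<rho>: "\<rho> \<in> ord_maps k m" and pr: "(a, b) \<in> prism k n" for k m \<rho> a b
  proof
    fix js
    obtain q where a: "a \<in> ord_maps q k" and b: "b \<in> ord_maps q n" using pr by (auto simp: prism_iff)
    note pa = pick_ord_maps[OF \<rho> a]
    show "beta M r I U n h m (pick \<rho> a, b) js = coact (HVB_nerve M I U) m \<rho> (beta M r I U n h k (a, b)) js"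
    proof (cases "js \<in> cidx I m")
      case js: True
      note pj = pick_cidx[OF js \<rho>] and sub = cap_pick[OF js \<rho>, of U]
      \<comment> \<open>Associativity of composition for \<open>js\<close>, \<open>\<rho>\<close>
        and \<open>a\<close>: relabelling the cover indices or relabelling the simplex gives the
        same vertex. This is the compatibility in the cosimplicial direction.\<close>
      have v: "vert a b (pick js \<rho>) t = vert (pick \<rho> a) b js t" if "t \<le> q" for t
        using that a ord_maps_nth[OF a that] \<rho> by (simp add: vert_def pick_nth ord_maps_def)
      have "restrict (\<lambda>x\<in>cap U (pick js \<rho>). g x) (cap U js) = (\<lambda>x\<in>cap U js. g x)" for g :: "'a \<Rightarrow> complex mat"
        using sub by (auto simp: fun_eq_iff)
      then show ?thesis
        using js v by (simp add: HVB_nerve_def hvb_res_def beta_eq[OF pa b js] beta_eq[OF a b pj] res_product[OF sub] del: replicate.simps)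
    next
      case False
      then show ?thesis using pa b by (auto simp: beta_def prism_iff HVB_nerve_def)
    qed
  qed
  show ?thesis unfolding Tot_def using ext smap co by auto
qed

lemma beta_act:
  assumes \<rho>: "\<rho> \<in> ord_maps k n"
  shows "beta M r I U k (act (CMan M r I U) \<rho> h) = act (Tot (HVB_nerve M I U)) \<rho> (beta M r I U n h)"
proof (intro ext)
  fix l and z :: "nat list \<times> nat list" and js :: "'i list"
  have len: "length \<rho> = Suc k" using \<rho> by (simp add: ord_maps_def)
  obtain a b where z: "z = (a, b)" by (cases z)
  show "beta M r I U k (act (CMan M r I U) \<rho> h) l z js = act (Tot (HVB_nerve M I U)) \<rho> (beta M r I U n h) l z js"
  proof (cases "(a, b) \<in> prism l k \<and> js \<in> cidx I l")
    case True
    then obtain q where a: "a \<in> ord_maps q l" and b: "b \<in> ord_maps q k" and js: "js \<in> cidx I l"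
      by (auto simp: prism_iff)
    have pr': "(a, pick \<rho> b) \<in> prism l n" using a pick_ord_maps[OF \<rho> b] by (auto simp: prism_iff)
    have lab: "length a = Suc q" "length b = Suc q" using a b by (auto simp: ord_maps_def)
    have J: "js ! (a ! t) \<in> I" if "t \<le> q" for t
    proof -
      have "js ! (a ! t) \<in> set js" by (rule nth_mem) (use ord_maps_nth[OF a that] js in \<open>simp add: cidx_def\<close>)
      then show ?thesis using js by (auto simp: cidx_def)
    qed
    have "comp1 (act (CMan M r I U) \<rho> h) (js ! (a ! t), b ! t) (js ! (a ! (t - 1)), b ! (t - 1)) =
        comp1 h (js ! (a ! t), pick \<rho> b ! t) (js ! (a ! (t - 1)), pick \<rho> b ! (t - 1))" if "t < Suc q" for t
      using that J[of t] J[of "t - 1"] ord_maps_nth[OF b, of t] ord_maps_nth[OF b, of "t - 1"] lab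
      by (subst comp1_act[OF _ _ len]) (auto simp: bridx_def pick_nth)
    then show ?thesis
      using True pr' js len by (auto simp: z Tot_def beta_def lab)
  next
    case False
    then show ?thesis
    proof (cases "(a, b) \<in> prism l k")
      case True
      then obtain q where "a \<in> ord_maps q l" "b \<in> ord_maps q k" by (auto simp: prism_iff)
      then have "(a, pick \<rho> b) \<in> prism l n" using pick_ord_maps[OF \<rho>] by (auto simp: prism_iff)
      then show ?thesis using False True len by (simp add: z Tot_def beta_def)
    qed (simp add: z Tot_def beta_def len)
  qed
qed

end

lemma (in cman_cover) beta_simplicial:
  "simplicial_map (CMan M r I U) (Tot (HVB_nerve M I U)) (beta M r I U)"
  unfolding simplicial_map_def
proof (intro allI ballI conjI)
  fix n h assume "h \<in> simp (CMan M r I U) n"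
  then interpret cman_map M I U r n h by unfold_locales
  show "beta M r I U n h \<in> simp (Tot (HVB_nerve M I U)) n" by (rule beta_tot)
  show "beta M r I U k (act (CMan M r I U) \<rho> h) = act (Tot (HVB_nerve M I U)) \<rho> (beta M r I U n h)"
    if "\<rho> \<in> ord_maps k n" for k \<rho> using that by (rule beta_act)
qed

section \<open>Commutativity of the diagram\<close>

lemma not_distinct_adj_map: "\<not> distinct_adj xs \<Longrightarrow> \<not> distinct_adj (map f xs)"
  by (induction xs) (auto simp: distinct_adj_Cons hd_map)

lemma upt_nondeg: "[0..<Suc k] \<in> nondeg k"
  by (auto simp: nondeg_def simp del: upt_Suc)

text \<open>By the product rule, differentiating \<open>F s\<close> and subtracting \<open>F\<close>
  times the derivative of \<open>s\<close> leaves the entrywise derivative of \<open>F\<close>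
  applied to \<open>s\<close>. The definite description needs uniqueness too, which is tested on
  constant basis sections.\<close>

lemma (in cmanifold) hom_conn_product:
  assumes W: "openin (mtop M) W"
    and F: "\<And>x. x \<in> W \<Longrightarrow> F x \<in> carrier_mat r r" "\<And>i j. i < r \<Longrightarrow> j < r \<Longrightarrow> holfun M W (\<lambda>x. F x $$ (i, j))"
    and p: "p \<in> W" and v: "v \<in> tangent M p"
  shows "hom_conn M W (product_vbc M r W) (product_vbc M r W) (\<lambda>x\<in>W. F x) p v = dmat r F p v"
proof -
  let ?P = "product_vbc M r W"
  let ?R = "\<lambda>V s. vb_conn ?P V (\<lambda>x\<in>V. (\<lambda>x\<in>W. F x) x *\<^sub>v s x) p v - (\<lambda>x\<in>W. F x) p *\<^sub>v vb_conn ?P V s p v"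
  have rank: "vb_rank ?P p = r" using p by (simp add: product_rank)
  have D: "dmat r F p v \<in> carrier_mat r r" by (simp add: dmat_def)
  have ex: "dmat r F p v *\<^sub>v s p = ?R V s" if s: "s \<in> vb_sec ?P V" and pV: "p \<in> V" for V s
  proof -
    have V: "openin (mtop M) V" "V \<subseteq> W" using opens_inD[OF product_secD(1)[OF s]] by auto
    note sh = product_secD(3)[OF s] and sc = product_secD(4)[OF s]
    have Fh: "holfun M V (\<lambda>x. F x $$ (i, j))" if "i < r" "j < r" for i j
      by (rule holfun_subset[OF F(2)[OF that] V(2)])
    have eq: "(\<lambda>x\<in>V. (\<lambda>x\<in>W. F x) x *\<^sub>v s x) = (\<lambda>x\<in>V. F x *\<^sub>v s x)"
      using V by (intro restrict_ext) auto
    have fs: "(\<lambda>x\<in>V. F x *\<^sub>v s x) \<in> vb_sec ?P V"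
      by (rule product_sec_mult[where F = F and W = W and s = s]) (use F s in auto)
    have c1: "vb_conn ?P V (\<lambda>x\<in>V. F x *\<^sub>v s x) p v = vec r (\<lambda>i. v (\<lambda>x. vec_index ((\<lambda>x\<in>V. F x *\<^sub>v s x) x) i))"
      using fs pV v by (simp add: product_conn)
    have c2: "vb_conn ?P V s p v = vec r (\<lambda>i. v (\<lambda>x. vec_index (s x) i))"
      using s pV v by (simp add: product_conn)
    have Fp: "F p \<in> carrier_mat r r" using F(1) p by simp
    show ?thesis
    proof (rule eq_vecI)
      show "dim_vec (dmat r F p v *\<^sub>v s p) = dim_vec (?R V s)" using D Fp p by simp
      fix i assume "i < dim_vec (?R V s)"
      then have i: "i < r" using Fp p by simp
      have "v (\<lambda>x. vec_index ((\<lambda>x\<in>V. F x *\<^sub>v s x) x) i) = v (\<lambda>x. \<Sum>j<r. F x $$ (i, j) * vec_index (s x) j)"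
      proof (rule tangent_cong[OF v V(1) pV, symmetric])
        show "holfun M V (\<lambda>x. \<Sum>j<r. F x $$ (i, j) * vec_index (s x) j)"
          by (intro holfun_sum holfun_mult Fh sh i) auto
        show "(\<Sum>j<r. F x $$ (i, j) * vec_index (s x) j) = vec_index ((\<lambda>x\<in>V. F x *\<^sub>v s x) x) i" if x: "x \<in> V" for x
        proof -
          have "F x \<in> carrier_mat r r" using F(1) V x by auto
          from mult_mat_vec_index[OF this sc[OF x] i] show ?thesis using x by simp
        qed
      qed
      also have "\<dots> = (\<Sum>j<r. v (\<lambda>x. F x $$ (i, j) * vec_index (s x) j))"
        by (rule tangent_sum[OF v V(1) pV]) (intro holfun_mult Fh sh i, auto)
      also have "\<dots> = (\<Sum>j<r. v (\<lambda>x. F x $$ (i, j)) * vec_index (s p) j + F p $$ (i, j) * v (\<lambda>x. vec_index (s x) j))"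
        by (intro sum.cong refl tangent_mult[OF v V(1) pV] Fh sh i) auto
      finally have lhs: "v (\<lambda>x. vec_index ((\<lambda>x\<in>V. F x *\<^sub>v s x) x) i) =
          (\<Sum>j<r. v (\<lambda>x. F x $$ (i, j)) * vec_index (s p) j) + (\<Sum>j<r. F p $$ (i, j) * v (\<lambda>x. vec_index (s x) j))"
        by (simp add: sum.distrib)
      have "vec_index (F p *\<^sub>v vec r (\<lambda>i. v (\<lambda>x. vec_index (s x) i))) i = (\<Sum>j<r. F p $$ (i, j) * v (\<lambda>x. vec_index (s x) j))"
        using mult_mat_vec_index[OF Fp _ i, of "vec r (\<lambda>i. v (\<lambda>x. vec_index (s x) i))"] by simp
      moreover have "vec_index (dmat r F p v *\<^sub>v s p) i = (\<Sum>j<r. v (\<lambda>x. F x $$ (i, j)) * vec_index (s p) j)"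
        unfolding mult_mat_vec_index[OF D sc[OF pV] i] using i by (simp add: dmat_def)
      ultimately show "vec_index (dmat r F p v *\<^sub>v s p) i = vec_index (?R V s) i"
        unfolding eq c1 c2 using i Fp p lhs by simp
    qed
  qed
  show ?thesis
    unfolding hom_conn_def rank
  proof (rule the_equality)
    show "dmat r F p v \<in> carrier_mat r r \<and> (\<forall>V\<in>opens_in M W. \<forall>s\<in>vb_sec ?P V. p \<in> V \<longrightarrow> dmat r F p v *\<^sub>v s p = ?R V s)"
      using D ex by blast
    fix B assume B: "B \<in> carrier_mat r r \<and> (\<forall>V\<in>opens_in M W. \<forall>s\<in>vb_sec ?P V. p \<in> V \<longrightarrow> B *\<^sub>v s p = ?R V s)"
    have WW: "W \<in> opens_in M W" using W by (simp add: opens_in_def)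
    have col: "vec_index (A *\<^sub>v unit_vec r j) i = A $$ (i, j)" if A: "A \<in> carrier_mat r r" and ij: "i < r" "j < r" for A :: "complex mat" and i j
    proof -
      have "vec_index (A *\<^sub>v unit_vec r j) i = (\<Sum>k<r. if k = j then A $$ (i, k) else 0)"
        unfolding mult_mat_vec_index[OF A unit_vec_carrier ij(1)] using ij by (intro sum.cong) auto
      then show ?thesis using ij by simp
    qed
    have "B $$ (i, j) = dmat r F p v $$ (i, j)" if ij: "i < r" "j < r" for i j
    proof -
      \<comment> \<open>A constant basis section picks out column \<open>j\<close>.\<close>
      let ?s = "\<lambda>x\<in>W. unit_vec r j :: complex vec"
      have s: "?s \<in> vb_sec ?P W"
      proof (rule product_secI[OF WW])
        fix i assume "i < r"
        show "holfun M W (\<lambda>x. vec_index (?s x) i)"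
          by (rule holfun_cong[OF holfun_const[of W "vec_index (unit_vec r j) i"]]) simp
      qed auto
      have "B *\<^sub>v ?s p = ?R W ?s" using B WW s p by blast
      then have "B *\<^sub>v unit_vec r j = dmat r F p v *\<^sub>v unit_vec r j" using ex[OF s p] p by simp
      then show ?thesis using col[OF conjunct1[OF B] ij] col[OF D ij] by simp
    qed
    then show "B = dmat r F p v" using B D by (intro eq_matI) auto
  qed
qed

section \<open>Chern forms on the simplices of \<open>beta\<close>\<close>

context cman_map
begin

context
  fixes a b l k js
  assumes a: "a \<in> ord_maps k l" and b: "b \<in> ord_maps k n" and js: "js \<in> cidx I l"
begin

lemma vert_path:
  assumes J: "J \<in> nondeg k"
  shows "map (vert a b js) J \<in> cidx_all X" "cap U js \<subseteq> capb (map (vert a b js) J)"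
  using J vert_X[OF a b js] vert_cap[OF a b js] by (auto simp: cidx_all_iff nondeg_def cap_def)

text \<open>Along \<open>J\<close> the composites of \<open>beta\<close> are components of
  \<open>h\<close> between the listed vertices, the inverse is the component for the reversed pair,
  and the induced connections are entrywise derivatives. So both sides are the word evaluated by
  \<open>gtr\<close>, the left one on the smaller set.\<close>

lemma ch_form_beta:
  assumes J: "J \<in> nondeg k"
  shows "ch_form M (cap U js) (beta M r I U n h l (a, b) js) J =
    res_form (cap U js) (gamma M r I U n h (map (vert a b js) J))"
proof (intro ext)
  fix p vs
  let ?W = "cap U js" and ?\<sigma> = "beta M r I U n h l (a, b) js"
  let ?w = "map (vert a b js) J" and ?P = "product_vbc M r (cap U js)"
  have W: "openin (mtop M) ?W" by (rule cap_open[OF cidxD[OF js]])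
  have Jk: "J ! t \<le> k" if "t < length J" for t using J nth_mem[OF that] by (auto simp: nondeg_def)
  have ne: "J \<noteq> []" using J by (simp add: nondeg_def)
  have E: "fst ?\<sigma> ! (J ! t) = ?P" if "t < length J" for t
    using Jk[OF that] by (simp add: beta_eq[OF a b js] del: replicate.simps)
  have comp: "hvb_comp ?W ?\<sigma> (J ! t) (J ! s) = (\<lambda>x\<in>?W. comp1 h (?w ! t) (?w ! s) x)"
    if "s \<le> t" "t < length J" for s t
  proof -
    have "J ! s \<le> J ! t"
      using J that strict_sorted_imp_sorted[of J] by (intro sorted_nth_mono) (auto simp: nondeg_def)
    then show ?thesis using beta_hvb_comp[OF a b js _ Jk[OF that(2)]] that by simp
  qed
  note wX = vert_path(1)[OF J] and sub = vert_path(2)[OF J]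
  show "ch_form M ?W ?\<sigma> J p vs = res_form ?W (gamma M r I U n h ?w) p vs"
  proof (cases "p \<in> ?W")
    case False
    then show ?thesis by (simp add: ch_form_def Let_def res_form_def tr_form_def)
  next
    case p: True
    then have R: "res_form ?W (gamma M r I U n h ?w) p vs = gtr p ?w vs"
      using gamma_apply[OF wX] sub by (auto simp: res_form_def)
    define N where "N = vb_rank (fst ?\<sigma> ! (J ! 0))"
    have N: "N p = r" using E[of 0] ne p by (simp add: N_def product_rank)
    have Xw: "?w ! t \<in> X" if "t < length J" for t using wX that by (auto simp: cidx_all_iff)
    have pw: "p \<in> brcov U (?w ! t)" if "t < length J" for t
    proof -
      have "?w ! t \<in> set ?w" by (rule nth_mem) (use that in simp)
      then show ?thesis using sub p unfolding cap_def by blast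
    qed
    show ?thesis
    proof (cases "length J = 1")
      case True
      then obtain t where t: "J = [t]" by (metis length_0_conv length_Suc_conv One_nat_def)
      have "gtr p ?w vs = (if vs = [] then of_nat r else 0)"
        using gtr_single[of "?w ! 0" p vs] Xw[of 0] pw[of 0] by (simp add: t)
      then show ?thesis unfolding R using p N unfolding N_def by (simp add: t ch_form_def Let_def res_form_def)
    next
      case False
      then have l0: "length J - 1 \<noteq> 0" using ne by (cases J) auto
      let ?A = "\<lambda>x. mat_inv (hvb_comp ?W ?\<sigma> (J ! (length J - 1)) (J ! 0) x)"
      let ?B = "\<lambda>t. hom_conn M ?W (fst ?\<sigma> ! (J ! t)) (fst ?\<sigma> ! (J ! Suc t)) (hvb_comp ?W ?\<sigma> (J ! Suc t) (J ! t))"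
      have ll: "length ?w = length J" by simp
      have "mtrace (mwedges N (mform0 ?W N ?A # map (\<lambda>t. mform1 M ?W N (?B t)) (rev [0..<length ?w - 1])) p vs) = gtr p ?w vs"
      proof (rule mwedges_eq_gtr[where W = "?W" and N = N and p = p and A = "?A" and B = "?B" and w = "?w", OF wX p sub N])
        have "p \<in> capb [?w ! (length J - 1), ?w ! 0]" using pw ne by (auto simp: cap_def)
        then have "mat_inv (comp1 h (?w ! (length J - 1)) (?w ! 0) p) = comp1 h (?w ! 0) (?w ! (length J - 1)) p"
          using comp1_inv[OF Xw Xw] ne by simp
        then show "?A p = comp1 h (hd ?w) (last ?w) p"
          using comp[of 0 "length J - 1"] ne p by (simp add: hd_conv_nth last_conv_nth)
      next
        fix t v assume t: "t < length ?w - 1" and v: "v \<in> tangent M p"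
        have tk: "J ! Suc t \<le> k" "J ! t \<le> k" using Jk t by auto
        have wt: "?w ! Suc t = vert a b js (J ! Suc t)" "?w ! t = vert a b js (J ! t)" using t by auto
        have "hom_conn M ?W ?P ?P (\<lambda>x\<in>?W. comp1 h (?w ! Suc t) (?w ! t) x) p v = dmat r (comp1 h (?w ! Suc t) (?w ! t)) p v"
        proof (rule hom_conn_product[OF W _ _ p v])
          show "comp1 h (?w ! Suc t) (?w ! t) x \<in> carrier_mat r r" if "x \<in> ?W" for x
            unfolding wt using h_pair(3)[OF vert_X[OF a b js tk(1)] vert_X[OF a b js tk(2)] vert_comp[OF a b js tk that]] .
          show "holfun M ?W (\<lambda>x. comp1 h (?w ! Suc t) (?w ! t) x $$ (i, j))" if "i < r" "j < r" for i j
            unfolding wt by (rule comp1_holfun[OF a b js tk that])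
        qed
        then show "?B t p v = dmat r (comp1 h (?w ! Suc t) (?w ! t)) p v"
          using E t comp[of t "Suc t"] by simp
      qed
      then show ?thesis unfolding R
        using p l0 unfolding ll by (simp add: ch_form_def Let_def tr_form_def res_form_def N_def)
    qed
  qed
qed

end

lemma Ch_beta:
  assumes a: "a \<in> ord_maps k l" and b: "b \<in> ord_maps k n"
  shows "Ch_nerve M I U l (beta M r I U n h l (a, b)) J m js =
    (if js \<in> cidx I l \<and> J \<in> nondeg k \<and> m = length J - 1
     then res_form (cap U js) (gamma M r I U n h (map (vert a b js) J)) else 0)"
proof (cases "js \<in> cidx I l")
  case True
  have "length (snd (beta M r I U n h l (a, b) js)) = k" by (simp add: beta_eq[OF a b True])
  then show ?thesis using True ch_form_beta[OF a b True] by (simp add: Ch_nerve_def)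
qed (simp add: Ch_nerve_def)

text \<open>The target has differential 0, so being a chain map means that the alternating sum over
  the faces of a generator vanishes; this is the closedness of \<open>gamma\<close> at the
  corresponding index list. For \<open>J\<close> of degree \<open>-q\<close> only \<open>u^q\<close>
  occurs, with a coefficient of form degree \<open>2 * q - q = q\<close>.\<close>

lemma Ch_beta_simp:
  assumes a: "a \<in> ord_maps k l" and b: "b \<in> ord_maps k n"
  shows "Ch_nerve M I U l (beta M r I U n h l (a, b)) \<in> simp (DK (Qu (nerve_forms M I U l))) k"
proof -
  let ?x = "Ch_nerve M I U l (beta M r I U n h l (a, b))"
  note Ch = Ch_beta[OF a b]
  have 1: "?x J = 0" if "J \<notin> nondeg k" for J using that by (simp add: Ch fun_eq_iff)
  have 2: "?x J \<in> gr (Qu (nerve_forms M I U l)) (length J - 1)" if J: "J \<in> nondeg k" for J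
  proof -
    let ?q = "length J - 1"
    have z: "?x J m = 0" if "m \<noteq> ?q" for m using that by (simp add: Ch fun_eq_iff)
    have "{m. ?x J m \<noteq> 0} \<subseteq> {?q}" using z by blast
    then have fin: "finite {m. ?x J m \<noteq> 0}" by (rule finite_subset) simp
    have "?x J ?q \<in> gr (nerve_forms M I U l) ?q"
    proof -
      have "?x J ?q js \<in> hol_form M ?q (cap U js)" if js: "js \<in> cidx I l" for js
        using hol_form_res[OF gamma_hol_form[OF vert_path(1)[OF a b js J]] vert_path(2)[OF a b js J]] J js
        by (simp add: Ch)
      then show ?thesis by (simp add: nerve_forms_def Ch)
    qed
    moreover have "0 \<in> gr (nerve_forms M I U l) q" for q by (simp add: nerve_forms_def hol_form_0)
    ultimately have "?x J m \<in> (if ?q \<le> 2 * m then gr (nerve_forms M I U l) (2 * m - ?q) else {0})" for m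
      using z[of m] by (cases "m = ?q") (auto simp: mult_2)
    then show ?thesis using fin unfolding Qu_def cplx.select_convs mem_Collect_eq by blast
  qed
  have 3: "df (Qu (nerve_forms M I U l)) (length J - 1) (?x J) = (\<Sum>j<length J. alt j (?x (del j J)))"
    if J: "J \<in> nondeg k" and len: "2 \<le> length J" for J
  proof (intro ext)
    fix m js p vs
    have L: "df (Qu (nerve_forms M I U l)) (length J - 1) (?x J) m = 0" by (simp add: Qu_def nerve_forms_def)
    have R: "(\<Sum>j<length J. alt j (?x (del j J))) m js p vs = (\<Sum>j<length J. alt j (?x (del j J) m js p vs))"
      by (simp add: sum_fun_apply alt_apply)
    have "(\<Sum>j<length J. alt j (?x (del j J) m js p vs)) = 0"
    proof (cases "js \<in> cidx I l \<and> m = length J - 2 \<and> p \<in> cap U js")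
      case True
      let ?w = "map (vert a b js) J"
      have js: "js \<in> cidx I l" and p: "p \<in> capb ?w" using True vert_path(2)[OF a b _ J] by auto
      have "(\<Sum>j<length J. alt j (?x (del j J) m js p vs)) = face_sum (\<lambda>w. gamma M r I U n h w p vs) ?w"
        unfolding face_sum_def length_map
        using True nondeg_del[OF J _ len] by (intro sum.cong) (auto simp: Ch length_del map_del res_form_def)
      also have "\<dots> = 0" by (rule face_sum_gamma[OF vert_path(1)[OF a b js J] _ p]) (use len in simp)
      finally show ?thesis .
    next
      case False
      then show ?thesis
        by (intro sum.neutral ballI) (auto simp: Ch length_del res_form_def)
    qed
    then show "df (Qu (nerve_forms M I U l)) (length J - 1) (?x J) m js p vs = (\<Sum>j<length J. alt j (?x (del j J))) m js p vs"
      unfolding L R by simp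
  qed
  show ?thesis using 1 2 3 by (simp add: DK_def)
qed

text \<open>If \<open>\<rho>\<close> makes \<open>J\<close> degenerate, the index list has equal
  neighbours and \<open>gamma\<close> vanishes there, in agreement with the action on
  \<open>DK\<close>.\<close>

lemma Ch_beta_act:
  assumes a: "a \<in> ord_maps k l" and b: "b \<in> ord_maps k n" and \<rho>: "\<rho> \<in> ord_maps k' k"
  shows "Ch_nerve M I U l (beta M r I U n h l (pick a \<rho>, pick b \<rho>)) =
    act (DK (Qu (nerve_forms M I U l))) \<rho> (Ch_nerve M I U l (beta M r I U n h l (a, b)))"
proof (intro ext)
  fix J m js p vs
  have len: "length \<rho> = Suc k'" using \<rho> by (simp add: ord_maps_def)
  note Ch = Ch_beta[OF a b] and Ch' = Ch_beta[OF pick_ord_maps[OF a \<rho>] pick_ord_maps[OF b \<rho>]]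
  have "Ch_nerve M I U l (beta M r I U n h l (pick a \<rho>, pick b \<rho>)) J m js =
      (if J \<in> nondeg k' \<and> distinct (pick \<rho> J) then Ch_nerve M I U l (beta M r I U n h l (a, b)) (pick \<rho> J) else 0) m js"
  proof (cases "J \<in> nondeg k' \<and> js \<in> cidx I l")
    case True
    then have J: "J \<in> nondeg k'" by simp
    have "map (vert (pick a \<rho>) (pick b \<rho>) js) J = map (vert a b js) (pick \<rho> J)"
      using J len by (auto simp: pick_def[of \<rho>] vert_def pick_nth nondeg_def less_Suc_eq_le)
    moreover have "gamma M r I U n h (map (vert a b js) (pick \<rho> J)) = 0" if "\<not> distinct (pick \<rho> J)"
      using that pick_nondeg(1)[OF \<rho> J] by (intro gamma_not_distinct_adj not_distinct_adj_map) simp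
    ultimately show ?thesis using True pick_nondeg(2)[OF \<rho> J] by (auto simp: Ch Ch')
  qed (auto simp: Ch Ch')
  then show "Ch_nerve M I U l (beta M r I U n h l (pick a \<rho>, pick b \<rho>)) J m js p vs =
    act (DK (Qu (nerve_forms M I U l))) \<rho> (Ch_nerve M I U l (beta M r I U n h l (a, b))) J m js p vs"
    by (simp add: DK_def len)
qed

lemma Tot_Ch_beta: "Tot_Ch M I U n (beta M r I U n h) \<in> simp (Tot (Omega_nerve M I U)) n"
proof -
  let ?F = "Tot_Ch M I U n (beta M r I U n h)"
  have F: "?F l (a, b) = Ch_nerve M I U l (beta M r I U n h l (a, b))" if "a \<in> ord_maps k l" "b \<in> ord_maps k n" for a b k l
  proof -
    have "(a, b) \<in> prism l n" using that by (auto simp: prism_iff)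
    then show ?thesis by (simp add: Tot_Ch_def)
  qed
  have Fext: "?F l \<in> extensional (prism l n)" for l by (simp add: Tot_Ch_def)
  have smap: "simplicial_map (prod_sset (std_simplex l) (std_simplex n)) (lev (Omega_nerve M I U) l) (\<lambda>_. ?F l)" for l
    unfolding simplicial_map_def
  proof (intro allI ballI)
    fix k x assume "x \<in> simp (prod_sset (std_simplex l) (std_simplex n)) k"
    then obtain a b where x: "x = (a, b)" and a: "a \<in> ord_maps k l" and b: "b \<in> ord_maps k n"
      by (auto simp: prod_sset_def std_simplex_def)
    show "?F l x \<in> simp (lev (Omega_nerve M I U) l) k \<and>
        (\<forall>k'. \<forall>\<rho>\<in>ord_maps k' k. ?F l (act (prod_sset (std_simplex l) (std_simplex n)) \<rho> x) =
           act (lev (Omega_nerve M I U) l) \<rho> (?F l x))"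
    proof (intro conjI allI ballI)
      show "?F l x \<in> simp (lev (Omega_nerve M I U) l) k"
        using Ch_beta_simp[OF a b] by (simp add: x F[OF a b] Omega_nerve_def)
      fix k' \<rho> assume \<rho>: "\<rho> \<in> ord_maps k' k"
      have "act (prod_sset (std_simplex l) (std_simplex n)) \<rho> x = (pick a \<rho>, pick b \<rho>)"
        by (simp add: x prod_sset_def std_simplex_def)
      then show "?F l (act (prod_sset (std_simplex l) (std_simplex n)) \<rho> x) = act (lev (Omega_nerve M I U) l) \<rho> (?F l x)"
        using Ch_beta_act[OF a b \<rho>] F[OF pick_ord_maps[OF a \<rho>] pick_ord_maps[OF b \<rho>]] F[OF a b]
        by (simp add: x Omega_nerve_def)
    qed
  qed
  have co: "?F m (pick \<rho> a, b) = coact (Omega_nerve M I U) m \<rho> (?F k (a, b))"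
    if \<rho>: "\<rho> \<in> ord_maps k m" and pr: "(a, b) \<in> prism k n" for k m \<rho> a b
  proof (intro ext)
    fix J u js p vs
    obtain q where a: "a \<in> ord_maps q k" and b: "b \<in> ord_maps q n" using pr by (auto simp: prism_iff)
    note pa = pick_ord_maps[OF \<rho> a]
    have "?F m (pick \<rho> a, b) J u js = coact (Omega_nerve M I U) m \<rho> (?F k (a, b)) J u js"
    proof (cases "js \<in> cidx I m \<and> J \<in> nondeg q")
      case True
      then have js: "js \<in> cidx I m" and J: "J \<in> nondeg q" by auto
      have eq: "map (vert (pick \<rho> a) b js) J = map (vert a b (pick js \<rho>)) J"
        using J a \<rho> ord_maps_nth[OF a] by (auto simp: vert_def pick_nth nondeg_def ord_maps_def less_Suc_eq_le)
      show ?thesis using js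
        by (simp add: eq F[OF pa b] F[OF a b] Ch_beta[OF pa b] Ch_beta[OF a b] Omega_nerve_def
            pick_cidx[OF js \<rho>] res_form_res_form[OF cap_pick[OF js \<rho>]])
    qed (auto simp: F[OF pa b] F[OF a b] Ch_beta[OF pa b] Ch_beta[OF a b] Omega_nerve_def)
    then show "?F m (pick \<rho> a, b) J u js p vs = coact (Omega_nerve M I U) m \<rho> (?F k (a, b)) J u js p vs" by simp
  qed
  show ?thesis unfolding Tot_def using Fext smap co by auto
qed

lemma Tot_Ch_beta_act:
  assumes \<rho>: "\<rho> \<in> ord_maps k n"
  shows "Tot_Ch M I U k (beta M r I U k (act (CMan M r I U) \<rho> h)) =
    act (Tot (Omega_nerve M I U)) \<rho> (Tot_Ch M I U n (beta M r I U n h))"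
proof (intro ext)
  fix l and z :: "nat list \<times> nat list" and J u js p vs
  have len: "length \<rho> = Suc k" using \<rho> by (simp add: ord_maps_def)
  obtain a b where z: "z = (a, b)" by (cases z)
  have "Tot_Ch M I U k (beta M r I U k (act (CMan M r I U) \<rho> h)) l z =
    act (Tot (Omega_nerve M I U)) \<rho> (Tot_Ch M I U n (beta M r I U n h)) l z"
  proof (cases "(a, b) \<in> prism l k")
    case True
    then obtain q where "a \<in> ord_maps q l" "b \<in> ord_maps q k" by (auto simp: prism_iff)
    then have "(a, pick \<rho> b) \<in> prism l n" using pick_ord_maps[OF \<rho>] by (auto simp: prism_iff)
    then show ?thesis using True len by (simp add: z beta_act[OF \<rho>] Tot_Ch_def Tot_def)
  qed (simp add: z Tot_Ch_def Tot_def len)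
  then show "Tot_Ch M I U k (beta M r I U k (act (CMan M r I U) \<rho> h)) l z J u js p vs =
    act (Tot (Omega_nerve M I U)) \<rho> (Tot_Ch M I U n (beta M r I U n h)) l z J u js p vs" by simp
qed

text \<open>A shuffle yields a simplex of the prism of dimension \<open>p + l\<close>, and
  evaluation on its top generator gives \<open>gamma\<close> along the lattice path of the shuffle.
  The shuffle signs are those of \<open>path_sum\<close>, which turns the Eilenberg-Zilber sum into
  a path sum.\<close>

lemma apply_EZ_Ch_beta:
  assumes J: "J \<in> nondeg n" and js: "js \<in> cidx I l"
  shows "apply_EZ (kappa_adj (Tot_Ch M I U n (beta M r I U n h)) l) J [0..<Suc l] m js =
    path_sum (homog (2 * m) (gamma M r I U n h)) js J"
proof -
  let ?g = "gamma M r I U n h"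
  obtain p where p: "length J = Suc p" using J by (cases J) (auto simp: nondeg_def)
  have ljs: "length js = Suc l" using js by (simp add: cidx_def)
  have term_eq: "kappa_adj (Tot_Ch M I U n (beta M r I U n h)) l (fold dup \<nu> J, fold dup \<mu> [0..<Suc l]) m js =
      homog (2 * m) ?g (zip (fold dup \<mu> js) (fold dup \<nu> J))" if s: "(\<mu>, \<nu>) \<in> shuffles_pq p l" for \<mu> \<nu>
  proof -
    define a where "a = fold dup \<mu> [0..<Suc l]"
    define b where "b = fold dup \<nu> J"
    let ?k = "p + l"
    let ?w = "zip (fold dup \<mu> js) b"
    note A = fold_dup_shuffle[OF s length_upt[of 0 "Suc l", unfolded diff_zero] p]
    have sJ: "sorted J" using J by (auto simp: nondeg_def intro: strict_sorted_imp_sorted)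
    have a: "a \<in> ord_maps ?k l" using A by (auto simp: ord_maps_def a_def simp del: upt_Suc)
    have b: "b \<in> ord_maps ?k n" using A J sJ by (auto simp: ord_maps_def b_def nondeg_def simp del: upt_Suc)
    have pr: "(a, b) \<in> prism l n" using a b by (auto simp: prism_iff)
    have la: "length a = Suc ?k" "length b = Suc ?k" using a b by (auto simp: ord_maps_def)
    \<comment> \<open>\<open>a\<close> is a degeneracy of the identity map, so composing
      \<open>js\<close> with it gives the same degeneracy of \<open>js\<close>.\<close>
    have fa: "map ((!) js) a = fold dup \<mu> js"
      unfolding a_def map_fold_dup using map_nth[of js] ljs by simp
    have "set (fold dup \<mu> js) = set (map ((!) js) [0..<Suc l])"
      unfolding fa[symmetric] set_map using A by (simp add: a_def del: upt_Suc)
    also have "map ((!) js) [0..<Suc l] = js" using map_nth[of js] ljs by simp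
    finally have B: "set (fold dup \<mu> js) = set js" "length (fold dup \<mu> js) = Suc ?k"
      using la unfolding fa[symmetric] by simp_all
    have w: "map (vert a b js) [0..<Suc ?k] = ?w"
      by (rule nth_equalityI) (use la in \<open>auto simp: vert_def fa[symmetric] simp del: upt_Suc\<close>)
    have lw: "length ?w = Suc ?k" using B la by simp
    have "cap (brcov U) ?w = cap U js"
      using B la unfolding cap_brcov by (simp add: cap_def)
    moreover have wX: "?w \<in> cidx_all X"
      using vert_path(1)[OF a b js upt_nondeg] w by simp
    ultimately have gf: "?g ?w \<in> hol_form M ?k (cap U js)"
      using gamma_hol_form[OF wX] lw by simp
    have "kappa_adj (Tot_Ch M I U n (beta M r I U n h)) l (b, a) m js =
        (if m = ?k then res_form (cap U js) (?g ?w) else 0)"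
      using pr js upt_nondeg[of ?k] by (simp add: kappa_adj_def Tot_Ch_def la Ch_beta[OF a b] w del: upt_Suc)
    also have "\<dots> = (if m = ?k then ?g ?w else 0)"
      using res_form_hol_form[OF gf] by simp
    \<comment> \<open>Cech degree and form degree are both \<open>?k\<close>, so selecting the power
      \<open>u^m\<close> is the same as selecting total degree \<open>2 * m\<close>.\<close>
    also have "\<dots> = homog (2 * m) ?g ?w"
    proof (intro ext)
      fix q vs
      have "length vs = ?k" if "?g ?w q vs \<noteq> 0" using hol_form_support[OF gf that] by simp
      then show "(if m = ?k then ?g ?w else 0) q vs = homog (2 * m) ?g ?w q vs"
        unfolding homog_def lw by (cases "?g ?w q vs = 0") auto
    qed
    finally show ?thesis by (simp add: a_def b_def)
  qed
  have "apply_EZ (kappa_adj (Tot_Ch M I U n (beta M r I U n h)) l) J [0..<Suc l] m js =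
      (\<Sum>(\<mu>, \<nu>)\<in>shuffles_pq p l. alt (shuffle_inv \<mu> \<nu>)
        (kappa_adj (Tot_Ch M I U n (beta M r I U n h)) l (fold dup \<nu> J, fold dup \<mu> [0..<Suc l]) m js))"
    unfolding apply_EZ_def p length_upt by (simp add: sum_fun_apply alt_apply case_prod_beta del: upt_Suc)
  also have "\<dots> = (\<Sum>(\<mu>, \<nu>)\<in>shuffles_pq p l. alt (shuffle_inv \<mu> \<nu>) (homog (2 * m) ?g (zip (fold dup \<mu> js) (fold dup \<nu> J))))"
    using term_eq by (intro sum.cong refl) (auto simp del: upt_Suc)
  also have "\<dots> = path_sum (homog (2 * m) ?g) js J"
    by (rule sum_shuffles_eq_path_sum[OF ljs p])
  finally show ?thesis .
qed

text \<open>The prefactors of \<open>iota\<close> and \<open>kappa\<close> have the same exponent,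
  which depends only on the length of \<open>J\<close>; what remains on both sides is the same path
  sum.\<close>

theorem iota_gamma_eq_kappa:
  "iota I n (gamma M r I U n h) = kappa I n (Tot_Ch M I U n (beta M r I U n h))"
proof (intro ext)
  fix J m js p vs
  have "iota I n (gamma M r I U n h) J m js = kappa I n (Tot_Ch M I U n (beta M r I U n h)) J m js"
  proof (cases "J \<in> nondeg n \<and> js \<in> cidx_all I")
    case True
    then have J: "J \<in> nondeg n" and jsa: "js \<in> cidx_all I" by auto
    have js: "js \<in> cidx I (length js - 1)" using jsa by (cases js) (auto simp: cidx_all_iff cidx_def)
    have "iota I n (gamma M r I U n h) J m js =
        alt ((length J - 1) * (length J - 1 - 1) div 2) (path_sum (homog (2 * m) (gamma M r I U n h)) js J)"
      by (rule iota_apply[OF J jsa])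
    then show ?thesis
      unfolding apply_EZ_Ch_beta[OF J js, symmetric] using J jsa
      by (simp add: kappa_def kappa_tot_def Let_def alt_apply del: upt_Suc)
  next
    case False
    then show ?thesis
      by (auto simp: iota_outside kappa_def kappa_tot_def Let_def alt_apply) (simp add: iota_def Let_def)
  qed
  then show "iota I n (gamma M r I U n h) J m js p vs = kappa I n (Tot_Ch M I U n (beta M r I U n h)) J m js p vs"
    by simp
qed

end

context cman_cover
begin

lemma Tot_Ch_simplicial:
  "simplicial_map (CMan M r I U) (Tot (Omega_nerve M I U)) (\<lambda>n. Tot_Ch M I U n \<circ> beta M r I U n)"
  unfolding simplicial_map_def o_def
proof (intro allI ballI conjI)
  fix n h assume "h \<in> simp (CMan M r I U) n"
  then interpret cman_map M I U r n h by unfold_locales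
  show "Tot_Ch M I U n (beta M r I U n h) \<in> simp (Tot (Omega_nerve M I U)) n" by (rule Tot_Ch_beta)
  show "Tot_Ch M I U k (beta M r I U k (act (CMan M r I U) \<rho> h)) =
      act (Tot (Omega_nerve M I U)) \<rho> (Tot_Ch M I U n (beta M r I U n h))" if "\<rho> \<in> ord_maps k n" for k \<rho>
    using that by (rule Tot_Ch_beta_act)
qed

lemma diagram_commutes:
  assumes "h \<in> simp (CMan M r I U) n"
  shows "iota I n (gamma M r I U n h) = kappa I n (Tot_Ch M I U n (beta M r I U n h))"
proof -
  interpret cman_map M I U r n h using assms by unfold_locales
  show ?thesis by (rule iota_gamma_eq_kappa)
qed

end

text \<open>The lower composite is simplicial with values in the corner because, on every simplex
  \<open>h\<close>, it equals the upper one, for which this is a separate conjunct.\<close>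

theorem theorem4p17:
  fixes M :: "'a cmfd" and I :: "'i set" and U :: "'i \<Rightarrow> 'a set" and r :: nat
  assumes manifold: "complex_manifold M"
    and cover_open: "\<And>i. i \<in> I \<Longrightarrow> openin (mtop M) (U i)"
    and cover: "(\<Union>i\<in>I. U i) = topspace (mtop M)"
  shows
    "simplicial_map (CMan M r I U) (cech_even_closed M I U) (gamma M r I U) \<and>
     (\<forall>n. \<forall>c\<in>simp (cech_even_closed M I U) n. iota I n c \<in> simp (DK (Qu (cech M I U))) n) \<and>
     simplicial_map (CMan M r I U) (Tot (HVB_nerve M I U)) (beta M r I U) \<and>
     simplicial_map (CMan M r I U) (Tot (Omega_nerve M I U)) (\<lambda>n. Tot_Ch M I U n \<circ> beta M r I U n) \<and>
     simplicial_map (CMan M r I U) (DK (Qu (cech M I U))) (\<lambda>n. iota I n \<circ> gamma M r I U n) \<and>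
     (\<forall>n. \<forall>h\<in>simp (CMan M r I U) n.
        (iota I n \<circ> gamma M r I U n) h = (kappa I n \<circ> Tot_Ch M I U n \<circ> beta M r I U n) h)"
proof -
  interpret cman_cover M I U r
    by unfold_locales (use manifold cover_open in auto)
  show ?thesis
    using gamma_simplicial iota_simp beta_simplicial Tot_Ch_simplicial iota_gamma_simplicial diagram_commutes
    by simp
qed

end
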